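(* Let $p$ be a prime and let $G$ be a finite $p$-separable group. Suppose that $x^G,y^G\in\operatorname{Con}(G_{p'})$ are non-central classes with $d(x^G,y^G)=3$ in $\Gamma_p(G)$. Set $\pi_x=\pi(x^G)$, $\pi_y=\pi(y^G)$ and $\pi=\pi_x\cup\pi_y$. If $p$ divides $\min(|x^G|,|y^G|)$, then $G$ is $p$-nilpotent, and every $p$-complement $H$ of $G$ satisfies the following: $H=\mathbf{O}_{\pi}(H)\times\mathbf{O}_{\pi'}(H)$, where $\mathbf{O}_{\pi}(H)$ is a quasi-Frobenius group with abelian kernel and complements; each complement of $\mathbf{O}_{\pi}(H)$ (in the quasi-Frobenius sense) is centralised by some Sylow $p$-subgroup of $G$; and $\mathbf{Z}(H)=H\cap\mathbf{Z}(G)$.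
   Context: All groups are finite. A group is $p$-separable if it has a normal series each of whose factors is either a $p$-group or a $p'$-group (a group of order not divisible by $p$). An element of $G$ is $p$-regular if its order is not divisible by $p$; $G_{p'}$ denotes the set of $p$-regular elements of $G$, and $\operatorname{Con}(G_{p'})=\{x^G : x\in G_{p'}\}$, where $x^G$ is the conjugacy class of $x$ in $G$. A class $x^G$ is non-central if $x\notin \mathbf{Z}(G)$, where $\mathbf{Z}(G)$ is the centre of $G$. The common divisor graph $\Gamma_p(G)$ is the simple undirected graph whose vertices are the non-central classes in $\operatorname{Con}(G_{p'})$, with two distinct vertices $B$ and $C$ adjacent if and only if $\gcd(|B|,|C|)>1$; $d(B,C)$ denotes the distance in $\Gamma_p(G)$ between vertices $B$ and $C$ (the number of edges in a shortest path joining them, or $\infty$ if there is none). For $g\in G$, $\pi(g^G)$ is the set of prime divisors of $|g^G|$. For a set of primes $\pi$, $\pi'$ is the set of primes not in $\pi$, and $\mathbf{O}_{\pi}(H)$ is the largest normal $\pi$-subgroup of $H$. A $p$-complement of $G$ is a Hall $p'$-subgroup of $G$; $G$ is $p$-nilpotent if it has a normal $p$-complement. A group $K$ is quasi-Frobenius if $K/\mathbf{Z}(K)$ is a Frobenius group; the inverse images in $K$ of the Frobenius kernel and of a Frobenius complement of $K/\mathbf{Z}(K)$ are then called the kernel and a complement of $K$, respectively. *)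

theory Defs
  imports
    "HOL-Algebra.Algebra"
    "Graph_Theory.Shortest_Path"
    "Graph_Theory.Pair_Digraph"
begin

hide_const (open) Divisibility.prime

text \<open>
  The orders below are cardinalities and hence only meaningful for finite groups, which is the
  setting throughout. The subgroup \<open>H\<close>, regarded as a group, is \<open>G\<lparr>carrier := H\<rparr>\<close>.
\<close>

section \<open>Centralizers, classes, and sets of primes\<close>

definition centralizer :: "('a, 'b) monoid_scheme \<Rightarrow> 'a set \<Rightarrow> 'a set" where
  "centralizer G S = {g \<in> carrier G. \<forall>s \<in> S. g \<otimes>\<^bsub>G\<^esub> s = s \<otimes>\<^bsub>G\<^esub> g}"

definition center :: "('a, 'b) monoid_scheme \<Rightarrow> 'a set" where
  "center G = centralizer G (carrier G)"

definition conj_class :: "('a, 'b) monoid_scheme \<Rightarrow> 'a \<Rightarrow> 'a set" where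
  "conj_class G x = (\<lambda>g. inv\<^bsub>G\<^esub> g \<otimes>\<^bsub>G\<^esub> x \<otimes>\<^bsub>G\<^esub> g) ` carrier G"

definition class_primes :: "('a, 'b) monoid_scheme \<Rightarrow> 'a \<Rightarrow> nat set" where
  "class_primes G x = prime_factors (card (conj_class G x))"

definition compl_primes :: "nat set \<Rightarrow> nat set" where
  "compl_primes \<pi> = {q. prime q \<and> q \<notin> \<pi>}"

definition pi_group :: "nat set \<Rightarrow> ('a, 'b) monoid_scheme \<Rightarrow> bool" where
  "pi_group \<pi> G \<longleftrightarrow> (\<forall>q. prime q \<longrightarrow> q dvd order G \<longrightarrow> q \<in> \<pi>)"

definition p_group :: "nat \<Rightarrow> ('a, 'b) monoid_scheme \<Rightarrow> bool" where
  "p_group p G \<longleftrightarrow> (\<exists>k. order G = p ^ k)"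

definition p'_group :: "nat \<Rightarrow> ('a, 'b) monoid_scheme \<Rightarrow> bool" where
  "p'_group p G \<longleftrightarrow> \<not> p dvd order G"

definition p_separable :: "nat \<Rightarrow> ('a, 'b) monoid_scheme \<Rightarrow> bool" where
  "p_separable p G \<longleftrightarrow>
     (\<exists>(r::nat) N. N 0 = {\<one>\<^bsub>G\<^esub>} \<and> N r = carrier G \<and> (\<forall>i\<le>r. N i \<lhd> G) \<and>
        (\<forall>i<r. N i \<subseteq> N (Suc i) \<and>
           (p_group p (G\<lparr>carrier := N (Suc i)\<rparr> Mod N i) \<or>
            p'_group p (G\<lparr>carrier := N (Suc i)\<rparr> Mod N i))))"

definition p_regular :: "nat \<Rightarrow> ('a, 'b) monoid_scheme \<Rightarrow> 'a set" where
  "p_regular p G = {x \<in> carrier G. \<not> p dvd group.ord G x}"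

definition p_regular_classes :: "nat \<Rightarrow> ('a, 'b) monoid_scheme \<Rightarrow> 'a set set" where
  "p_regular_classes p G = conj_class G ` p_regular p G"


section \<open>The common divisor graph\<close>

text \<open>An undirected edge is a pair of opposite arcs.\<close>

definition common_divisor_graph ::
    "nat \<Rightarrow> ('a, 'b) monoid_scheme \<Rightarrow> 'a set pair_pre_digraph" where
  "common_divisor_graph p G =
     (let V = {conj_class G x | x. x \<in> carrier G \<and> x \<notin> center G \<and>
                                 conj_class G x \<in> p_regular_classes p G}
      in \<lparr>pverts = V,
          parcs = {(B, C). B \<in> V \<and> C \<in> V \<and> B \<noteq> C \<and> gcd (card B) (card C) > 1}\<rparr>)"

lemma pair_graph_common_divisor_graph:
  assumes "finite (carrier G)"
  shows "pair_graph (common_divisor_graph p G)"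
proof -
  have fin: "finite (pverts (common_divisor_graph p G))"
    by (rule finite_subset[OF _ finite_imageI[OF assms, of "conj_class G"]])
       (auto simp: common_divisor_graph_def Let_def)
  have "parcs (common_divisor_graph p G)
      \<subseteq> pverts (common_divisor_graph p G) \<times> pverts (common_divisor_graph p G)"
    by (auto simp: common_divisor_graph_def Let_def)
  then have "finite (parcs (common_divisor_graph p G))"
    by (rule finite_subset) (simp add: fin)
  with fin show ?thesis
    by unfold_locales
       (auto simp: common_divisor_graph_def Let_def symmetric_def sym_def gcd.commute)
qed

text \<open>Minimal length of a walk; it is \<open>\<infinity>\<close> if there is none.\<close>

definition graph_dist :: "'v pair_pre_digraph \<Rightarrow> 'v \<Rightarrow> 'v \<Rightarrow> ereal" where
  "graph_dist \<Gamma> u v = wf_digraph.\<mu> (with_proj \<Gamma>) (\<lambda>_. 1) u v"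


section \<open>Hall and Sylow subgroups, and the largest normal \<open>\<pi>\<close>-subgroup\<close>

definition hall_subgroup :: "nat set \<Rightarrow> ('a, 'b) monoid_scheme \<Rightarrow> 'a set \<Rightarrow> bool" where
  "hall_subgroup \<pi> G H \<longleftrightarrow> subgroup H G \<and> pi_group \<pi> (G\<lparr>carrier := H\<rparr>) \<and>
     (\<forall>q. prime q \<longrightarrow> q dvd card (rcosets\<^bsub>G\<^esub> H) \<longrightarrow> q \<notin> \<pi>)"

definition p_complement :: "nat \<Rightarrow> ('a, 'b) monoid_scheme \<Rightarrow> 'a set \<Rightarrow> bool" where
  "p_complement p G H \<longleftrightarrow> hall_subgroup (compl_primes {p}) G H"

definition p_nilpotent :: "nat \<Rightarrow> ('a, 'b) monoid_scheme \<Rightarrow> bool" where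
  "p_nilpotent p G \<longleftrightarrow> (\<exists>N. p_complement p G N \<and> N \<lhd> G)"

definition sylow_subgroup :: "nat \<Rightarrow> ('a, 'b) monoid_scheme \<Rightarrow> 'a set \<Rightarrow> bool" where
  "sylow_subgroup p G P \<longleftrightarrow> subgroup P G \<and> card P = p ^ multiplicity p (order G)"

definition normal_pi_subgroup :: "nat set \<Rightarrow> ('a, 'b) monoid_scheme \<Rightarrow> 'a set \<Rightarrow> bool" where
  "normal_pi_subgroup \<pi> G N \<longleftrightarrow> N \<lhd> G \<and> pi_group \<pi> (G\<lparr>carrier := N\<rparr>)"

definition pi_core :: "nat set \<Rightarrow> ('a, 'b) monoid_scheme \<Rightarrow> 'a set" where
  "pi_core \<pi> G =
     (THE N. normal_pi_subgroup \<pi> G N \<and> (\<forall>M. normal_pi_subgroup \<pi> G M \<longrightarrow> M \<subseteq> N))"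

lemma (in group) normal_pi_subgroup_set_mult:
  assumes fin: "finite (carrier G)"
    and M: "normal_pi_subgroup \<pi> G M" and N: "normal_pi_subgroup \<pi> G N"
  shows "normal_pi_subgroup \<pi> G (M <#> N)"
proof -
  from M N have nM: "M \<lhd> G" and nN: "N \<lhd> G" by (auto simp: normal_pi_subgroup_def)
  have sN: "subgroup N G" by (rule normal_imp_subgroup[OF nN])
  interpret S: second_isomorphism_grp M G N
    using nM sN by (simp add: second_isomorphism_grp_def second_isomorphism_grp_axioms_def)
  have sMN: "subgroup (M <#> N) G" by (rule S.normal_set_mult_subgroup)
  have "q \<in> \<pi>" if q: "prime q" "q dvd card (M <#> N)" for q
  proof -
    interpret K: group "G\<lparr>carrier := M <#> N\<rparr>" by (rule subgroup_imp_group[OF sMN])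
    interpret L: group "G\<lparr>carrier := N\<rparr>" by (rule subgroup_imp_group[OF sN])
    have finK: "finite (M <#> N)" by (rule finite_subset[OF subgroup.subset[OF sMN] fin])
    have finL: "finite N" by (rule finite_subset[OF subgroup.subset[OF sN] fin])
    have "subgroup M (G\<lparr>carrier := M <#> N\<rparr>)"
      by (rule subgroup_incl[OF normal_imp_subgroup[OF nM] sMN S.H_contained_in_set_mult])
    from K.lagrange_finite[OF _ this] finK
    have 1: "card (rcosets\<^bsub>G\<lparr>carrier := M <#> N\<rparr>\<^esub> M) * card M = card (M <#> N)"
      by (simp add: order_def)
    have "subgroup (M \<inter> N) (G\<lparr>carrier := N\<rparr>)"
      using normal_imp_subgroup[OF S.normal_subgrp_intersection_normal] by (simp add: Int_commute)
    from L.lagrange_finite[OF _ this] finL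
    have 2: "card (rcosets\<^bsub>G\<lparr>carrier := N\<rparr>\<^esub> (M \<inter> N)) * card (M \<inter> N) = card N"
      by (simp add: order_def)
    have 3: "card (rcosets\<^bsub>G\<lparr>carrier := N\<rparr>\<^esub> (M \<inter> N)) = card (rcosets\<^bsub>G\<lparr>carrier := M <#> N\<rparr>\<^esub> M)"
      using iso_same_card[OF is_isoI[OF S.normal_intersection_quotient_isom]]
      by (simp add: FactGroup_def)
    from q 1 have "q dvd card (rcosets\<^bsub>G\<lparr>carrier := M <#> N\<rparr>\<^esub> M) \<or> q dvd card M"
      by (metis prime_dvd_mult_iff)
    then have "q dvd card N \<or> q dvd card M"
      using 2 3 by (metis dvd_mult2)
    with q(1) M N show ?thesis by (auto simp: normal_pi_subgroup_def pi_group_def order_def)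
  qed
  with normal_subgroup_set_mult_closed[OF nM nN] show ?thesis
    by (simp add: normal_pi_subgroup_def pi_group_def order_def)
qed

lemma (in group) pi_core_largest:
  assumes fin: "finite (carrier G)"
  shows "normal_pi_subgroup \<pi> G (pi_core \<pi> G)"
    and "normal_pi_subgroup \<pi> G M \<Longrightarrow> M \<subseteq> pi_core \<pi> G"
proof -
  have one: "normal_pi_subgroup \<pi> G {\<one>}"
    by (simp add: normal_pi_subgroup_def one_is_normal pi_group_def order_def)
  have bound: "card N \<le> card (carrier G)" if "normal_pi_subgroup \<pi> G N" for N
    using that fin by (auto simp: normal_pi_subgroup_def dest!: normal_imp_subgroup subgroup.subset
        intro: card_mono)
  obtain N where N: "normal_pi_subgroup \<pi> G N"
    and mx: "\<And>M. normal_pi_subgroup \<pi> G M \<Longrightarrow> card M \<le> card N"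
    using ex_has_greatest_nat[of "normal_pi_subgroup \<pi> G" "{\<one>}" card "Suc (card (carrier G))"]
      one bound by (auto simp: less_Suc_eq_le)
  have max: "M \<subseteq> N" if M: "normal_pi_subgroup \<pi> G M" for M
  proof -
    have MN: "normal_pi_subgroup \<pi> G (M <#> N)"
      by (rule normal_pi_subgroup_set_mult[OF fin M N])
    interpret S: second_isomorphism_grp M G N
      using M N by (auto simp: normal_pi_subgroup_def second_isomorphism_grp_def
          second_isomorphism_grp_axioms_def intro: normal_imp_subgroup)
    have "finite (M <#> N)"
      using MN fin by (auto simp: normal_pi_subgroup_def dest!: normal_imp_subgroup subgroup.subset
          intro: finite_subset)
    then have "N = M <#> N"
      using mx[OF MN] S.S_contained_in_set_mult by (metis card_seteq)
    with S.H_contained_in_set_mult show ?thesis by simp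
  qed
  have "normal_pi_subgroup \<pi> G (pi_core \<pi> G) \<and>
      (\<forall>M. normal_pi_subgroup \<pi> G M \<longrightarrow> M \<subseteq> pi_core \<pi> G)"
    unfolding pi_core_def
    by (rule theI[of _ N]) (use N max in blast)+
  then show "normal_pi_subgroup \<pi> G (pi_core \<pi> G)"
    and "normal_pi_subgroup \<pi> G M \<Longrightarrow> M \<subseteq> pi_core \<pi> G" by blast+
qed

definition internal_direct_product ::
    "('a, 'b) monoid_scheme \<Rightarrow> 'a set \<Rightarrow> 'a set \<Rightarrow> bool" where
  "internal_direct_product G A B \<longleftrightarrow>
     A \<lhd> G \<and> B \<lhd> G \<and> A \<inter> B = {\<one>\<^bsub>G\<^esub>} \<and> A <#>\<^bsub>G\<^esub> B = carrier G"


section \<open>Frobenius and quasi-Frobenius groups\<close>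

definition conj_set :: "('a, 'b) monoid_scheme \<Rightarrow> 'a set \<Rightarrow> 'a \<Rightarrow> 'a set" where
  "conj_set G C g = (\<lambda>c. inv\<^bsub>G\<^esub> g \<otimes>\<^bsub>G\<^esub> c \<otimes>\<^bsub>G\<^esub> g) ` C"

definition frobenius_complement :: "('a, 'b) monoid_scheme \<Rightarrow> 'a set \<Rightarrow> bool" where
  "frobenius_complement G C \<longleftrightarrow>
     subgroup C G \<and> C \<noteq> {\<one>\<^bsub>G\<^esub>} \<and> C \<noteq> carrier G \<and>
     (\<forall>g \<in> carrier G - C. C \<inter> conj_set G C g = {\<one>\<^bsub>G\<^esub>})"

definition frobenius_group :: "('a, 'b) monoid_scheme \<Rightarrow> bool" where
  "frobenius_group G \<longleftrightarrow> group G \<and> finite (carrier G) \<and> (\<exists>C. frobenius_complement G C)"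

text \<open>
  The kernel is the identity together with all elements lying in no conjugate of the complement;
  by Frobenius's theorem it is a normal subgroup.
\<close>

definition frobenius_kernel :: "('a, 'b) monoid_scheme \<Rightarrow> 'a set \<Rightarrow> bool" where
  "frobenius_kernel G N \<longleftrightarrow>
     (\<exists>C. frobenius_complement G C \<and>
        N = insert \<one>\<^bsub>G\<^esub> (carrier G - (\<Union>g \<in> carrier G. conj_set G C g)))"

definition quasi_frobenius :: "('a, 'b) monoid_scheme \<Rightarrow> bool" where
  "quasi_frobenius K \<longleftrightarrow> group K \<and> frobenius_group (K Mod center K)"

definition center_preimage :: "('a, 'b) monoid_scheme \<Rightarrow> 'a set set \<Rightarrow> 'a set" where
  "center_preimage K S = {k \<in> carrier K. center K #>\<^bsub>K\<^esub> k \<in> S}"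

definition qf_kernel :: "('a, 'b) monoid_scheme \<Rightarrow> 'a set \<Rightarrow> bool" where
  "qf_kernel K N \<longleftrightarrow>
     (\<exists>S. frobenius_kernel (K Mod center K) S \<and> N = center_preimage K S)"

definition qf_complement :: "('a, 'b) monoid_scheme \<Rightarrow> 'a set \<Rightarrow> bool" where
  "qf_complement K C \<longleftrightarrow>
     (\<exists>S. frobenius_complement (K Mod center K) S \<and> C = center_preimage K S)"

end

(*
  Let a, b be the two elements, named so that |a^G| < |b^G|; then p divides |a^G| and not |b^G|.
  As the distance is 3, no p-regular class size has a common factor with both |a^G| and |b^G|.

  The product of the two classes is one class, whose size must be |b^G|; hence b^G is a union of cosets
  of M, the normal subgroup generated by the quotients of the elements of a^G.  Since |M| divides
  |b^G|, it is prime to |a^G|, so a centralises M; thus M is abelian and, up to a central factor, a lies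
  in M.  One may also replace b by a non-central primary component of it, a q-element.

  A p-regular element that does not centralise M has class size prime to |a^G|, hence centralises a
  Sylow p-subgroup and lies in V = O_p'(G) by a Hall-Higman argument.  Multiplying by such an element
  puts every p-regular element into V, so V is a normal p-complement.  That such an element exists, and
  that b is one, follows by excluding the case that b centralises M.

  Put W = C_V(M) and Y = C_V(b).  The elements of V outside W centralise a Sylow r-subgroup for every
  prime r dividing |a^G|; counting conjugates of C_V(R) shows that distinct conjugates of Y meet inside W
  and cover V outside W.  The class sizes of elements of W turn out to be prime to |b^G|, which makes
  the Sylow subgroups of W for the primes of |b^G| central in W.  They form the abelian kernel, the Sylow
  subgroups of Y for the other primes of |a^G| form the complement, and a central transfer splits
  off the remaining part of Y and W as a direct factor of V.
*)
theory Submission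
  imports Defs "HOL-Number_Theory.Cong"
begin

text \<open>Nothing is assumed about p-singular elements, so before separation is applied to a
  product, the product must be shown to be p-regular; one factor is therefore always taken in a
  normal p'-subgroup, \<open>V\<close> or \<open>M\<close>.

  The class of ab contains translates of b^G and its size divides |a^G| |b^G|; separation leaves a
  divisor of one factor, and |a^G| < |b^G| decides which. After b is replaced by a primary component
  this inequality may be lost, so the same step needs a second argument. A primary component is
  wanted because a q-element centralised by a Sylow q-subgroup R lies in R, which gives C_V(R) =
  C_V(b).

  That p divides |a^G| enters twice: class sizes prime to |a^G| are then prime to p, as the
  Hall-Higman argument requires, and p becomes one of the primes r for which C_V(R) is controlled,
  which produces the Sylow p-subgroup centralising the complement.

  One counting lemma, \<open>union_of_conjugates\<close>, gives both the factorisations H = YW and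
  the fact that conjugates of Y meet only inside W. Normal complements to central subgroups come
  from a transfer homomorphism.\<close>

locale finite_group = group +
  assumes fin: "finite (carrier G)"
begin

definition conjugate :: "'a \<Rightarrow> 'a \<Rightarrow> 'a" (infixl "\<frown>" 85) where
  "x \<frown> g = inv g \<otimes> x \<otimes> g"

text \<open>Orbits, centralisers, normality and Sylow subgroups are taken relative to a subset
  \<open>H\<close> of one ambient group, so that arguments can move between \<open>G\<close>,
  \<open>V\<close>, \<open>W\<close> and smaller subgroups without changing the carrier.\<close>

definition orb :: "'a set \<Rightarrow> 'a \<Rightarrow> 'a set" where
  "orb H x = (\<lambda>h. x \<frown> h) ` H"

definition cz :: "'a set \<Rightarrow> 'a set \<Rightarrow> 'a set" where
  "cz H D = {h \<in> H. \<forall>x\<in>D. h \<otimes> x = x \<otimes> h}"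

definition normal_in :: "'a set \<Rightarrow> 'a set \<Rightarrow> bool" where
  "normal_in N H \<longleftrightarrow> subgroup N G \<and> N \<subseteq> H \<and> (\<forall>n\<in>N. \<forall>h\<in>H. n \<frown> h \<in> N)"

definition sylow_in :: "nat \<Rightarrow> 'a set \<Rightarrow> 'a set \<Rightarrow> bool" where
  "sylow_in r H R \<longleftrightarrow> subgroup R G \<and> R \<subseteq> H \<and> card R = r ^ multiplicity r (card H)"

lemma conj_class_eq_orb: "conj_class G x = orb (carrier G) x"
  by (simp add: conj_class_def orb_def conjugate_def)

subsection \<open>Conjugation\<close>

lemma conj_closed [simp]: "x \<in> carrier G \<Longrightarrow> g \<in> carrier G \<Longrightarrow> x \<frown> g \<in> carrier G"
  by (simp add: conjugate_def)

lemma inv_mult_cancel: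
  "x \<in> carrier G \<Longrightarrow> y \<in> carrier G \<Longrightarrow> x \<otimes> (inv x \<otimes> y) = y"
  "x \<in> carrier G \<Longrightarrow> y \<in> carrier G \<Longrightarrow> inv x \<otimes> (x \<otimes> y) = y"
  by (simp_all add: m_assoc[symmetric])

lemma conj_mult:
  "\<lbrakk>x \<in> carrier G; y \<in> carrier G; g \<in> carrier G\<rbrakk> \<Longrightarrow> (x \<otimes> y) \<frown> g = x \<frown> g \<otimes> y \<frown> g"
  by (simp add: conjugate_def m_assoc inv_mult_cancel)

lemma conj_conj:
  "\<lbrakk>x \<in> carrier G; g \<in> carrier G; h \<in> carrier G\<rbrakk> \<Longrightarrow> x \<frown> g \<frown> h = x \<frown> (g \<otimes> h)"
  by (simp add: conjugate_def m_assoc inv_mult_group)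

lemma conj_one [simp]: "x \<in> carrier G \<Longrightarrow> x \<frown> \<one> = x"
  by (simp add: conjugate_def)

lemma one_conj [simp]: "g \<in> carrier G \<Longrightarrow> \<one> \<frown> g = \<one>"
  by (simp add: conjugate_def)

lemma conj_inv_cancel [simp]:
  "\<lbrakk>x \<in> carrier G; g \<in> carrier G\<rbrakk> \<Longrightarrow> x \<frown> g \<frown> (inv g) = x"
  "\<lbrakk>x \<in> carrier G; g \<in> carrier G\<rbrakk> \<Longrightarrow> x \<frown> (inv g) \<frown> g = x"
  by (simp_all add: conj_conj)

lemma conj_inj:
  "\<lbrakk>x \<in> carrier G; y \<in> carrier G; g \<in> carrier G\<rbrakk> \<Longrightarrow> x \<frown> g = y \<frown> g \<longleftrightarrow> x = y"
  by (metis conj_inv_cancel(1))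

lemma inj_on_conj: "g \<in> carrier G \<Longrightarrow> D \<subseteq> carrier G \<Longrightarrow> inj_on (\<lambda>x. x \<frown> g) D"
  by (auto simp: inj_on_def conj_inj subset_iff)

lemma inv_conj: "\<lbrakk>x \<in> carrier G; g \<in> carrier G\<rbrakk> \<Longrightarrow> inv (x \<frown> g) = (inv x) \<frown> g"
  by (simp add: conjugate_def m_assoc inv_mult_group)

lemma pow_conj: "\<lbrakk>x \<in> carrier G; g \<in> carrier G\<rbrakk> \<Longrightarrow> (x [^] (n::nat)) \<frown> g = (x \<frown> g) [^] n"
  by (induction n) (simp_all add: conj_mult)

lemma conj_fix: "\<lbrakk>x \<in> carrier G; g \<in> carrier G\<rbrakk> \<Longrightarrow> x \<frown> g = x \<longleftrightarrow> g \<otimes> x = x \<otimes> g"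
  unfolding conjugate_def by (metis inv_closed inv_solve_left m_assoc m_closed)

lemma ord_conj [simp]:
  assumes "x \<in> carrier G" "g \<in> carrier G" shows "ord (x \<frown> g) = ord x"
proof -
  have "(x \<frown> g) [^] n = \<one> \<longleftrightarrow> x [^] n = \<one>" for n :: nat
    using assms conj_inj[of "x [^] n" \<one> g] by (simp add: pow_conj[symmetric])
  then have "ord (x \<frown> g) dvd n \<longleftrightarrow> ord x dvd n" for n
    using assms by (simp add: pow_eq_id[symmetric])
  then show ?thesis by (meson dvd_antisym dvd_refl)
qed

subsection \<open>Subgroups of a finite group\<close>

lemma finite_sub [simp]: "subgroup H G \<Longrightarrow> finite H"
  using fin finite_subset subgroup.subset by blast

lemma card_sub_pos: "subgroup H G \<Longrightarrow> card H > 0"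
  using subgroup.one_closed card_gt_0_iff finite_sub by fastforce

lemma sub_carrier: "subgroup H G \<Longrightarrow> x \<in> H \<Longrightarrow> x \<in> carrier G"
  by (rule subgroup.mem_carrier)

lemma sub_pow: "subgroup H G \<Longrightarrow> x \<in> H \<Longrightarrow> x [^] (n::nat) \<in> H"
  by (induction n) (auto intro: subgroup.m_closed subgroup.one_closed)

lemma ord_pos: "x \<in> carrier G \<Longrightarrow> ord x > 0"
  using ord_ge_1[OF fin] by (metis less_eq_Suc_le One_nat_def)

text \<open>By finiteness the inverse of \<open>a\<close> is the power with exponent
  \<open>ord a - 1\<close>, so closure under multiplication suffices.\<close>

lemma finite_subgroupI:
  assumes "H \<subseteq> carrier G" "\<one> \<in> H" "\<And>x y. x \<in> H \<Longrightarrow> y \<in> H \<Longrightarrow> x \<otimes> y \<in> H"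
  shows "subgroup H G"
proof (rule subgroupI)
  fix a assume a: "a \<in> H"
  have pw: "a [^] (n::nat) \<in> H" for n
    by (induction n) (use a assms in auto)
  from a assms have ac: "a \<in> carrier G" by auto
  then have "a \<otimes> a [^] (ord a - 1) = \<one>"
    by (metis One_nat_def Suc_diff_1 nat_pow_Suc2 ord_pos pow_ord_eq_1)
  then have "inv a = a [^] (ord a - 1)"
    using ac by (metis inv_unique' l_inv_ex m_closed nat_pow_closed inv_comm)
  then show "inv a \<in> H" using pw by simp
qed (use assms in auto)

lemma subgroup_inter: "subgroup H G \<Longrightarrow> subgroup K G \<Longrightarrow> subgroup (H \<inter> K) G"
  by (rule subgroups_Inter_pair)

lemma carrier_subgroup: "subgroup (carrier G) G"
  by (rule subgroup_self)

lemma lagrange_sub: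
  assumes "subgroup H G" "subgroup K G" "H \<subseteq> K"
  shows "card H dvd card K"
proof -
  interpret K: group "G\<lparr>carrier := K\<rparr>" by (rule subgroup_imp_group[OF assms(2)])
  have "subgroup H (G\<lparr>carrier := K\<rparr>)" by (rule subgroup_incl[OF assms(1,2,3)])
  from K.lagrange[OF this] show ?thesis by (simp add: order_def) (metis dvd_triv_right)
qed

lemma ord_dvd_sub: "subgroup H G \<Longrightarrow> x \<in> H \<Longrightarrow> ord x dvd card H"
proof -
  assume H: "subgroup H G" and x: "x \<in> H"
  then have xc: "x \<in> carrier G" by (rule sub_carrier)
  have s: "subgroup (generate G {x}) G" using xc by (intro generate_is_subgroup) auto
  have "generate G {x} \<subseteq> H" using H x by (intro generate_subgroup_incl) auto
  moreover have "card (generate G {x}) = ord x"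
    using generate_pow_card[OF xc] by simp
  ultimately show ?thesis using lagrange_sub[OF s H] by simp
qed

lemma card_fibers:
  assumes "finite A" "f ` A = B" "\<And>y. y \<in> B \<Longrightarrow> card {x \<in> A. f x = y} = k"
  shows "card A = card B * k"
proof -
  have "finite B" using assms by auto
  have "card A = (\<Sum>y\<in>B. card {x \<in> A. f x = y})"
    using sum.group[OF assms(1) \<open>finite B\<close>, of f "\<lambda>_. 1::nat"] assms(2) by simp
  then show ?thesis using assms(3) by simp
qed

lemma subgroup_cz:
  assumes "subgroup H G" "D \<subseteq> carrier G" shows "subgroup (cz H D) G"
proof (rule finite_subgroupI)
  show "cz H D \<subseteq> carrier G" using assms subgroup.subset by (auto simp: cz_def)
  show "\<one> \<in> cz H D" using assms by (auto simp: cz_def subgroup.one_closed subset_iff)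
  fix x y assume "x \<in> cz H D" "y \<in> cz H D"
  then show "x \<otimes> y \<in> cz H D"
    using assms by (auto simp: cz_def subgroup.m_closed subset_iff)
      (metis m_assoc sub_carrier)
qed

lemma cz_conj_iff:
  "H \<subseteq> carrier G \<Longrightarrow> D \<subseteq> carrier G \<Longrightarrow> h \<in> cz H D \<longleftrightarrow> h \<in> H \<and> (\<forall>x\<in>D. x \<frown> h = x)"
  by (auto simp: cz_def conj_fix subset_iff)

text \<open>Orbit-stabiliser: the fibre over \<open>x \<frown> k\<close> is the right coset of the
  centraliser through \<open>k\<close>.\<close>

lemma orb_card:
  assumes H: "subgroup H G" and x: "x \<in> carrier G"
  shows "card (orb H x) * card (cz H {x}) = card H"
proof (rule card_fibers[symmetric, where f = "\<lambda>h. x \<frown> h"])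
  show "finite H" using H by simp
  show "(\<lambda>h. x \<frown> h) ` H = orb H x" by (simp add: orb_def)
  fix y assume "y \<in> orb H x"
  then obtain k where k: "k \<in> H" "y = x \<frown> k" by (auto simp: orb_def)
  note Hc = sub_carrier[OF H]
  have "{h \<in> H. x \<frown> h = y} = (\<lambda>c. c \<otimes> k) ` cz H {x}"
  proof safe
    fix h assume h: "h \<in> H" "y = x \<frown> h"
    then have "x \<frown> (h \<otimes> inv k) = x"
      using k x Hc by (metis conj_conj conj_inv_cancel(1) inv_closed)
    then have "h \<otimes> inv k \<in> cz H {x}"
      using h k x Hc H by (auto simp: cz_def conj_fix subgroup.m_closed subgroup.m_inv_closed)
    moreover have "h = (h \<otimes> inv k) \<otimes> k" using h k Hc by (simp add: m_assoc)
    ultimately show "h \<in> (\<lambda>c. c \<otimes> k) ` cz H {x}" by blast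
  next
    fix c assume "c \<in> cz H {x}"
    then show "c \<otimes> k \<in> H" "x \<frown> (c \<otimes> k) = y"
      using k H x Hc by (auto simp: cz_def subgroup.m_closed conj_conj[symmetric] conj_fix)
        (metis conj_fix)
  qed
  moreover have "inj_on (\<lambda>c. c \<otimes> k) (cz H {x})"
    using k Hc by (auto simp: inj_on_def cz_def)
  ultimately show "card {h \<in> H. x \<frown> h = y} = card (cz H {x})" by (simp add: card_image)
qed

lemma product_formula:
  assumes H: "subgroup H G" and K: "subgroup K G"
  shows "card (H <#> K) * card (H \<inter> K) = card H * card K"
proof -
  have "card (H \<times> K) = card (H <#> K) * card (H \<inter> K)"
  proof (rule card_fibers[where f = "\<lambda>(h, k). h \<otimes> k"])
    show "finite (H \<times> K)" using H K by simp
    show "(\<lambda>(h, k). h \<otimes> k) ` (H \<times> K) = H <#> K" by (auto simp: set_mult_def)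
    note Hc = sub_carrier[OF H] and Kc = sub_carrier[OF K]
    fix y assume "y \<in> H <#> K"
    then obtain h k where hk: "h \<in> H" "k \<in> K" "y = h \<otimes> k" by (auto simp: set_mult_def)
    have "{x \<in> H \<times> K. (case x of (h, k) \<Rightarrow> h \<otimes> k) = y} = (\<lambda>d. (h \<otimes> d, inv d \<otimes> k)) ` (H \<inter> K)"
    proof safe
      fix a b assume ab: "a \<in> H" "b \<in> K" "y = a \<otimes> b"
      let ?d = "inv h \<otimes> a"
      have e: "?d = k \<otimes> inv b"
      proof -
        have "a \<otimes> b = h \<otimes> k" using ab hk by simp
        then have "inv h \<otimes> (a \<otimes> b) \<otimes> inv b = inv h \<otimes> (h \<otimes> k) \<otimes> inv b" by simp
        then show ?thesis using ab hk Hc Kc by (simp add: m_assoc inv_mult_cancel)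
      qed
      have "?d \<in> H" using ab hk H by (simp add: subgroup.m_closed subgroup.m_inv_closed)
      moreover have "?d \<in> K" unfolding e using ab hk K by (simp add: subgroup.m_closed subgroup.m_inv_closed)
      moreover have "a = h \<otimes> ?d" using ab hk Hc by (simp add: inv_mult_cancel)
      moreover have "b = inv ?d \<otimes> k" unfolding e using ab hk Kc by (simp add: inv_mult_group m_assoc)
      ultimately show "(a, b) \<in> (\<lambda>d. (h \<otimes> d, inv d \<otimes> k)) ` (H \<inter> K)" by blast
    next
      fix d assume d: "d \<in> H" "d \<in> K"
      show "h \<otimes> d \<in> H" "inv d \<otimes> k \<in> K"
        using d hk H K by (simp_all add: subgroup.m_closed subgroup.m_inv_closed)
      show "h \<otimes> d \<otimes> (inv d \<otimes> k) = y" using d hk Hc Kc by (simp add: m_assoc inv_mult_cancel)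
    qed
    moreover have "inj_on (\<lambda>d. (h \<otimes> d, inv d \<otimes> k)) (H \<inter> K)"
      using hk Hc by (auto simp: inj_on_def)
    ultimately show "card {x \<in> H \<times> K. (case x of (h, k) \<Rightarrow> h \<otimes> k) = y} = card (H \<inter> K)"
      by (simp add: card_image)
  qed
  then show ?thesis by (simp add: card_cartesian_product)
qed

lemma normal_in_subgroup: "normal_in N H \<Longrightarrow> subgroup N G"
  by (simp add: normal_in_def)

lemma normal_in_subset: "normal_in N H \<Longrightarrow> N \<subseteq> H"
  by (simp add: normal_in_def)

lemma normal_in_conj: "normal_in N H \<Longrightarrow> n \<in> N \<Longrightarrow> h \<in> H \<Longrightarrow> n \<frown> h \<in> N"
  by (simp add: normal_in_def)

lemma normal_in_conj_iff:
  "normal_in N H \<Longrightarrow> subgroup H G \<Longrightarrow> n \<in> carrier G \<Longrightarrow> h \<in> H \<Longrightarrow> n \<frown> h \<in> N \<longleftrightarrow> n \<in> N"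
  by (metis conj_inv_cancel(1) normal_in_conj subgroup.m_inv_closed subgroup.mem_carrier)

lemma normal_in_mono: "normal_in N K \<Longrightarrow> N \<subseteq> H \<Longrightarrow> H \<subseteq> K \<Longrightarrow> normal_in N H"
  by (auto simp: normal_in_def)

lemma set_mult_iff: "x \<in> H <#> K \<longleftrightarrow> (\<exists>h\<in>H. \<exists>k\<in>K. x = h \<otimes> k)"
  by (auto simp: set_mult_def)

lemma subgroup_set_mult:
  assumes N: "normal_in N H" and K: "subgroup K G" "K \<subseteq> H" and H: "subgroup H G"
  shows "subgroup (K <#> N) G"
proof (rule finite_subgroupI)
  note Nc = sub_carrier[OF normal_in_subgroup[OF N]] and Kc = sub_carrier[OF K(1)]
  show "K <#> N \<subseteq> carrier G" using Nc Kc by (auto simp: set_mult_def)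
  have "\<one> \<otimes> \<one> = \<one>" by simp
  then show "\<one> \<in> K <#> N" unfolding set_mult_iff
    using K(1) normal_in_subgroup[OF N] subgroup.one_closed by metis
  fix x y assume "x \<in> K <#> N" "y \<in> K <#> N"
  then obtain a b c d where e: "a \<in> K" "b \<in> N" "x = a \<otimes> b" "c \<in> K" "d \<in> N" "y = c \<otimes> d"
    unfolding set_mult_iff by blast
  then have "x \<otimes> y = (a \<otimes> c) \<otimes> (b \<frown> c \<otimes> d)"
    using Nc Kc by (simp add: conjugate_def m_assoc inv_mult_cancel)
  moreover have "a \<otimes> c \<in> K" using e K subgroup.m_closed by metis
  moreover have "b \<frown> c \<otimes> d \<in> N"
    using e K N normal_in_subgroup[OF N] by (meson normal_in_conj subgroup.m_closed subset_iff)
  ultimately show "x \<otimes> y \<in> K <#> N" unfolding set_mult_iff by blast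
qed

lemma set_mult_sub:
  assumes "subgroup H G" "A \<subseteq> H" "B \<subseteq> H" shows "A <#> B \<subseteq> H"
  using assms by (auto simp: set_mult_def subset_iff subgroup.m_closed)

lemma sub_set_mult:
  assumes "subgroup A G" "subgroup B G" shows "A \<subseteq> A <#> B" "B \<subseteq> A <#> B"
proof -
  have "x \<in> A <#> B" if "x \<in> A" for x
    unfolding set_mult_iff using that assms by (metis subgroup.one_closed r_one sub_carrier)
  then show "A \<subseteq> A <#> B" by blast
  have "x \<in> A <#> B" if "x \<in> B" for x
    unfolding set_mult_iff using that assms by (metis subgroup.one_closed l_one sub_carrier)
  then show "B \<subseteq> A <#> B" by blast
qed

text \<open>Normality makes C_H(x) M a subgroup; by the product formula its order is |C_H(x)| times
  the size of the \<open>M\<close>-orbit, and Lagrange finishes.\<close>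

lemma orb_normal_dvd:
  assumes M: "normal_in M H" and H: "subgroup H G" and x: "x \<in> carrier G"
  shows "card (orb M x) dvd card (orb H x)"
proof -
  let ?C = "cz H {x}"
  have C: "subgroup ?C G" using H x by (simp add: subgroup_cz)
  have CH: "?C \<subseteq> H" by (auto simp: cz_def)
  have s: "subgroup (?C <#> M) G" by (rule subgroup_set_mult[OF M C CH H])
  have i: "?C \<inter> M = cz M {x}" using normal_in_subset[OF M] by (auto simp: cz_def)
  have 1: "card (?C <#> M) * card (cz M {x}) = card ?C * card M"
    using product_formula[OF C normal_in_subgroup[OF M]] i by simp
  have 2: "card (orb M x) * card (cz M {x}) = card M" by (rule orb_card[OF normal_in_subgroup[OF M] x])
  have pos: "card (cz M {x}) > 0" "card ?C > 0"
    using card_sub_pos subgroup_cz[OF normal_in_subgroup[OF M]] C x by auto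
  have "card (?C <#> M) * card (cz M {x}) = card ?C * card (orb M x) * card (cz M {x})"
    using 1 2 by (simp add: algebra_simps)
  then have 3: "card (?C <#> M) = card ?C * card (orb M x)" using pos by simp
  have "card (?C <#> M) dvd card H"
    using lagrange_sub[OF s H set_mult_sub[OF H CH normal_in_subset[OF M]]] .
  then have "card (orb M x) * card ?C dvd card (orb H x) * card ?C"
    using 3 orb_card[OF H x] by (simp add: algebra_simps)
  then show ?thesis using pos by simp
qed

subsection \<open>Sylow subgroups relative to a subgroup\<close>

abbreviation cset :: "'a set \<Rightarrow> 'a \<Rightarrow> 'a set" where
  "cset D g \<equiv> (\<lambda>x. x \<frown> g) ` D"

lemma subgroup_cset:
  assumes "subgroup H G" "g \<in> carrier G" shows "subgroup (cset H g) G"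
proof (rule finite_subgroupI)
  show "cset H g \<subseteq> carrier G" using assms by (auto simp: sub_carrier)
  have "\<one> \<frown> g \<in> cset H g" using assms subgroup.one_closed by blast
  then show "\<one> \<in> cset H g" using assms by simp
  fix x y assume "x \<in> cset H g" "y \<in> cset H g"
  then obtain a b where "a \<in> H" "b \<in> H" "x = a \<frown> g" "y = b \<frown> g" by auto
  then have "x \<otimes> y = (a \<otimes> b) \<frown> g" "a \<otimes> b \<in> H"
    using assms by (simp_all add: conj_mult sub_carrier subgroup.m_closed)
  then show "x \<otimes> y \<in> cset H g" by blast
qed

lemma card_cset: "\<lbrakk>D \<subseteq> carrier G; g \<in> carrier G\<rbrakk> \<Longrightarrow> card (cset D g) = card D"
  by (rule card_image[OF inj_on_conj])

lemma cset_cset: "\<lbrakk>D \<subseteq> carrier G; g \<in> carrier G; h \<in> carrier G\<rbrakk> \<Longrightarrow> cset (cset D g) h = cset D (g \<otimes> h)"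
  by (force simp: conj_conj subset_iff image_image intro!: image_cong)

lemma cset_sub: "\<lbrakk>subgroup H G; D \<subseteq> H; h \<in> H\<rbrakk> \<Longrightarrow> cset D h \<subseteq> H"
  by (auto simp: conjugate_def subset_iff subgroup.m_closed subgroup.m_inv_closed)

lemma conj_in_sub: "\<lbrakk>subgroup H G; x \<in> H; h \<in> H\<rbrakk> \<Longrightarrow> x \<frown> h \<in> H"
  by (auto simp: conjugate_def subgroup.m_closed subgroup.m_inv_closed)

lemma normal_in_cset:
  assumes "normal_in N (carrier G)" "g \<in> carrier G" shows "cset N g = N"
  using assms normal_in_subgroup[OF assms(1)]
  by (intro card_seteq) (auto simp: normal_in_conj card_cset subgroup.subset)

lemma sylow_subgroup: "sylow_in r H R \<Longrightarrow> subgroup R G" and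
  sylow_subset: "sylow_in r H R \<Longrightarrow> R \<subseteq> H" and
  sylow_card: "sylow_in r H R \<Longrightarrow> card R = r ^ multiplicity r (card H)"
  by (simp_all add: sylow_in_def)

lemma sylow_exists:
  assumes H: "subgroup H G" and r: "prime r"
  obtains R where "sylow_in r H R"
proof -
  interpret K: group "G\<lparr>carrier := H\<rparr>" by (rule subgroup_imp_group[OF H])
  have "r ^ multiplicity r (card H) dvd card H" by (rule multiplicity_dvd)
  then obtain m where m: "order (G\<lparr>carrier := H\<rparr>) = r ^ multiplicity r (card H) * m"
    by (auto simp: order_def)
  obtain R where "subgroup R (G\<lparr>carrier := H\<rparr>)" "card R = r ^ multiplicity r (card H)"
    using sylow_thm[OF r K.is_group m] H by auto
  then have "sylow_in r H R"
    using incl_subgroup[OF H] subgroup.subset by (force simp: sylow_in_def)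
  then show thesis by (rule that)
qed

text \<open>Sylow's second theorem by counting (R, U) double cosets. If no conjugate of
  \<open>R\<close> contains \<open>U\<close>, each intersection of \<open>U\<close> with a conjugate
  of \<open>R\<close> is proper, so every double coset has size divisible by one power of
  \<open>r\<close> more than |R|; then so has |H|, a contradiction.\<close>

lemma sylow_contains:
  assumes r: "prime r" and H: "subgroup H G" and R: "sylow_in r H R"
    and U: "subgroup U G" "U \<subseteq> H" "card U = r ^ k"
  shows "\<exists>h\<in>H. U \<subseteq> cset R h"
proof (rule ccontr)
  assume neg: "\<not> ?thesis"
  note Rs = sylow_subgroup[OF R] and RH = sylow_subset[OF R]
  define n where "n = multiplicity r (card H)"
  have Rc: "card R = r ^ n" using sylow_card[OF R] n_def by simp
  note Hc = sub_carrier[OF H] and Uc = sub_carrier[OF U(1)] and Rcc = sub_carrier[OF Rs]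
  \<comment> \<open>\<open>E h\<close> is the double coset R h U.\<close>
  define E where "E = (\<lambda>h. {a \<otimes> h \<otimes> u |a u. a \<in> R \<and> u \<in> U})"
  have self: "h \<in> E h" if "h \<in> H" for h
  proof -
    have "\<one> \<otimes> h \<otimes> \<one> = h" using that Hc by simp
    then show ?thesis unfolding E_def
      using subgroup.one_closed[OF Rs] subgroup.one_closed[OF U(1)] by (metis (mono_tags, lifting) mem_Collect_eq)
  qed
  have EH: "E h \<subseteq> H" if "h \<in> H" for h
    using that RH U(2) H by (auto simp: E_def subset_iff subgroup.m_closed)
  have mem: "E x \<subseteq> E h" if hH: "h \<in> H" and xE: "x \<in> E h" for h x
  proof
    fix y assume "y \<in> E x"
    then obtain a u b v where ab: "a \<in> R" "u \<in> U" "x = a \<otimes> h \<otimes> u" "b \<in> R" "v \<in> U" "y = b \<otimes> x \<otimes> v"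
      using xE unfolding E_def by blast
    then have "y = (b \<otimes> a) \<otimes> h \<otimes> (u \<otimes> v)" using hH Hc Uc Rcc by (simp add: m_assoc)
    then show "y \<in> E h" using ab Rs U(1) unfolding E_def by (blast intro: subgroup.m_closed)
  qed
  have sym: "h \<in> E x" if hH: "h \<in> H" and xE: "x \<in> E h" for h x
  proof -
    obtain a u where ab: "a \<in> R" "u \<in> U" "x = a \<otimes> h \<otimes> u" using xE unfolding E_def by blast
    then have "h = inv a \<otimes> x \<otimes> inv u" using hH Hc Uc Rcc by (simp add: m_assoc inv_mult_cancel)
    then show ?thesis using ab Rs U(1) unfolding E_def by (blast intro: subgroup.m_inv_closed)
  qed
  have eq: "E h = E h'" if "h \<in> H" "h' \<in> H" "E h \<inter> E h' \<noteq> {}" for h h'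
  proof -
    from that obtain x where x: "x \<in> E h" "x \<in> E h'" by blast
    have xH: "x \<in> H" using EH that x by blast
    have "E h = E x" "E h' = E x"
      using mem sym x that xH by blast+
    then show ?thesis by simp
  qed
  have dv: "r ^ Suc n dvd card (E h)" if h: "h \<in> H" for h
  proof -
    note hc = Hc[OF h]
    have Rh: "subgroup (cset R h) G" by (rule subgroup_cset[OF Rs hc])
    have "E h = (\<lambda>x. h \<otimes> x) ` (cset R h <#> U)"
    proof -
      have "a \<otimes> h \<otimes> u = h \<otimes> (a \<frown> h \<otimes> u)" if "a \<in> R" "u \<in> U" for a u
        using that hc Uc Rcc by (simp add: conjugate_def m_assoc inv_mult_cancel)
      then show ?thesis unfolding E_def set_mult_def by (auto simp: image_iff) (metis)+
    qed
    moreover have "inj_on (\<lambda>x. h \<otimes> x) (cset R h <#> U)"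
    proof -
      have "cset R h <#> U \<subseteq> carrier G"
        using Rh U(1) by (meson set_mult_closed subgroup.subset)
      then show ?thesis using hc by (auto simp: inj_on_def subset_iff)
    qed
    ultimately have cE: "card (E h) = card (cset R h <#> U)" by (simp add: card_image)
    have pf: "card (E h) * card (cset R h \<inter> U) = r ^ n * r ^ k"
      using product_formula[OF Rh U(1)] cE Rc U(3) card_cset[of R h] subgroup.subset[OF Rs] hc by simp
    have I: "subgroup (cset R h \<inter> U) G" by (rule subgroup_inter[OF Rh U(1)])
    have "card (cset R h \<inter> U) dvd r ^ k" using lagrange_sub[OF I U(1)] U(3) by simp
    then obtain j where j: "j \<le> k" "card (cset R h \<inter> U) = r ^ j"
      using divides_primepow_nat[OF r] by blast
    have "j \<noteq> k"
    proof
      assume "j = k"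
      then have "cset R h \<inter> U = U" using j U(3) finite_sub[OF U(1)] by (intro card_seteq) auto
      then show False using neg h by blast
    qed
    then have "k = Suc (k - Suc j) + j" using j by simp
    then have "r ^ k = r ^ Suc (k - Suc j) * r ^ j" by (metis power_add)
    then have "card (E h) * r ^ j = r ^ n * r ^ Suc (k - Suc j) * r ^ j"
      using pf j(2) by (metis mult.assoc)
    then have "card (E h) = r ^ n * r ^ Suc (k - Suc j)"
      using r by (simp add: prime_gt_0_nat)
    then have "card (E h) = r ^ Suc n * r ^ (k - Suc j)" by simp
    then show ?thesis by (metis dvd_triv_left)
  qed
  have UE: "\<Union> (E ` H) = H" using self EH by blast
  have "r ^ Suc n dvd card (\<Union> (E ` H))"
  proof (rule dvd_partition)
    show "finite (\<Union> (E ` H))" using UE H by simp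
    show "\<forall>c\<in>E ` H. r ^ Suc n dvd card c" using dv by blast
    show "\<forall>c1\<in>E ` H. \<forall>c2\<in>E ` H. c1 \<noteq> c2 \<longrightarrow> c1 \<inter> c2 = {}" using eq by blast
  qed
  then have "r ^ Suc n dvd card H" using UE by simp
  then have "Suc n \<le> multiplicity r (card H)"
    using power_dvd_iff_le_multiplicity card_sub_pos[OF H] r
    by (metis not_prime_unit less_numeral_extra(3))
  then show False by (simp add: n_def)
qed

lemma sylow_conj:
  assumes r: "prime r" and H: "subgroup H G" and R: "sylow_in r H R" and R': "sylow_in r H R'"
  shows "\<exists>h\<in>H. R' = cset R h"
proof -
  obtain h where h: "h \<in> H" "R' \<subseteq> cset R h"
    using sylow_contains[OF r H R sylow_subgroup[OF R'] sylow_subset[OF R'] sylow_card[OF R']] by blast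
  have "h \<in> carrier G" using h H by (simp add: sub_carrier)
  then have "card (cset R h) = card R'" "finite (cset R h)"
    using card_cset[of R h] sylow_card[OF R] sylow_card[OF R'] sylow_subgroup[OF R]
    by (simp_all add: subgroup.subset)
  then have "R' = cset R h" using h by (metis card_seteq order_refl)
  then show ?thesis using h by blast
qed

lemma subgroup_cyclic: "x \<in> carrier G \<Longrightarrow> subgroup (generate G {x}) G"
  by (intro generate_is_subgroup) auto

lemma card_cyclic: "x \<in> carrier G \<Longrightarrow> card (generate G {x}) = ord x"
  using generate_pow_card by simp

lemma cyclic_sub: "subgroup H G \<Longrightarrow> x \<in> H \<Longrightarrow> generate G {x} \<subseteq> H"
  by (intro generate_subgroup_incl) auto

lemma mem_cyclic: "x \<in> generate G {x}"
  by (simp add: generate.incl)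

lemma sylow_contains_elem:
  assumes r: "prime r" and H: "subgroup H G" and R: "sylow_in r H R" and x: "x \<in> H" "ord x = r ^ k"
  shows "\<exists>h\<in>H. x \<in> cset R h"
proof -
  have xc: "x \<in> carrier G" using H x sub_carrier by blast
  show ?thesis
    using sylow_contains[OF r H R subgroup_cyclic[OF xc] cyclic_sub[OF H x(1)], of k]
      card_cyclic[OF xc] x(2) mem_cyclic[of x] by (metis subsetD)
qed

lemma sylow_cset:
  assumes "sylow_in r H R" "subgroup H G" "h \<in> H" shows "sylow_in r H (cset R h)"
  using assms by (auto simp: sylow_in_def subgroup_cset sub_carrier card_cset subgroup.subset
      intro!: conj_in_sub)

lemma sylow_cset_normal:
  assumes "sylow_in r N R" "normal_in N (carrier G)" "g \<in> carrier G" shows "sylow_in r N (cset R g)"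
  using assms by (auto simp: sylow_in_def subgroup_cset sub_carrier card_cset subgroup.subset
      intro: normal_in_conj)

lemma sylow_normal_contains:
  assumes "prime r" "subgroup H G" "sylow_in r H R" "normal_in R H" "x \<in> H" "ord x = r ^ k"
  shows "x \<in> R"
  using sylow_contains_elem[OF assms(1-3,5,6)] normal_in_conj[OF assms(4)] by blast

lemma sylow_intermediate:
  assumes R: "sylow_in r H R" and K: "subgroup K G" "R \<subseteq> K" "K \<subseteq> H" and H: "subgroup H G"
    and r: "prime r"
  shows "sylow_in r K R" "multiplicity r (card K) = multiplicity r (card H)"
proof -
  have "card R dvd card K" by (rule lagrange_sub[OF sylow_subgroup[OF R] K(1,2)])
  then have "r ^ multiplicity r (card H) dvd card K" using sylow_card[OF R] by simp
  then have "multiplicity r (card H) \<le> multiplicity r (card K)"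
    using card_sub_pos[OF K(1)] r by (intro multiplicity_geI) auto
  moreover have "multiplicity r (card K) \<le> multiplicity r (card H)"
    using lagrange_sub[OF K(1) H K(3)] card_sub_pos[OF H] by (intro dvd_imp_multiplicity_le) auto
  ultimately show "multiplicity r (card K) = multiplicity r (card H)" by simp
  then show "sylow_in r K R" using R K by (simp add: sylow_in_def)
qed

lemma sylow_index:
  assumes R: "sylow_in r H R" and K: "subgroup K G" "R \<subseteq> K" "K \<subseteq> H" and H: "subgroup H G"
    and r: "prime r" and n: "card H = card K * n"
  shows "\<not> r dvd n"
proof
  assume "r dvd n"
  have nz: "n \<noteq> 0" "card K \<noteq> 0" using n card_sub_pos[OF H] by auto
  have "multiplicity r (card H) = multiplicity r (card K) + multiplicity r n"
    unfolding n using r nz by (intro prime_elem_multiplicity_mult_distrib) auto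
  then have "multiplicity r n = 0" using sylow_intermediate(2)[OF R K H r] by simp
  then show False using \<open>r dvd n\<close> nz r
    by (metis multiplicity_eq_zero_iff not_prime_unit)
qed

lemma sylow_of_index:
  assumes R: "sylow_in r K R" and K: "subgroup K G" "K \<subseteq> H" and H: "subgroup H G"
    and r: "prime r" and n: "card H = card K * n" "\<not> r dvd n"
  shows "sylow_in r H R"
proof -
  have nz: "n \<noteq> 0" "card K \<noteq> 0" using n card_sub_pos[OF H] by auto
  have "multiplicity r (card H) = multiplicity r (card K) + multiplicity r n"
    unfolding n(1) using r nz by (intro prime_elem_multiplicity_mult_distrib) auto
  moreover have "multiplicity r n = 0" using n(2) by (rule not_dvd_imp_multiplicity_0)
  ultimately show ?thesis using R K by (auto simp: sylow_in_def)
qed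

lemma orb_index: "\<lbrakk>subgroup H G; x \<in> carrier G\<rbrakk> \<Longrightarrow> card H = card (cz H {x}) * card (orb H x)"
  using orb_card[of H x] by (simp add: mult.commute)

lemma cz_subset: "cz H D \<subseteq> H"
  by (auto simp: cz_def)

lemma sylow_centralizes:
  assumes H: "subgroup H G" and x: "x \<in> carrier G" and r: "prime r" and nd: "\<not> r dvd card (orb H x)"
  obtains R where "sylow_in r H R" "R \<subseteq> cz H {x}"
proof -
  have C: "subgroup (cz H {x}) G" using H x by (simp add: subgroup_cz)
  obtain R where R: "sylow_in r (cz H {x}) R" by (rule sylow_exists[OF C r])
  have "sylow_in r H R"
    by (rule sylow_of_index[OF R C cz_subset H r orb_index[OF H x] nd])
  then show thesis using that sylow_subset[OF R] by blast
qed

lemma sylow_centralizes_dvd: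
  assumes H: "subgroup H G" and x: "x \<in> carrier G" and r: "prime r"
    and R: "sylow_in r H R" "R \<subseteq> cz H {x}"
  shows "\<not> r dvd card (orb H x)"
  by (rule sylow_index[OF R(1) subgroup_cz[OF H] R(2) cz_subset H r orb_index[OF H x]]) (use x in auto)

text \<open>A nontrivial element of a Sylow \<open>r\<close>-subgroup has order a positive power of
  \<open>r\<close>, and a suitable power of it has order exactly \<open>r\<close>.\<close>

lemma cauchy:
  assumes H: "subgroup H G" and r: "prime r" "r dvd card H"
  obtains x where "x \<in> H" "ord x = r"
proof -
  obtain R where R: "sylow_in r H R" by (rule sylow_exists[OF H r(1)])
  have "multiplicity r (card H) > 0"
    using r card_sub_pos[OF H] by (simp add: prime_multiplicity_gt_zero_iff)
  then have "card R > 1"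
    using sylow_card[OF R] prime_gt_1_nat[OF r(1)] by (metis one_less_power)
  then obtain x where x: "x \<in> R" "x \<noteq> \<one>"
    by (metis card_1_singleton_iff card_le_Suc0_iff_eq finite_sub linorder_not_less One_nat_def
        subgroup.one_closed sylow_subgroup[OF R])
  have xc: "x \<in> carrier G" using x sylow_subgroup[OF R] sub_carrier by blast
  have "ord x dvd r ^ multiplicity r (card H)"
    using ord_dvd_sub[OF sylow_subgroup[OF R] x(1)] sylow_card[OF R] by simp
  then obtain j where j: "ord x = r ^ j" using divides_primepow_nat[OF r(1)] by blast
  have "ord x \<noteq> 1" using x ord_eq_1[OF xc] by simp
  then have "j \<noteq> 0" using j by (metis power_0)
  then obtain i where i: "j = Suc i" by (cases j) auto
  have "ord (x [^] (r ^ i)) = r"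
    using ord_pow[OF xc, of "r ^ i"] j i prime_gt_0_nat[OF r(1)] by simp
  moreover have "x [^] (r ^ i) \<in> H"
    using x sylow_subset[OF R] H by (meson sub_pow subset_iff)
  ultimately show thesis by (rule that[rotated])
qed

subsection \<open>Unions of conjugates\<close>

text \<open>Count the pairs (h, y) with h in H and y in Y - W by the value of y^h. \<open>Y\<close>
  acts freely on each fibre, so covering gives |H - W| |Y| <= |H| |Y - W|, that is, |H| |Y \<inter>
  W| <= |Y| |W|. The product formula turns this into |H| <= |YW|. Equality then makes every fibre a
  single \<open>Y\<close>-orbit, which is the second claim.\<close>

lemma union_of_conjugates:
  assumes H: "subgroup H G" and Y: "subgroup Y G" "Y \<subseteq> H" and W: "normal_in W H"
    and cov: "\<And>z. z \<in> H \<Longrightarrow> z \<notin> W \<Longrightarrow> \<exists>h\<in>H. z \<in> cset Y h"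
  shows "Y <#> W = H" "\<lbrakk>h \<in> H; y \<in> Y; y \<notin> W; y \<frown> h \<in> Y\<rbrakk> \<Longrightarrow> h \<in> Y"
proof -
  note Hc = sub_carrier[OF H] and Yc = sub_carrier[OF Y(1)] and Ws = normal_in_subgroup[OF W]
  note WH = normal_in_subset[OF W]
  define F where "F = (\<lambda>z. {(h, y). h \<in> H \<and> y \<in> Y - W \<and> y \<frown> h = z})"
  \<comment> \<open>The free action of \<open>Y\<close> on a fibre: \<open>u\<close> multiplies the
    conjugating element on the left and compensates by conjugating \<open>y\<close> with the inverse
    of \<open>u\<close>.\<close>
  define \<phi> where "\<phi> = (\<lambda>(h, y) u. (u \<otimes> h, y \<frown> (inv u)))"
  have Wi: "y \<frown> h \<in> W \<longleftrightarrow> y \<in> W" if "y \<in> H" "h \<in> H" for y h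
    using normal_in_conj_iff[OF W H] that Hc by blast
  have \<phi>F: "\<phi> (h, y) ` Y \<subseteq> F z \<and> card (\<phi> (h, y) ` Y) = card Y" if "(h, y) \<in> F z" for h y z
  proof
    have hy: "h \<in> H" "y \<in> Y" "y \<notin> W" "y \<frown> h = z" using that by (auto simp: F_def)
    show "\<phi> (h, y) ` Y \<subseteq> F z"
    proof safe
      fix a b u assume u: "u \<in> Y" and e: "(a, b) = \<phi> (h, y) u"
      then have e: "a = u \<otimes> h" "b = y \<frown> (inv u)" by (auto simp: \<phi>_def)
      have ui: "inv u \<in> Y" using u Y by (simp add: subgroup.m_inv_closed)
      have "b \<in> Y" using e hy conj_in_sub[OF Y(1) _ ui] by simp
      moreover have "b \<notin> W" using e hy Wi[of y "inv u"] Y ui by auto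
      moreover have "a \<in> H" using e u hy Y H by (auto intro: subgroup.m_closed)
      moreover have "b \<frown> a = z"
        using e u hy Yc Hc ui by (simp add: conj_conj m_assoc[symmetric])
      ultimately show "(a, b) \<in> F z" by (simp add: F_def)
    qed
    have "inj_on (\<phi> (h, y)) Y" using hy Hc Yc by (auto simp: inj_on_def \<phi>_def)
    then show "card (\<phi> (h, y) ` Y) = card Y" by (rule card_image)
  qed
  have finF: "finite (F z)" for z
    by (rule finite_subset[of _ "H \<times> Y"]) (use H Y in \<open>auto simp: F_def\<close>)
  have ge: "card Y \<le> card (F z)" if z: "z \<in> H - W" for z
  proof -
    obtain h y where hy: "h \<in> H" "y \<in> Y" "z = y \<frown> h" using cov z by blast
    then have "y \<notin> W" using z Wi[of y h] Y by auto
    then have "(h, y) \<in> F z" using hy by (simp add: F_def)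
    then show ?thesis using \<phi>F card_mono[OF finF] by metis
  qed
  have tot: "(\<Sum>z\<in>H - W. card (F z)) = card H * card (Y - W)"
  proof -
    have im: "(\<lambda>(h, y). y \<frown> h) ` (H \<times> (Y - W)) \<subseteq> H - W"
      using Wi Y(2) conj_in_sub[OF H] by auto
    have "(\<Sum>z\<in>H - W. card {x \<in> H \<times> (Y - W). (\<lambda>(h, y). y \<frown> h) x = z}) = card (H \<times> (Y - W))"
      using sum.group[OF _ _ im, of "\<lambda>_. 1::nat"] H Y(1) by simp
    moreover have "{x \<in> H \<times> (Y - W). (\<lambda>(h, y). y \<frown> h) x = z} = F z" for z
      by (auto simp: F_def)
    ultimately show ?thesis by (simp add: card_cartesian_product)
  qed
  have le: "card (H - W) * card Y \<le> card H * card (Y - W)"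
    using sum_mono[of "H - W" "\<lambda>_. card Y" "\<lambda>z. card (F z)"] ge tot by simp
  have cHW: "card (H - W) + card W = card H"
    using card_Diff_subset[of W H] Ws WH H card_mono[of H W] by simp
  have cYW: "card (Y - W) + card (Y \<inter> W) = card Y"
    using card_Int_Diff[of Y W] Y(1) by simp
  have pf: "card (Y <#> W) * card (Y \<inter> W) = card Y * card W" by (rule product_formula[OF Y(1) Ws])
  have pos: "card (Y \<inter> W) > 0" using card_sub_pos[OF subgroup_inter[OF Y(1) Ws]] .
  have sub: "Y <#> W \<subseteq> H" by (rule set_mult_sub[OF H Y(2) WH])
  have "(card (H - W) + card W) * card Y = card H * (card (Y - W) + card (Y \<inter> W))"
    using cHW cYW by simp
  \<comment> \<open>The slack of the inequality is kept as a natural-number difference, which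
    \<open>le\<close> makes a true one. The equation gives first YW = H and, once that is known,
    that the slack is zero.\<close>
  then have le2: "card H * card (Y \<inter> W) + (card H * card (Y - W) - card (H - W) * card Y) = card W * card Y"
    using le by (simp add: algebra_simps)
  then have "card H * card (Y \<inter> W) \<le> card (Y <#> W) * card (Y \<inter> W)" using pf by (simp add: algebra_simps)
  then have "card H \<le> card (Y <#> W)" using pos by simp
  then show YW: "Y <#> W = H" using sub H by (intro card_seteq) auto
  have tight: "(\<Sum>z\<in>H - W. card Y) = (\<Sum>z\<in>H - W. card (F z))"
    using le2 pf YW tot le by (simp add: algebra_simps)
  show "h \<in> Y" if h: "h \<in> H" "y \<in> Y" "y \<notin> W" "y \<frown> h \<in> Y"
  proof -
    let ?z = "y \<frown> h"
    have z: "?z \<in> H - W" using h Y Wi[of y h] by auto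
    have "card Y = card (F ?z)"
      using sum_mono_inv[OF tight _ z] ge H by simp
    \<comment> \<open>The \<open>Y\<close>-orbit of this pair is the whole fibre. Its members have
      first coordinates in \<open>Y\<close>, so the given pair (h, y) has h in
      \<open>Y\<close>.\<close>
    moreover have b: "(\<one>, ?z) \<in> F ?z" using z h H Hc by (auto simp: F_def subgroup.one_closed)
    ultimately have "\<phi> (\<one>, ?z) ` Y = F ?z" using \<phi>F[OF b] finF by (metis card_seteq order_refl)
    moreover have "(h, y) \<in> F ?z" using h by (simp add: F_def)
    ultimately obtain u where "u \<in> Y" "(h, y) = \<phi> (\<one>, ?z) u" by blast
    then show ?thesis using Yc by (auto simp: \<phi>_def)
  qed
qed

lemma normal_in_one: "subgroup H G \<Longrightarrow> normal_in {\<one>} H"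
  by (auto simp: normal_in_def triv_subgroup subgroup.one_closed sub_carrier)

text \<open>The case of trivial \<open>W\<close>: a finite group is not the union of the conjugates
  of a proper subgroup.\<close>

lemma union_of_conjugates_eq:
  assumes "subgroup H G" "subgroup Y G" "Y \<subseteq> H" "\<And>z. z \<in> H \<Longrightarrow> \<exists>h\<in>H. z \<in> cset Y h"
  shows "Y = H"
proof -
  have "Y <#> {\<one>} = H" by (rule union_of_conjugates(1)[OF assms(1-3) normal_in_one[OF assms(1)] assms(4)])
  moreover have "Y <#> {\<one>} = Y" using sub_carrier[OF assms(2)] by (force simp: set_mult_def)
  ultimately show ?thesis by simp
qed

subsection \<open>Primary decomposition\<close>

text \<open>The exponents are the two idempotents of the Chinese remainder theorem; raising an
  element of order m n to them extracts its two coprime parts.\<close>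

lemma coprime_exponents:
  assumes "coprime m (n::nat)"
  obtains i j where "[i = 1] (mod m)" "[i = 0] (mod n)" "[j = 0] (mod m)" "[j = 1] (mod n)"
  using binary_chinese_remainder_nat[OF assms, of 1 0] binary_chinese_remainder_nat[OF assms, of 0 1]
  by metis

lemma pow_mod_ord:
  assumes "x \<in> carrier G" shows "x [^] (i mod ord x) = x [^] (i::nat)"
proof -
  have "x [^] i = x [^] (ord x * (i div ord x) + i mod ord x)" by simp
  also have "\<dots> = (x [^] ord x) [^] (i div ord x) \<otimes> x [^] (i mod ord x)"
    using assms by (simp only: nat_pow_mult[symmetric] nat_pow_pow)
  finally show ?thesis using assms by simp
qed

lemma pow_cong: "\<lbrakk>x \<in> carrier G; [i = j] (mod ord x)\<rbrakk> \<Longrightarrow> x [^] (i::nat) = x [^] j"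
  by (metis cong_def pow_mod_ord)

lemma ord_split:
  assumes x: "x \<in> carrier G" and o: "ord x = m * n" "coprime m n"
  obtains i j :: nat where "x = x [^] i \<otimes> x [^] j" "ord (x [^] i) dvd m" "ord (x [^] j) dvd n"
proof -
  obtain i j where ij: "[i = 1] (mod m)" "[i = 0] (mod n)" "[j = 0] (mod m)" "[j = 1] (mod n)"
    using coprime_exponents[OF o(2)] by blast
  have "[i + j = 1 + 0] (mod m)" "[i + j = 0 + 1] (mod n)" using ij cong_add by blast+
  then have "[i + j = 1] (mod ord x)" using o by (simp add: coprime_cong_mult_nat)
  then have "x [^] (i + j) = x" using pow_cong[OF x, of "i + j" 1] x by simp
  then have "x = x [^] i \<otimes> x [^] j" using x by (simp add: nat_pow_mult)
  moreover have "n dvd i" "m dvd j" using ij by (simp_all add: cong_0_iff)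
  then have "ord x dvd i * m" "ord x dvd j * n" unfolding o by (auto intro: mult_dvd_mono simp: mult.commute)
  then have "(x [^] i) [^] m = \<one>" "(x [^] j) [^] n = \<one>"
    using x by (simp_all add: nat_pow_pow pow_eq_id)
  then have "ord (x [^] i) dvd m" "ord (x [^] j) dvd n" using x by (simp_all add: pow_eq_id)
  ultimately show thesis by (rule that)
qed

text \<open>Both parts are powers of \<open>x\<close>, so they lie in every subgroup containing
  \<open>x\<close> and commute with everything that commutes with \<open>x\<close>.\<close>

lemma primary_decomp:
  assumes x: "x \<in> carrier G" and r: "prime r"
  obtains i j k :: nat where "x = x [^] i \<otimes> x [^] j" "ord (x [^] i) = r ^ k" "\<not> r dvd ord (x [^] j)"
proof -
  obtain m where m: "ord x = r ^ multiplicity r (ord x) * m" "\<not> r dvd m"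
    using multiplicity_decompose'[of "ord x" r] ord_pos[OF x] r
    by (metis not_gr_zero not_prime_unit)
  have "coprime (r ^ multiplicity r (ord x)) m"
    using m(2) r by (meson coprime_commute coprime_power_left_iff prime_imp_coprime)
  then obtain i j where ij: "x = x [^] i \<otimes> x [^] j"
    "ord (x [^] (i::nat)) dvd r ^ multiplicity r (ord x)" "ord (x [^] (j::nat)) dvd m"
    using ord_split[OF x m(1)] by blast
  obtain k where "ord (x [^] i) = r ^ k" using ij(2) divides_primepow_nat[OF r] by blast
  moreover have "\<not> r dvd ord (x [^] j)" using ij(3) m(2) dvd_trans by blast
  ultimately show thesis using that ij(1) by blast
qed

lemma coprime_commuting_power:
  assumes z: "z \<in> carrier G" and m: "m \<in> carrier G" and c: "z \<otimes> m = m \<otimes> z"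
    and co: "coprime (ord z) (ord m)"
  obtains i j :: nat where "(z \<otimes> m) [^] i = z" "(z \<otimes> m) [^] j = m"
proof -
  obtain i j where ij: "[i = 1] (mod ord z)" "[i = 0] (mod ord m)" "[j = 0] (mod ord z)" "[j = 1] (mod ord m)"
    using coprime_exponents[OF co] by blast
  have "(z \<otimes> m) [^] i = z [^] i \<otimes> m [^] i" "(z \<otimes> m) [^] j = z [^] j \<otimes> m [^] j"
    using pow_mult_distrib[OF c z m] by blast+
  moreover have "z [^] i = z [^] (1::nat)" "m [^] i = m [^] (0::nat)" "z [^] j = z [^] (0::nat)" "m [^] j = m [^] (1::nat)"
    using pow_cong z m ij by blast+
  ultimately show thesis using that z m by simp
qed

lemma commute_pow:
  assumes "h \<in> carrier G" "x \<in> carrier G" "h \<otimes> x = x \<otimes> h"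
  shows "h \<otimes> x [^] (n::nat) = x [^] n \<otimes> h"
  using assms conj_fix[of x h] pow_conj[of x h n] conj_fix[of "x [^] n" h] by simp

lemma cz_pow: "\<lbrakk>H \<subseteq> carrier G; x \<in> carrier G\<rbrakk> \<Longrightarrow> cz H {x} \<subseteq> cz H {x [^] (n::nat)}"
  by (auto simp: cz_def commute_pow subset_iff)

lemma cz_mult: "\<lbrakk>H \<subseteq> carrier G; x \<in> carrier G; y \<in> carrier G\<rbrakk> \<Longrightarrow> cz H {x} \<inter> cz H {y} \<subseteq> cz H {x \<otimes> y}"
  by (auto simp: cz_def subset_iff) (metis m_assoc)

lemma cz_coprime:
  assumes "H \<subseteq> carrier G" "z \<in> carrier G" "m \<in> carrier G" "z \<otimes> m = m \<otimes> z" "coprime (ord z) (ord m)"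
  shows "cz H {z \<otimes> m} = cz H {z} \<inter> cz H {m}"
proof -
  obtain i j :: nat where "(z \<otimes> m) [^] i = z" "(z \<otimes> m) [^] j = m"
    using coprime_commuting_power[OF assms(2-5)] by blast
  then have "cz H {z \<otimes> m} \<subseteq> cz H {z}" "cz H {z \<otimes> m} \<subseteq> cz H {m}"
    using cz_pow[OF assms(1), of "z \<otimes> m" i] cz_pow[OF assms(1), of "z \<otimes> m" j] assms by auto
  then show ?thesis using cz_mult[OF assms(1-3)] by blast
qed

lemma orb_dvd:
  assumes "subgroup H G" "x \<in> carrier G" "y \<in> carrier G" "cz H {y} \<subseteq> cz H {x}"
  shows "card (orb H x) dvd card (orb H y)"
proof -
  have "card (cz H {y}) dvd card (cz H {x})"
    using assms by (intro lagrange_sub subgroup_cz) auto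
  then obtain k where "card (cz H {x}) = card (cz H {y}) * k" by blast
  then have "card (orb H x) * k * card (cz H {y}) = card (orb H y) * card (cz H {y})"
    using orb_card[OF assms(1,2)] orb_card[OF assms(1,3)] by (simp add: algebra_simps)
  then have "card (orb H x) * k = card (orb H y)"
    using card_sub_pos[OF subgroup_cz[OF assms(1)], of "{y}"] assms by simp
  then show ?thesis by (metis dvd_triv_left)
qed

text \<open>Each factor is a power of the product, so the centraliser of the product is the
  intersection of the two centralisers. Multiplying by a commuting element of coprime order thus
  produces a class carrying the primes of both classes, to which separation is then applied.\<close>

lemma orb_coprime_dvd:
  assumes "subgroup H G" "z \<in> carrier G" "m \<in> carrier G" "z \<otimes> m = m \<otimes> z" "coprime (ord z) (ord m)"
  shows "card (orb H z) dvd card (orb H (z \<otimes> m))" "card (orb H m) dvd card (orb H (z \<otimes> m))"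
  using assms(1-3) cz_coprime[OF subgroup.subset[OF assms(1)] assms(2-5)] by (auto intro!: orb_dvd)

lemma orb_conj:
  assumes "subgroup H G" "x \<in> carrier G" "h \<in> H" shows "orb H (x \<frown> h) = orb H x"
proof -
  have "(\<lambda>k. h \<otimes> k) ` H = H"
    using assms by (auto simp: subgroup.m_closed image_iff)
      (metis inv_mult_cancel(1) sub_carrier subgroup.m_closed subgroup.m_inv_closed)
  then have "orb H x = (\<lambda>k. x \<frown> k) ` (\<lambda>k. h \<otimes> k) ` H" by (simp add: orb_def)
  also have "\<dots> = (\<lambda>k. x \<frown> (h \<otimes> k)) ` H" by (rule image_image)
  finally have "orb H x = (\<lambda>k. x \<frown> (h \<otimes> k)) ` H" .
  then show ?thesis using assms by (auto simp: orb_def conj_conj sub_carrier intro!: image_cong)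
qed

lemma orb_finite: "subgroup H G \<Longrightarrow> finite (orb H x)"
  by (simp add: orb_def)

lemma orb_pos: "subgroup H G \<Longrightarrow> card (orb H x) > 0"
  using subgroup.one_closed by (fastforce simp: orb_def card_gt_0_iff)

lemma orb_self: "subgroup H G \<Longrightarrow> x \<in> carrier G \<Longrightarrow> x \<in> orb H x"
  using subgroup.one_closed by (force simp: orb_def)

subsection \<open>Commuting subgroups\<close>

lemma subgroup_set_mult_comm:
  assumes A: "subgroup A G" and B: "subgroup B G" and c: "\<And>a b. a \<in> A \<Longrightarrow> b \<in> B \<Longrightarrow> a \<otimes> b = b \<otimes> a"
  shows "subgroup (A <#> B) G"
proof (rule finite_subgroupI)
  note Ac = sub_carrier[OF A] and Bc = sub_carrier[OF B]
  show "A <#> B \<subseteq> carrier G" using Ac Bc by (auto simp: set_mult_def)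
  show "\<one> \<in> A <#> B" using sub_set_mult(1)[OF A B] subgroup.one_closed[OF A] by blast
  fix x y assume "x \<in> A <#> B" "y \<in> A <#> B"
  then obtain a b a' b' where e: "a \<in> A" "b \<in> B" "x = a \<otimes> b" "a' \<in> A" "b' \<in> B" "y = a' \<otimes> b'"
    unfolding set_mult_iff by blast
  have "x \<otimes> y = a \<otimes> (b \<otimes> a') \<otimes> b'" using e Ac Bc by (simp add: m_assoc)
  also have "\<dots> = a \<otimes> (a' \<otimes> b) \<otimes> b'" using c[OF e(4,2)] by simp
  also have "\<dots> = (a \<otimes> a') \<otimes> (b \<otimes> b')" using e Ac Bc by (simp add: m_assoc)
  finally show "x \<otimes> y \<in> A <#> B"
    unfolding set_mult_iff using e A B by (blast intro: subgroup.m_closed)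
qed

lemma conj_commute_iff:
  assumes "x \<in> carrier G" "y \<in> carrier G" "g \<in> carrier G"
  shows "x \<frown> g \<otimes> y \<frown> g = y \<frown> g \<otimes> x \<frown> g \<longleftrightarrow> x \<otimes> y = y \<otimes> x"
  using assms conj_inj[of "x \<otimes> y" "y \<otimes> x" g] by (simp add: conj_mult)

lemma cz_cset:
  assumes "subgroup H G" "D \<subseteq> carrier G" "h \<in> H"
  shows "cz H (cset D h) = cset (cz H D) h"
proof -
  have hc: "h \<in> carrier G" using assms sub_carrier by blast
  have sub: "cset (cz H D) k \<subseteq> cz H (cset D k)" if "k \<in> H" "D \<subseteq> carrier G" for k D
  proof -
    have kc: "k \<in> carrier G" using that assms sub_carrier by blast
    show ?thesis
    proof safe
      fix x assume x: "x \<in> cz H D"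
      then have "x \<in> H" and xc: "x \<in> carrier G" and com: "\<And>d. d \<in> D \<Longrightarrow> x \<otimes> d = d \<otimes> x"
        using assms(1) sub_carrier by (auto simp: cz_def)
      then have "x \<frown> k \<in> H" using conj_in_sub[OF assms(1)] that by blast
      moreover have "x \<frown> k \<otimes> d \<frown> k = d \<frown> k \<otimes> x \<frown> k" if "d \<in> D" for d
        using conj_commute_iff[of x d k] com that \<open>D \<subseteq> carrier G\<close> xc kc by auto
      ultimately show "x \<frown> k \<in> cz H (cset D k)" by (auto simp: cz_def)
    qed
  qed
  have "cset (cz H (cset D h)) (inv h) \<subseteq> cz H (cset (cset D h) (inv h))"
    using assms hc by (intro sub) (auto simp: subgroup.m_inv_closed subset_iff)
  also have "cset (cset D h) (inv h) = D"
    using assms hc by (force simp: image_image subset_iff)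
  finally have "cset (cset (cz H (cset D h)) (inv h)) h \<subseteq> cset (cz H D) h" by blast
  moreover have "cset (cset (cz H (cset D h)) (inv h)) h = cz H (cset D h)"
    using assms hc cz_subset[of H "cset D h"] sub_carrier[OF assms(1)] by (force simp: image_image subset_iff)
  ultimately show ?thesis using sub[OF assms(3,2)] by blast
qed

text \<open>Every element is centralised by some conjugate of \<open>Q\<close>, so the conjugates of
  C_V(Q) cover \<open>V\<close>, and C_V(Q) must be all of \<open>V\<close>.\<close>

lemma sylow_central_cover:
  assumes V: "subgroup V G" and q: "prime q" and cov: "\<And>z. z \<in> V \<Longrightarrow> \<not> q dvd card (orb V z)"
    and Q: "sylow_in q V Q"
  shows "Q \<subseteq> cz V V"
proof -
  note Vc = sub_carrier[OF V] and Qs = sylow_subgroup[OF Q]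
  have "cz V Q = V"
  proof (rule union_of_conjugates_eq[OF V])
    show "subgroup (cz V Q) G" "cz V Q \<subseteq> V"
      using V Qs by (auto simp: subgroup_cz subgroup.subset cz_subset)
    fix z assume z: "z \<in> V"
    obtain R where R: "sylow_in q V R" "R \<subseteq> cz V {z}"
      using sylow_centralizes[OF V Vc[OF z] q cov[OF z]] by blast
    obtain h where h: "h \<in> V" "R = cset Q h" using sylow_conj[OF q V Q R(1)] by blast
    have "z \<in> cz V R" using R(2) z by (auto simp: cz_def subset_iff)
    then show "\<exists>h\<in>V. z \<in> cset (cz V Q) h"
      using h cz_cset[OF V _ h(1), of Q] Qs subgroup.subset by blast
  qed
  then have "x \<otimes> y = y \<otimes> x" if "x \<in> V" "y \<in> Q" for x y using that by (auto simp: cz_def)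
  then show ?thesis using sylow_subset[OF Q] by (auto simp: cz_def) 
qed

text \<open>The \<open>q'\<close>-part of \<open>v\<close> is centralised by a Sylow \<open>q\<close>-subgroup, which can be chosen to contain the
  \<open>q\<close>-part of \<open>v\<close>; so the conjugates of \<open>Q C\<^sub>V(Q)\<close> cover \<open>V\<close>.\<close>

lemma sylow_direct_cover:
  assumes V: "subgroup V G" and q: "prime q"
    and cov: "\<And>z. z \<in> V \<Longrightarrow> \<not> q dvd ord z \<Longrightarrow> \<not> q dvd card (orb V z)"
    and Q: "sylow_in q V Q"
  shows "Q <#> cz V Q = V" "normal_in Q V"
proof -
  note Vc = sub_carrier[OF V] and Qs = sylow_subgroup[OF Q]
  note Qc = sub_carrier[OF Qs] and QV = sylow_subset[OF Q]
  have Cs: "subgroup (cz V Q) G" using V Qs by (simp add: subgroup_cz subgroup.subset)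
  have Fs: "subgroup (Q <#> cz V Q) G"
    by (rule subgroup_set_mult_comm[OF Qs Cs]) (auto simp: cz_def)
  show F: "Q <#> cz V Q = V"
  proof (rule union_of_conjugates_eq[OF V Fs set_mult_sub[OF V QV cz_subset]])
    fix v assume v: "v \<in> V"
    obtain i j k :: nat where ij: "v = v [^] i \<otimes> v [^] j" "ord (v [^] i) = q ^ k" "\<not> q dvd ord (v [^] j)"
      using primary_decomp[OF Vc[OF v] q] by blast
    let ?a = "v [^] i" and ?b = "v [^] j"
    have ab: "?a \<in> V" "?b \<in> V" using sub_pow[OF V v] by auto
    let ?C = "cz V {?b}"
    have C: "subgroup ?C G" using V ab Vc by (simp add: subgroup_cz)
    obtain R where R: "sylow_in q V R" "R \<subseteq> ?C"
      using sylow_centralizes[OF V Vc[OF ab(2)] q cov[OF ab(2) ij(3)]] by blast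
    have RC: "sylow_in q ?C R" by (rule sylow_intermediate(1)[OF R(1) C R(2) cz_subset V q])
    have "?a \<in> ?C" using ab Vc[OF v] by (simp add: cz_def nat_pow_mult add.commute)
    then obtain c where c: "c \<in> ?C" "?a \<in> cset R c"
      using sylow_contains_elem[OF q C RC _ ij(2)] by blast
    have RC': "cset R c \<subseteq> ?C" using cset_sub[OF C R(2) c(1)] .
    have "c \<in> V" using c by (simp add: cz_def)
    then have "sylow_in q V (cset R c)" by (rule sylow_cset[OF R(1) V])
    then obtain h where h: "h \<in> V" "cset R c = cset Q h" using sylow_conj[OF q V Q] by blast
    have "?b \<in> cz V (cset Q h)" using RC' ab h by (auto simp: cz_def subset_iff)
    then have "?b \<in> cset (cz V Q) h" using cz_cset[OF V _ h(1), of Q] Qs subgroup.subset by blast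
    moreover have "?a \<in> cset Q h" using c h by simp
    ultimately obtain x y where xy: "x \<in> Q" "?a = x \<frown> h" "y \<in> cz V Q" "?b = y \<frown> h" by blast
    then have "v = (x \<otimes> y) \<frown> h"
      using ij(1) Qc Vc h(1) sub_carrier[OF Cs] by (simp add: conj_mult)
    moreover have "x \<otimes> y \<in> Q <#> cz V Q" using xy unfolding set_mult_iff by blast
    ultimately show "\<exists>h\<in>V. v \<in> cset (Q <#> cz V Q) h" using h by blast
  qed
  have "n \<frown> v \<in> Q" if n: "n \<in> Q" and v: "v \<in> V" for n v
  proof -
    have "v \<in> Q <#> cz V Q" using v F by simp
    then obtain x y where xy: "x \<in> Q" "y \<in> cz V Q" "v = x \<otimes> y" unfolding set_mult_iff by blast
    have y: "y \<in> V" and yc: "y \<in> carrier G" using xy(2) Vc by (auto simp: cz_def)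
    have nx: "n \<frown> x \<in> Q" using conj_in_sub[OF Qs n xy(1)] .
    have "n \<frown> v = n \<frown> x \<frown> y" using xy n Qc yc by (simp add: conj_conj)
    also have "\<dots> = n \<frown> x" using nx xy(2) yc Qc[OF nx] by (simp add: conj_fix cz_def)
    finally show ?thesis using nx by simp
  qed
  then show "normal_in Q V" using Qs QV by (simp add: normal_in_def)
qed

subsection \<open>Central transfer\<close>

text \<open>The transfer into a central subgroup, with the product taken over coset representatives.
  On \<open>Z\<close> each factor is the element itself, whence the \<open>n\<close>-th
  power.\<close>

lemma central_transfer:
  assumes H: "subgroup H G" and Z: "subgroup Z G" "Z \<subseteq> cz H H" and n: "card H = card Z * n"
  obtains \<tau> where "\<And>x. x \<in> H \<Longrightarrow> \<tau> x \<in> Z"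
    "\<And>x y. x \<in> H \<Longrightarrow> y \<in> H \<Longrightarrow> \<tau> (x \<otimes> y) = \<tau> x \<otimes> \<tau> y"
    "\<And>z. z \<in> Z \<Longrightarrow> \<tau> z = z [^] n"
proof -
  note Hc = sub_carrier[OF H] and Zc = sub_carrier[OF Z(1)]
  have ZH: "z \<in> H" if "z \<in> Z" for z using that Z(2) by (auto simp: cz_def)
  have com: "z \<otimes> x = x \<otimes> z" if "z \<in> Z" "x \<in> H" for z x using that Z(2) by (auto simp: cz_def)
  \<comment> \<open>The choice depends only on the coset Z x, because the predicate under
    \<open>SOME\<close> does; this is \<open>rep_mult\<close>.\<close>
  define rep where "rep = (\<lambda>x. SOME y. \<exists>z\<in>Z. y = z \<otimes> x)"
  have rep: "\<exists>z\<in>Z. rep x = z \<otimes> x" if "x \<in> H" for x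
    unfolding rep_def by (rule someI_ex) (use subgroup.one_closed[OF Z(1)] in blast)
  have repH: "rep x \<in> H" if "x \<in> H" for x using rep[OF that] that ZH H by (auto simp: subgroup.m_closed)
  have rep_mult: "rep (z \<otimes> x) = rep x" if "z \<in> Z" "x \<in> H" for z x
  proof -
    have "(\<exists>w\<in>Z. y = w \<otimes> (z \<otimes> x)) \<longleftrightarrow> (\<exists>w\<in>Z. y = w \<otimes> x)" for y
    proof
      assume "\<exists>w\<in>Z. y = w \<otimes> (z \<otimes> x)"
      then obtain w where w: "w \<in> Z" "y = w \<otimes> (z \<otimes> x)" by blast
      then have "y = (w \<otimes> z) \<otimes> x" using that Hc Zc by (simp add: m_assoc)
      with w(1) show "\<exists>w\<in>Z. y = w \<otimes> x" using that Z(1) by (blast intro: subgroup.m_closed)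
    next
      assume "\<exists>w\<in>Z. y = w \<otimes> x"
      then obtain w where w: "w \<in> Z" "y = w \<otimes> x" by blast
      then have "y = (w \<otimes> inv z) \<otimes> (z \<otimes> x)" using that Hc Zc by (simp add: m_assoc inv_mult_cancel)
      then show "\<exists>w\<in>Z. y = w \<otimes> (z \<otimes> x)" using that w Z(1) by (blast intro: subgroup.m_closed subgroup.m_inv_closed)
    qed
    then show ?thesis by (simp add: rep_def)
  qed
  have rep_rep: "rep (rep x \<otimes> y) = rep (x \<otimes> y)" if xy: "x \<in> H" "y \<in> H" for x y
  proof -
    obtain z where "z \<in> Z" "rep x = z \<otimes> x" using rep xy by blast
    then show ?thesis using rep_mult[of z "x \<otimes> y"] xy Hc Zc H by (simp add: m_assoc subgroup.m_closed)
  qed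
  define T where "T = rep ` H"
  have TH: "t \<in> H" if "t \<in> T" for t using that repH by (auto simp: T_def)
  have repT: "rep t = t" if t: "t \<in> T" for t
  proof -
    obtain x where "x \<in> H" "t = rep x" using t by (auto simp: T_def)
    then show ?thesis using rep_rep[of x \<one>] Hc[OF repH] Hc H by (simp add: subgroup.one_closed)
  qed
  have finT: "finite T" using H by (simp add: T_def)
  have cT: "card T = n"
  proof -
    have "card H = card T * card Z"
    proof (rule card_fibers[where f = rep])
      fix t assume t: "t \<in> T"
      have "{x \<in> H. rep x = t} = (\<lambda>z. z \<otimes> t) ` Z"
      proof safe
        fix x assume x: "x \<in> H" "t = rep x"
        then obtain z where z: "z \<in> Z" "rep x = z \<otimes> x" using rep by blast
        have "inv z \<otimes> rep x = x" unfolding z(2) using x(1) z(1) Hc Zc by (simp add: inv_mult_cancel)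
        moreover have "inv z \<in> Z" using z(1) Z(1) by (simp add: subgroup.m_inv_closed)
        ultimately show "x \<in> (\<lambda>z. z \<otimes> rep x) ` Z" by (metis image_eqI)
      next
        fix z assume z: "z \<in> Z"
        then show "z \<otimes> t \<in> H" using TH[OF t] ZH H by (simp add: subgroup.m_closed)
        show "rep (z \<otimes> t) = t" using rep_mult[OF z TH[OF t]] repT[OF t] by simp
      qed
      moreover have "inj_on (\<lambda>z. z \<otimes> t) Z" using Hc[OF TH[OF t]] Zc by (auto simp: inj_on_def)
      ultimately show "card {x \<in> H. rep x = t} = card Z" by (simp add: card_image)
    qed (use H in \<open>auto simp: T_def\<close>)
    then show ?thesis using n card_sub_pos[OF Z(1)] by simp
  qed
  define \<sigma> where "\<sigma> = (\<lambda>x v. v \<otimes> x \<otimes> inv (rep (v \<otimes> x)))"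
  have \<sigma>Z: "\<sigma> x v \<in> Z" if "x \<in> H" "v \<in> H" for x v
  proof -
    have vx: "v \<otimes> x \<in> H" using that H by (simp add: subgroup.m_closed)
    obtain z where z: "z \<in> Z" "rep (v \<otimes> x) = z \<otimes> (v \<otimes> x)" using rep[OF vx] by blast
    then have "\<sigma> x v = inv z" using that vx Hc Zc
      by (simp add: \<sigma>_def inv_mult_group m_assoc inv_mult_cancel)
    then show ?thesis using z Z(1) by (simp add: subgroup.m_inv_closed)
  qed
  \<comment> \<open>The cocycle identity. In the product over \<open>T\<close> the second factor is
    reindexed, since right multiplication by \<open>x\<close> followed by \<open>rep\<close>
    permutes the transversal.\<close>
  have \<sigma>m: "\<sigma> (x \<otimes> y) v = \<sigma> x v \<otimes> \<sigma> y (rep (v \<otimes> x))" if "x \<in> H" "y \<in> H" "v \<in> H" for x y v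
  proof -
    have vx: "v \<otimes> x \<in> H" using that H by (simp add: subgroup.m_closed)
    have rr: "rep (rep (v \<otimes> x) \<otimes> y) = rep (v \<otimes> (x \<otimes> y))"
      using rep_rep[OF vx that(2)] that Hc by (simp add: m_assoc)
    have m: "rep (v \<otimes> x) \<in> carrier G" "rep (v \<otimes> (x \<otimes> y)) \<in> carrier G"
      using Hc[OF repH[OF vx]] Hc[OF repH, of "v \<otimes> (x \<otimes> y)"] that H by (simp_all add: subgroup.m_closed)
    have "v \<otimes> (x \<otimes> y) = v \<otimes> x \<otimes> y" using that Hc by (simp add: m_assoc)
    then show ?thesis unfolding \<sigma>_def rr
      using m(1) inv_closed[OF m(2)] Hc[OF vx] Hc[OF that(2)] by (simp add: m_assoc inv_mult_cancel)
  qed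
  interpret Zg: comm_group "G\<lparr>carrier := Z\<rparr>"
  proof (rule group.group_comm_groupI)
    show "group (G\<lparr>carrier := Z\<rparr>)" by (rule subgroup_imp_group[OF Z(1)])
  qed (use com ZH in auto)
  define \<tau> where "\<tau> = (\<lambda>x. finprod (G\<lparr>carrier := Z\<rparr>) (\<sigma> x) T)"
  show thesis
  proof
    show \<tau>Z: "\<tau> x \<in> Z" if "x \<in> H" for x
      using Zg.finprod_closed[of "\<sigma> x" T] \<sigma>Z that TH by (auto simp: \<tau>_def)
    show "\<tau> (x \<otimes> y) = \<tau> x \<otimes> \<tau> y" if xy: "x \<in> H" "y \<in> H" for x y
    proof -
      let ?f = "\<lambda>v. rep (v \<otimes> x)"
      have fT: "?f ` T \<subseteq> T" using xy TH H by (auto simp: T_def subgroup.m_closed)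
      have inj: "inj_on ?f T"
      proof (rule inj_onI)
        fix v w assume vw: "v \<in> T" "w \<in> T" "?f v = ?f w"
        have "rep (?f v \<otimes> inv x) = rep (?f w \<otimes> inv x)" using vw by simp
        then have "rep (v \<otimes> x \<otimes> inv x) = rep (w \<otimes> x \<otimes> inv x)"
          using rep_rep[of "v \<otimes> x" "inv x"] rep_rep[of "w \<otimes> x" "inv x"] vw TH xy H
          by (simp add: subgroup.m_closed subgroup.m_inv_closed)
        then show "v = w" using vw repT TH xy Hc by (simp add: m_assoc)
      qed
      have img: "?f ` T = T" using endo_inj_surj[OF finT fT inj] .
      have "\<tau> (x \<otimes> y) = finprod (G\<lparr>carrier := Z\<rparr>) (\<lambda>v. \<sigma> x v \<otimes>\<^bsub>G\<lparr>carrier := Z\<rparr>\<^esub> \<sigma> y (?f v)) T"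
        unfolding \<tau>_def
        using \<sigma>m xy TH \<sigma>Z repH H by (intro Zg.finprod_cong') (auto simp: subgroup.m_closed[OF H] subgroup.m_closed[OF Z(1)])
      also have "\<dots> = \<tau> x \<otimes> finprod (G\<lparr>carrier := Z\<rparr>) (\<lambda>v. \<sigma> y (?f v)) T"
        unfolding \<tau>_def using xy TH \<sigma>Z repH H
        by (subst Zg.finprod_multf) (auto simp: subgroup.m_closed)
      also have "finprod (G\<lparr>carrier := Z\<rparr>) (\<lambda>v. \<sigma> y (?f v)) T = finprod (G\<lparr>carrier := Z\<rparr>) (\<sigma> y) (?f ` T)"
        by (rule Zg.finprod_reindex[symmetric]) (use inj img xy \<sigma>Z TH in auto)
      finally show ?thesis using img by (simp add: \<tau>_def)
    qed
    show "\<tau> z = z [^] n" if z: "z \<in> Z" for z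
    proof -
      have "\<sigma> z v = z" if v: "v \<in> T" for v
      proof -
        have "v \<otimes> z = z \<otimes> v" using com[OF z TH[OF v]] by simp
        then show ?thesis using rep_mult[OF z TH[OF v]] repT[OF v] Hc[OF TH[OF v]] Zc[OF z]
          by (simp add: \<sigma>_def m_assoc)
      qed
      then have "\<tau> z = finprod (G\<lparr>carrier := Z\<rparr>) (\<lambda>_. z) T"
        unfolding \<tau>_def using z by (intro Zg.finprod_cong') auto
      also have "\<dots> = z [^]\<^bsub>G\<lparr>carrier := Z\<rparr>\<^esub> n"
        using Zg.finprod_const[of z T] z cT by simp
      finally show ?thesis by (simp add: nat_pow_consistent[symmetric])
    qed
  qed
qed

text \<open>A central Hall subgroup has a normal complement: the kernel of the transfer. Describing
  it as the set of elements of order prime to |Z| makes it visibly invariant under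
  conjugation.\<close>

lemma central_hall_complement:
  assumes H: "subgroup H G" and Z: "subgroup Z G" "Z \<subseteq> cz H H" and n: "card H = card Z * n"
    and co: "coprime (card Z) n"
  defines "L \<equiv> {x \<in> H. coprime (ord x) (card Z)}"
  shows "subgroup L G" "card L = n"
proof -
  note Hc = sub_carrier[OF H] and Zc = sub_carrier[OF Z(1)]
  have ZH: "z \<in> H" if "z \<in> Z" for z using that Z(2) by (auto simp: cz_def)
  have com: "z \<otimes> x = x \<otimes> z" if "z \<in> Z" "x \<in> H" for z x using that Z(2) by (auto simp: cz_def)
  obtain \<tau> where \<tau>: "\<And>x. x \<in> H \<Longrightarrow> \<tau> x \<in> Z"
    "\<And>x y. x \<in> H \<Longrightarrow> y \<in> H \<Longrightarrow> \<tau> (x \<otimes> y) = \<tau> x \<otimes> \<tau> y"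
    "\<And>z. z \<in> Z \<Longrightarrow> \<tau> z = z [^] n"
    using central_transfer[OF H Z n] by blast
  have H1: "\<one> \<in> H" using H by (simp add: subgroup.one_closed)
  have \<tau>1: "\<tau> \<one> = \<one>" using \<tau>(3)[of \<one>] Z(1) by (simp add: subgroup.one_closed)
  have \<tau>p: "\<tau> (x [^] (k::nat)) = \<tau> x [^] k" if x: "x \<in> H" for x k
    by (induction k) (use x \<tau>1 \<tau>(2) sub_pow[OF H x] in auto)
  have Leq: "L = {x \<in> H. \<tau> x = \<one>}"
  proof safe
    fix x assume "x \<in> L"
    then have x: "x \<in> H" "coprime (ord x) (card Z)" by (auto simp: L_def)
    then show "x \<in> H" by simp
    have "\<tau> x [^] ord x = \<one>" using \<tau>p[OF x(1), of "ord x"] \<tau>1 Hc[OF x(1)] by simp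
    then have "ord (\<tau> x) dvd ord x" using \<tau>(1)[OF x(1)] Zc by (simp add: pow_eq_id)
    moreover have "ord (\<tau> x) dvd card Z" using ord_dvd_sub[OF Z(1) \<tau>(1)[OF x(1)]] .
    ultimately have "ord (\<tau> x) = 1" using x(2) by (metis coprime_common_divisor_nat)
    then show "\<tau> x = \<one>" using ord_eq_1[OF Zc[OF \<tau>(1)[OF x(1)]]] by simp
  next
    fix x assume x: "x \<in> H" "\<tau> x = \<one>"
    show "x \<in> L"
    proof (rule ccontr)
      assume "x \<notin> L"
      then have "\<not> coprime (ord x) (card Z)" using x by (simp add: L_def)
      then obtain l where l: "prime l" "l dvd ord x" "l dvd card Z"
        using prime_factor_nat[of "gcd (ord x) (card Z)"] by (auto simp: coprime_iff_gcd_eq_1)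
      obtain k where k: "ord x = l * k" using l(2) by blast
      then have "k > 0" using ord_pos[OF Hc[OF x(1)]] by simp
      \<comment> \<open>Suppose a prime \<open>l\<close> divides both |Z| and the order of a kernel
        element. A Sylow \<open>l\<close>-subgroup of \<open>Z\<close> is Sylow in \<open>H\<close>
        and normal, so it contains the power \<open>y\<close> of order \<open>l\<close>. On
        \<open>Z\<close> the transfer is the \<open>n\<close>-th power, which forces
        \<open>l\<close> to divide \<open>n\<close>.\<close>
      define y where "y = x [^] k"
      have yH: "y \<in> H" using sub_pow[OF H x(1)] by (simp add: y_def)
      have oy: "ord y = l"
        unfolding y_def using ord_pow[OF Hc[OF x(1)], of k] k \<open>k > 0\<close> by simp
      have ln: "\<not> l dvd n" using co l by (metis coprime_common_divisor_nat not_prime_1)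
      obtain R where R: "sylow_in l Z R" by (rule sylow_exists[OF Z(1) l(1)])
      have RH: "sylow_in l H R" by (rule sylow_of_index[OF R Z(1) _ H l(1) n ln]) (use ZH in auto)
      have RZ: "R \<subseteq> Z" using sylow_subset[OF R] .
      have nR: "normal_in R H"
        unfolding normal_in_def using sylow_subgroup[OF R] RZ ZH com Hc Zc
        by (auto simp: subset_iff) (metis conj_fix)
      have "y \<in> R" using sylow_normal_contains[OF l(1) H RH nR yH, of 1] oy by simp
      then have yZ: "y \<in> Z" using RZ by blast
      have "y [^] n = \<one>" using \<tau>(3)[OF yZ] \<tau>p[OF x(1), of k] x(2) by (simp add: y_def)
      then have "l dvd n" using oy Zc[OF yZ] by (simp add: pow_eq_id)
      then show False using ln by simp
    qed
  qed
  show Ls: "subgroup L G"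
    by (rule finite_subgroupI) (use Leq Hc \<tau>(2) \<tau>1 H1 H in \<open>auto simp: subgroup.m_closed\<close>)
  have LZ: "L \<inter> Z = {\<one>}"
  proof -
    have "x = \<one>" if "x \<in> L" "x \<in> Z" for x
    proof -
      have "coprime (ord x) (card Z)" "ord x dvd card Z" using that ord_dvd_sub[OF Z(1)] by (auto simp: L_def)
      then have "ord x = 1" by (metis coprime_common_divisor_nat dvd_refl)
      then show ?thesis using ord_eq_1[OF Zc[OF that(2)]] by simp
    qed
    then show ?thesis using subgroup.one_closed[OF Ls] subgroup.one_closed[OF Z(1)] by blast
  qed
  \<comment> \<open>As \<open>n\<close> is prime to |Z|, taking \<open>n\<close>-th powers permutes
    \<open>Z\<close>. Hence any \<open>x\<close> can be corrected by an element of \<open>Z\<close>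
    to lie in the kernel.\<close>
  have inj: "inj_on (\<lambda>z. z [^] n) Z"
  proof (rule inj_onI)
    fix z w assume zw: "z \<in> Z" "w \<in> Z" "z [^] n = w [^] n"
    have c: "z \<otimes> inv w = inv w \<otimes> z" using com[OF zw(1)] ZH zw Z(1) by (simp add: subgroup.m_inv_closed)
    have d: "z \<otimes> inv w \<in> Z" using zw Z(1) by (simp add: subgroup.m_closed subgroup.m_inv_closed)
    have "(z \<otimes> inv w) [^] n = \<one>"
      using pow_mult_distrib[OF c, of n] zw Zc by (simp add: nat_pow_inv)
    then have "ord (z \<otimes> inv w) dvd n" using Zc[OF d] by (simp add: pow_eq_id)
    moreover have "ord (z \<otimes> inv w) dvd card Z" using ord_dvd_sub[OF Z(1) d] .
    ultimately have "ord (z \<otimes> inv w) = 1" using co by (metis coprime_common_divisor_nat)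
    then have "z \<otimes> inv w = \<one>" using ord_eq_1[OF Zc[OF d]] by simp
    then show "z = w" using zw Zc by (metis inv_closed inv_equality inv_inv)
  qed
  have surj: "(\<lambda>z. z [^] n) ` Z = Z"
    by (rule endo_inj_surj[OF _ _ inj]) (use Z(1) sub_pow[OF Z(1)] in auto)
  have "L <#> Z = H"
  proof
    show "L <#> Z \<subseteq> H" by (rule set_mult_sub[OF H]) (use ZH in \<open>auto simp: L_def\<close>)
    show "H \<subseteq> L <#> Z"
    proof
      fix x assume x: "x \<in> H"
      obtain z where z: "z \<in> Z" "\<tau> x = z [^] n" using \<tau>(1)[OF x] surj by blast
      have iz: "inv z \<in> Z" using z Z(1) by (simp add: subgroup.m_inv_closed)
      have "\<tau> (x \<otimes> inv z) = \<one>"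
        using \<tau>(2)[OF x ZH[OF iz]] \<tau>(3)[OF iz] z Zc by (simp add: nat_pow_inv)
      then have "x \<otimes> inv z \<in> L" using x ZH[OF iz] H by (simp add: Leq subgroup.m_closed)
      moreover have "x = x \<otimes> inv z \<otimes> z" using x z Hc Zc by (simp add: m_assoc)
      ultimately show "x \<in> L <#> Z" unfolding set_mult_iff using z by blast
    qed
  qed
  then have "card H = card L * card Z" using product_formula[OF Ls Z(1)] LZ by simp
  then show "card L = n" using n card_sub_pos[OF Z(1)] by simp
qed

subsection \<open>Regular elements and the Hall--Higman argument\<close>

lemma prime_powerI:
  assumes "n > (0::nat)" "prime p" "\<And>r. prime r \<Longrightarrow> r dvd n \<Longrightarrow> r = p"
  obtains k where "n = p ^ k"
proof -
  obtain m where m: "n = p ^ multiplicity p n * m" "\<not> p dvd m"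
    using multiplicity_decompose'[of n p] assms(1,2) by (metis not_gr_zero not_prime_unit)
  have "m = 1"
  proof (rule ccontr)
    assume "m \<noteq> 1"
    then obtain r where r: "prime r" "r dvd m" using prime_factor_nat by blast
    then have "r dvd n" using m(1) by (metis dvd_mult)
    then show False using assms(3)[OF r(1)] r(2) m(2) by simp
  qed
  then show thesis using m(1) that by simp
qed

lemma sylow_elem_ord:
  assumes "prime r" "sylow_in r H R" "x \<in> R" obtains k where "ord x = r ^ k"
  using ord_dvd_sub[OF sylow_subgroup[OF assms(2)] assms(3)] sylow_card[OF assms(2)]
    divides_primepow_nat[OF assms(1)] that by metis

text \<open>When \<open>r\<close> divides the index, a Sylow \<open>r\<close>-subgroup of
  \<open>H\<close> does not fit into \<open>K\<close>.\<close>

lemma index_prime_dvd: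
  assumes H: "subgroup H G" and K: "subgroup K G" "K \<subseteq> H" and n: "card H = card K * n"
    and r: "prime r" "r dvd n"
  obtains x k where "x \<in> H" "x \<notin> K" "ord x = r ^ k"
proof -
  obtain R where R: "sylow_in r H R" by (rule sylow_exists[OF H r(1)])
  have "\<not> R \<subseteq> K" using sylow_index[OF R K(1) _ K(2) H r(1) n] r(2) by blast
  then obtain x where x: "x \<in> R" "x \<notin> K" by blast
  obtain k where "ord x = r ^ k" by (rule sylow_elem_ord[OF r(1) R x(1)])
  then show thesis using that x sylow_subset[OF R] by blast
qed

lemma subgroup_index:
  assumes "subgroup H G" "subgroup K G" "K \<subseteq> H"
  obtains n where "card H = card K * n" "n > 0"
  using lagrange_sub[OF assms(2,1,3)] card_sub_pos[OF assms(1)] by (metis dvdE nat_0_less_mult_iff)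

lemma subgroup_eq_prime_powers:
  assumes H: "subgroup H G" and K: "subgroup K G" "K \<subseteq> H"
    and e: "\<And>x r k. x \<in> H \<Longrightarrow> prime r \<Longrightarrow> ord x = r ^ k \<Longrightarrow> x \<in> K"
  shows "K = H"
proof -
  obtain n where n: "card H = card K * n" by (rule subgroup_index[OF H K])
  have "n = 1"
  proof (rule ccontr)
    assume "n \<noteq> 1"
    then obtain r where r: "prime r" "r dvd n" using prime_factor_nat by blast
    show False by (rule index_prime_dvd[OF H K n r]) (use e r in blast)
  qed
  then show ?thesis using n K(2) H by (intro card_seteq) auto
qed

lemma regular_index_power:
  assumes H: "subgroup H G" and K: "subgroup K G" "K \<subseteq> H" and p: "prime p"
    and reg: "\<And>x. x \<in> H \<Longrightarrow> \<not> p dvd ord x \<Longrightarrow> x \<in> K"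
  obtains k where "card H = card K * p ^ k"
proof -
  obtain n where n: "card H = card K * n" "n > 0" by (rule subgroup_index[OF H K])
  have "r = p" if r: "prime r" "r dvd n" for r
  proof (rule ccontr)
    assume "r \<noteq> p"
    obtain x k where x: "x \<in> H" "x \<notin> K" "ord x = r ^ k" by (rule index_prime_dvd[OF H K n(1) r])
    then have "\<not> p dvd ord x" using p r(1) \<open>r \<noteq> p\<close> by (metis prime_dvd_power primes_dvd_imp_eq)
    then show False using x reg by blast
  qed
  then obtain k where "n = p ^ k" using prime_powerI[OF n(2) p] by blast
  then show thesis using n that by blast
qed

lemma normal_in_iff: "N \<lhd> G \<longleftrightarrow> normal_in N (carrier G)"
proof
  assume N: "N \<lhd> G"
  have "n \<frown> h \<in> N" if "n \<in> N" "h \<in> carrier G" for n h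
    using normal.inv_op_closed1[OF N that(2,1)] by (simp add: conjugate_def)
  then show "normal_in N (carrier G)"
    using normal_imp_subgroup[OF N] subgroup.subset[OF normal_imp_subgroup[OF N]] by (simp add: normal_in_def)
next
  assume N: "normal_in N (carrier G)"
  have "x \<otimes> h \<otimes> inv x \<in> N" if "x \<in> carrier G" "h \<in> N" for x h
    using normal_in_conj[OF N that(2), of "inv x"] that(1) by (simp add: conjugate_def)
  then show "N \<lhd> G" using normal_in_subgroup[OF N] by (simp add: normal_inv_iff)
qed

lemma normal_in_set_mult:
  assumes A: "normal_in A H" and B: "normal_in B H" and H: "subgroup H G"
  shows "normal_in (A <#> B) H"
proof -
  note Ac = sub_carrier[OF normal_in_subgroup[OF A]] and Bc = sub_carrier[OF normal_in_subgroup[OF B]]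
  have "x \<frown> h \<in> A <#> B" if x: "x \<in> A <#> B" and h: "h \<in> H" for x h
  proof -
    from x obtain a b where "a \<in> A" "b \<in> B" "x = a \<otimes> b" unfolding set_mult_iff by blast
    then show ?thesis
      using normal_in_conj[OF A _ h] normal_in_conj[OF B _ h] Ac Bc sub_carrier[OF H h]
      unfolding set_mult_iff by (metis conj_mult)
  qed
  moreover have "subgroup (A <#> B) G"
    using subgroup_set_mult[OF B normal_in_subgroup[OF A] normal_in_subset[OF A] H] .
  moreover have "A <#> B \<subseteq> H"
    by (rule set_mult_sub[OF H normal_in_subset[OF A] normal_in_subset[OF B]])
  ultimately show ?thesis by (simp add: normal_in_def)
qed

lemma normal_in_inter:
  "\<lbrakk>normal_in A H; normal_in B H\<rbrakk> \<Longrightarrow> normal_in (A \<inter> B) H"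
  by (auto simp: normal_in_def subgroup_inter)

text \<open>A Sylow subgroup of \<open>U\<close> lies in a conjugate of \<open>P\<close>; normality
  of \<open>U\<close> lets it be conjugated back into P \<inter> U, which bounds the order of the
  intersection from below.\<close>

lemma sylow_inter_normal:
  assumes U: "normal_in U H" and H: "subgroup H G" and P: "sylow_in p H P" and p: "prime p"
  shows "sylow_in p U (P \<inter> U)"
proof -
  note Us = normal_in_subgroup[OF U] and Ps = sylow_subgroup[OF P]
  have I: "subgroup (P \<inter> U) G" by (rule subgroup_inter[OF Ps Us])
  obtain R where R: "sylow_in p U R" by (rule sylow_exists[OF Us p])
  obtain h where h: "h \<in> H" "R \<subseteq> cset P h"
    using sylow_contains[OF p H P sylow_subgroup[OF R] _ sylow_card[OF R]]
      sylow_subset[OF R] normal_in_subset[OF U] by blast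
  have hc: "h \<in> carrier G" using sub_carrier[OF H h(1)] .
  have "R \<subseteq> cset (P \<inter> U) h"
  proof
    fix x assume x: "x \<in> R"
    then obtain y where y: "y \<in> P" "x = y \<frown> h" using h by blast
    then have "y \<in> U" using normal_in_conj_iff[OF U H sub_carrier[OF Ps y(1)] h(1)] x sylow_subset[OF R] by blast
    then show "x \<in> cset (P \<inter> U) h" using y by blast
  qed
  then have "card R \<le> card (P \<inter> U)"
    using card_mono[of "cset (P \<inter> U) h" R] card_cset[of "P \<inter> U" h] subgroup.subset[OF I] hc I by simp
  moreover have "card (P \<inter> U) dvd p ^ multiplicity p (card H)"
    using lagrange_sub[OF I Ps] sylow_card[OF P] by simp
  then obtain j where j: "card (P \<inter> U) = p ^ j" using divides_primepow_nat[OF p] by blast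
  have "p ^ j dvd card U" using lagrange_sub[OF I Us] j by simp
  then have "j \<le> multiplicity p (card U)"
    using card_sub_pos[OF Us] p by (intro multiplicity_geI) auto
  then have "card (P \<inter> U) \<le> card R" using j sylow_card[OF R] prime_gt_0_nat[OF p] by (simp add: power_increasing)
  ultimately show ?thesis using I sylow_card[OF R] by (simp add: sylow_in_def)
qed

text \<open>The order of \<open>z\<close> modulo \<open>V\<close> divides both the order of
  \<open>z\<close> and \<open>n\<close>. It is computed as the index of \<open>V\<close> in the
  product of the cyclic group of \<open>z\<close> with \<open>V\<close>.\<close>

lemma coprime_ord_in_normal:
  assumes V: "normal_in V U" and U: "subgroup U G" and n: "card U = card V * n"
    and z: "z \<in> U" "coprime (ord z) n"
  shows "z \<in> V"
proof -
  note Vs = normal_in_subgroup[OF V]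
  have zc: "z \<in> carrier G" using sub_carrier[OF U z(1)] .
  let ?A = "generate G {z} <#> V"
  have A: "subgroup ?A G" by (rule subgroup_set_mult[OF V subgroup_cyclic[OF zc] cyclic_sub[OF U z(1)] U])
  have VA: "V \<subseteq> ?A" and zA: "z \<in> ?A"
    using sub_set_mult[OF subgroup_cyclic[OF zc] Vs] mem_cyclic by auto
  obtain m where m: "card ?A = card V * m" by (rule subgroup_index[OF A Vs VA])
  have "?A \<subseteq> U" by (rule set_mult_sub[OF U cyclic_sub[OF U z(1)] normal_in_subset[OF V]])
  then obtain l where "card U = card ?A * l" by (rule subgroup_index[OF U A])
  then have "n = m * l" using m n card_sub_pos[OF Vs] by simp
  moreover have "m * card (generate G {z} \<inter> V) = ord z"
    using product_formula[OF subgroup_cyclic[OF zc] Vs] m card_cyclic[OF zc] card_sub_pos[OF Vs]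
    by (simp add: algebra_simps)
  ultimately have "m = 1" using z(2) by (metis coprime_common_divisor_nat dvd_triv_left)
  then have "V = ?A" using m VA A by (intro card_seteq) auto
  then show ?thesis using zA by simp
qed

text \<open>Modulo \<open>V\<close> the subgroup \<open>Z\<close> is a central p-group of index
  prime to \<open>p\<close>, so it has a complement formed by the p-regular elements of the
  quotient. Since |V| is prime to \<open>p\<close>, being p-regular can be tested modulo
  \<open>V\<close>.\<close>

lemma regular_subgroup_mod:
  assumes Y: "subgroup Y G" and V: "normal_in V Y" and Z: "subgroup Z G" "V \<subseteq> Z" "Z \<subseteq> Y"
    and com: "\<And>z y. z \<in> Z \<Longrightarrow> y \<in> Y \<Longrightarrow> \<exists>v\<in>V. z \<frown> y = z \<otimes> v"
    and k: "card Z = card V * p ^ k" and m: "card Y = card Z * m" "\<not> p dvd m"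
    and pV: "\<not> p dvd card V" and p: "prime p"
  shows "subgroup {y \<in> Y. \<not> p dvd ord y} G"
proof -
  note Yc = sub_carrier[OF Y] and Vs = normal_in_subgroup[OF V] and VY = normal_in_subset[OF V]
  note Vc = sub_carrier[OF Vs]
  define K where "K = G\<lparr>carrier := Y\<rparr>"
  interpret K: group K unfolding K_def by (rule subgroup_imp_group[OF Y])
  have VK: "V \<lhd> K"
  proof -
    have "y \<otimes> v \<otimes> inv y \<in> V" if "y \<in> Y" "v \<in> V" for y v
      using normal_in_conj[OF V that(2), of "inv y"] that Y Yc by (simp add: conjugate_def subgroup.m_inv_closed)
    moreover have "inv\<^bsub>K\<^esub> y = inv y" if "y \<in> Y" for y
      unfolding K_def using m_inv_consistent[OF Y that] .
    moreover have "subgroup V K" unfolding K_def by (rule subgroup_incl[OF Vs Y VY])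
    ultimately show ?thesis by (simp add: K.normal_inv_iff) (simp add: K_def)
  qed
  interpret V: normal V K by (rule VK)
  define Q where "Q = K Mod V"
  define f where "f = (\<lambda>a. V #>\<^bsub>K\<^esub> a)"
  have Qg: "group Q" unfolding Q_def by (rule V.factorgroup_is_group)
  have Qc: "carrier Q = f ` Y" by (auto simp: Q_def f_def carrier_FactGroup K_def)
  have Q1: "\<one>\<^bsub>Q\<^esub> = V" by (simp add: Q_def)
  interpret Q: finite_group Q
    using Qg Qc Y by (simp add: finite_group_def finite_group_axioms_def)
  have fh: "group_hom K Q f"
    using V.r_coset_hom_Mod K.group_axioms Qg by (simp add: group_hom_def group_hom_axioms_def Q_def f_def)
  interpret f: group_hom K Q f by (rule fh)
  have fm: "f (x \<otimes> y) = f x \<otimes>\<^bsub>Q\<^esub> f y" if "x \<in> Y" "y \<in> Y" for x y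
    using f.hom_mult[of x y] that by (simp add: K_def)
  have fp: "f (x [^] (n::nat)) = f x [^]\<^bsub>Q\<^esub> n" if "x \<in> Y" for x n
    using f.hom_nat_pow[of x n] that by (simp add: K_def nat_pow_consistent[symmetric])
  have fV: "f x = V \<longleftrightarrow> x \<in> V" if "x \<in> Y" for x
    using that K.coset_join1[OF _ _ V.subgroup_axioms, of x] K.coset_join2[OF _ V.subgroup_axioms, of x]
    by (auto simp: f_def K_def VY)
  have finj: "f x = f y \<longleftrightarrow> (\<exists>v\<in>V. x = v \<otimes> y)" if "x \<in> Y" "y \<in> Y" for x y
  proof -
    have "f x = f y \<longleftrightarrow> x \<in> V #>\<^bsub>K\<^esub> y"
      using K.repr_independence[of x V y] K.rcos_self[of x V] V.subgroup_axioms that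
      by (auto simp: f_def K_def)
    also have "\<dots> \<longleftrightarrow> (\<exists>v\<in>V. x = v \<otimes> y)" by (auto simp: r_coset_def K_def)
    finally show ?thesis .
  qed
  have cardf: "card A = card (f ` A) * card V" if A: "subgroup A G" "V \<subseteq> A" "A \<subseteq> Y" for A
  proof (rule card_fibers[of A f])
    fix y assume "y \<in> f ` A"
    then obtain a where a: "a \<in> A" "y = f a" by blast
    have "{x \<in> A. f x = y} = (\<lambda>v. v \<otimes> a) ` V"
    proof (rule subset_antisym; rule subsetI)
      fix x assume "x \<in> {x \<in> A. f x = y}"
      then show "x \<in> (\<lambda>v. v \<otimes> a) ` V" using a finj[of x a] A(3) by blast
    next
      fix x assume "x \<in> (\<lambda>v. v \<otimes> a) ` V"
      then obtain v where v: "v \<in> V" "x = v \<otimes> a" by blast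
      have va: "v \<otimes> a \<in> A" using v a A by (auto simp: subgroup.m_closed)
      show "x \<in> {x \<in> A. f x = y}" using a v finj[of "v \<otimes> a" a] va A(3) by blast
    qed
    moreover have "inj_on (\<lambda>v. v \<otimes> a) V" using Vc sub_carrier[OF A(1) a(1)] by (auto simp: inj_on_def)
    ultimately show "card {x \<in> A. f x = y} = card V" by (simp add: card_image)
  qed (use A in auto)
  have cZ: "card (f ` Z) = p ^ k" using cardf[OF Z] k card_sub_pos[OF Vs] by simp
  have cQ: "card (carrier Q) = card (f ` Z) * m"
    using cardf[OF Y VY order_refl] m(1) k cZ Qc card_sub_pos[OF Vs] by simp
  have fZs: "subgroup (f ` Z) Q"
    using f.subgroup_img_is_subgroup[of Z] subgroup_incl[OF Z(1) Y Z(3)] by (simp add: K_def)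
  have "f ` Z \<subseteq> Q.cz (carrier Q) (carrier Q)"
  proof -
    have "f z \<otimes>\<^bsub>Q\<^esub> f y = f y \<otimes>\<^bsub>Q\<^esub> f z" if z: "z \<in> Z" and y: "y \<in> Y" for z y
    proof -
      have zY: "z \<in> Y" using z Z by blast
      note zc = Yc[OF zY] and yc = Yc[OF y]
      obtain v where v: "v \<in> V" "z \<frown> y = z \<otimes> v" using com[OF z y] by blast
      \<comment> \<open>Conjugation by \<open>?g\<close> moves \<open>v\<close> to the left of the
        product, the side on which the cosets defining \<open>f\<close> carry
        \<open>V\<close>.\<close>
      let ?g = "inv (y \<otimes> z)"
      have g: "?g \<in> Y" using y zY Y by (simp add: subgroup.m_closed subgroup.m_inv_closed)
      have "z \<otimes> y = y \<otimes> (z \<frown> y)" using zc yc by (simp add: conjugate_def m_assoc inv_mult_cancel)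
      also have "\<dots> = y \<otimes> z \<otimes> v" using v zc yc Vc by (simp add: m_assoc)
      also have "\<dots> = (v \<frown> ?g) \<otimes> (y \<otimes> z)" using v zc yc Vc by (simp add: conjugate_def m_assoc)
      finally have "\<exists>v\<in>V. z \<otimes> y = v \<otimes> (y \<otimes> z)" using normal_in_conj[OF V v(1) g] by blast
      then have "f (z \<otimes> y) = f (y \<otimes> z)"
        using finj[OF subgroup.m_closed[OF Y zY y] subgroup.m_closed[OF Y y zY]] by simp
      then show ?thesis using fm zY y by simp
    qed
    then show ?thesis using Z(3) by (auto simp: Q.cz_def Qc)
  qed
  from Q.central_hall_complement(1)[OF Q.carrier_subgroup fZs this cQ]
  have L: "subgroup {x \<in> carrier Q. coprime (Q.ord x) (p ^ k)} Q"
    using p m(2) cZ by (simp add: prime_imp_coprime coprime_power_left_iff)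
  have Liff: "\<not> p dvd ord y \<longleftrightarrow> coprime (Q.ord (f y)) (p ^ k)" if y: "y \<in> Y" for y
  proof
    note yc = Yc[OF y] and fy = f.hom_closed[of y, unfolded K_def, simplified, OF y]
    assume np: "\<not> p dvd ord y"
    have "f y [^]\<^bsub>Q\<^esub> ord y = \<one>\<^bsub>Q\<^esub>" using fp[OF y, of "ord y"] yc fV[of \<one>] Q1 Vs Y
      by (simp add: subgroup.one_closed)
    then have "Q.ord (f y) dvd ord y" using Q.pow_eq_id[OF fy] by simp
    then have "\<not> p dvd Q.ord (f y)" using np dvd_trans by blast
    then show "coprime (Q.ord (f y)) (p ^ k)"
      using p by (simp add: coprime_commute coprime_power_right_iff prime_imp_coprime)
  next
    note yc = Yc[OF y] and fy = f.hom_closed[of y, unfolded K_def, simplified, OF y]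
    assume co: "coprime (Q.ord (f y)) (p ^ k)"
    show "\<not> p dvd ord y"
    \<comment> \<open>For k = 0 coprimality to p^k says nothing, but then |Y| itself is prime to
      \<open>p\<close>.\<close>
    proof (cases "k = 0")
      case True
      then have "ord y dvd card V * m" using ord_dvd_sub[OF Y y] m(1) k by simp
      then show ?thesis using pV m(2) p by (metis dvd_trans prime_dvd_mult_iff)
    next
      case False
      then have np: "\<not> p dvd Q.ord (f y)"
        using co p by (metis coprime_power_right_iff coprime_common_divisor_nat dvd_refl neq0_conv not_prime_1)
      let ?o = "Q.ord (f y)"
      have yo: "y [^] ?o \<in> V" using fV[of "y [^] ?o"] fp[OF y, of ?o] Q.pow_ord_eq_1[OF fy] Q1 sub_pow[OF Y y] by simp
      have "(y [^] ?o) [^] card V = \<one>"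
        using ord_dvd_sub[OF Vs yo] Vc[OF yo] by (simp add: pow_eq_id)
      then have "ord y dvd ?o * card V" using yc by (simp add: nat_pow_pow pow_eq_id)
      then show ?thesis using np pV p by (metis dvd_trans prime_dvd_mult_iff)
    qed
  qed
  show ?thesis
  proof (rule finite_subgroupI)
    show "{y \<in> Y. \<not> p dvd ord y} \<subseteq> carrier G" using Yc by blast
    show "\<one> \<in> {y \<in> Y. \<not> p dvd ord y}"
      using Y not_prime_unit[of p] p by (auto simp: subgroup.one_closed)
    fix x y assume xy: "x \<in> {y \<in> Y. \<not> p dvd ord y}" "y \<in> {y \<in> Y. \<not> p dvd ord y}"
    then have "f x \<otimes>\<^bsub>Q\<^esub> f y \<in> {x \<in> carrier Q. coprime (Q.ord x) (p ^ k)}"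
      using Liff Qc by (intro subgroup.m_closed[OF L]) auto
    then show "x \<otimes> y \<in> {y \<in> Y. \<not> p dvd ord y}"
      using xy fm Liff[of "x \<otimes> y"] Y by (auto simp: subgroup.m_closed)
  qed
qed

text \<open>\<open>U/V\<close> is the largest normal \<open>p\<close>-subgroup of \<open>G/V\<close>, and \<open>J/V\<close> its centraliser, which contains \<open>z\<close>. The
  first layer of \<open>J\<close> not inside \<open>U\<close> would be a \<open>p'\<close>-group extended by a central \<open>p\<close>-group, modulo \<open>V\<close>; it
  splits by central transfer and so contradicts the maximality of \<open>V\<close> or \<open>U\<close>.\<close>

lemma subgroup_centralizer_mod:
  assumes H: "subgroup H G" and V: "normal_in V (carrier G)" and U: "U \<subseteq> carrier G"
  shows "subgroup {g \<in> H. \<forall>u\<in>U. \<exists>v\<in>V. u \<frown> g = u \<otimes> v} G"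
proof (rule finite_subgroupI)
  note Vs = normal_in_subgroup[OF V]
  note Vc = sub_carrier[OF Vs] and Hc = sub_carrier[OF H]
  show "{g \<in> H. \<forall>u\<in>U. \<exists>v\<in>V. u \<frown> g = u \<otimes> v} \<subseteq> carrier G" using Hc by blast
  have "\<one> \<in> V" "\<one> \<in> H" using Vs H by (auto intro: subgroup.one_closed)
  then show "\<one> \<in> {g \<in> H. \<forall>u\<in>U. \<exists>v\<in>V. u \<frown> g = u \<otimes> v}" using U by force
  fix g h
  assume g: "g \<in> {g \<in> H. \<forall>u\<in>U. \<exists>v\<in>V. u \<frown> g = u \<otimes> v}" and h: "h \<in> {g \<in> H. \<forall>u\<in>U. \<exists>v\<in>V. u \<frown> g = u \<otimes> v}"
  have gh: "g \<in> H" "h \<in> H" using g h by auto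
  note gc = Hc[OF gh(1)] Hc[OF gh(2)]
  have "\<exists>v\<in>V. u \<frown> (g \<otimes> h) = u \<otimes> v" if u: "u \<in> U" for u
  proof -
    have uc: "u \<in> carrier G" using U u by blast
    have "\<exists>v\<in>V. u \<frown> g = u \<otimes> v" "\<exists>v\<in>V. u \<frown> h = u \<otimes> v" using g h u by simp_all
    then obtain v w where v: "v \<in> V" "u \<frown> g = u \<otimes> v" and w: "w \<in> V" "u \<frown> h = u \<otimes> w" by blast
    have vh: "v \<frown> h \<in> V" using normal_in_conj[OF V v(1) gc(2)] .
    have "u \<frown> (g \<otimes> h) = (u \<otimes> v) \<frown> h" using v gc uc by (simp add: conj_conj[symmetric])
    also have "\<dots> = u \<otimes> (w \<otimes> v \<frown> h)"
      using w(2) Vc[OF v(1)] Vc[OF w(1)] Vc[OF vh] uc gc by (simp add: conj_mult m_assoc)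
    finally show ?thesis using subgroup.m_closed[OF Vs w(1) vh] by blast
  qed
  then show "g \<otimes> h \<in> {g \<in> H. \<forall>u\<in>U. \<exists>v\<in>V. u \<frown> g = u \<otimes> v}" using gh H by (simp add: subgroup.m_closed)
qed

lemma p_regular_in_core:
  assumes p: "prime p"
    and V: "normal_in V (carrier G)" "\<not> p dvd card V"
    and Vmax: "\<And>N. normal_in N (carrier G) \<Longrightarrow> \<not> p dvd card N \<Longrightarrow> N \<subseteq> V"
    and N: "N 0 = {\<one>}" "N r = carrier G" "\<And>i. i \<le> r \<Longrightarrow> normal_in (N i) (carrier G)"
      "\<And>i. i < r \<Longrightarrow> N i \<subseteq> N (Suc i)"
      "\<And>i. i < r \<Longrightarrow> \<exists>n. card (N (Suc i)) = card (N i) * n \<and> ((\<exists>k. n = p ^ k) \<or> \<not> p dvd n)"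
    and z: "z \<in> carrier G" "\<not> p dvd ord z" "\<not> p dvd card (orb (carrier G) z)"
  shows "z \<in> V"
proof -
  note Gs = carrier_subgroup and Vs = normal_in_subgroup[OF V(1)]
  note Vc = sub_carrier[OF Vs]
  define \<U> where "\<U> = {A. normal_in A (carrier G) \<and> V \<subseteq> A \<and> (\<exists>k. card A = card V * p ^ k)}"
  have V\<U>: "V \<in> \<U>" using V by (auto simp: \<U>_def intro!: exI[of _ 0])
  have "\<exists>U. U \<in> \<U> \<and> (\<forall>A. A \<in> \<U> \<longrightarrow> card A \<le> card U)"
  proof (rule ex_has_greatest_nat[of "\<lambda>A. A \<in> \<U>" V card])
    show "V \<in> \<U>" by (rule V\<U>)
    show "\<forall>A. A \<in> \<U> \<longrightarrow> card A < Suc (card (carrier G))"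
      using fin by (auto simp: \<U>_def normal_in_def less_Suc_eq_le intro: card_mono)
  qed
  then obtain U where U: "U \<in> \<U>" and Umax: "\<And>A. A \<in> \<U> \<Longrightarrow> card A \<le> card U" by blast
  obtain k where nU: "normal_in U (carrier G)" and VU: "V \<subseteq> U" and k: "card U = card V * p ^ k"
    using U by (auto simp: \<U>_def)
  note Us = normal_in_subgroup[OF nU]
  note Uc = sub_carrier[OF Us]
  \<comment> \<open>The index of \<open>V\<close> in U A divides a power of \<open>p\<close>, so the
    family is closed under products; hence a member of largest order contains all the
    others.\<close>
  have Utop: "A \<subseteq> U" if A: "A \<in> \<U>" for A
  proof -
    obtain l where nA: "normal_in A (carrier G)" and VA: "V \<subseteq> A" and l: "card A = card V * p ^ l"
      using A by (auto simp: \<U>_def)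
    note As = normal_in_subgroup[OF nA]
    have nUA: "normal_in (U <#> A) (carrier G)" by (rule normal_in_set_mult[OF nU nA Gs])
    note UAs = normal_in_subgroup[OF nUA]
    have sub: "U \<subseteq> U <#> A" "A \<subseteq> U <#> A" by (rule sub_set_mult[OF Us As])+
    obtain n where n: "card (U <#> A) = card V * n"
      by (rule subgroup_index[OF UAs Vs subset_trans[OF VU sub(1)]])
    have "V \<subseteq> U \<inter> A" using VU VA by blast
    then obtain m where m: "card (U \<inter> A) = card V * m"
      by (rule subgroup_index[OF subgroup_inter[OF Us As] Vs])
    have "card V * card V * (n * m) = card V * card V * p ^ (k + l)"
      using product_formula[OF Us As] n m k l by (simp add: power_add algebra_simps)
    then have "n * m = p ^ (k + l)" using card_sub_pos[OF Vs] by simp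
    then have "n dvd p ^ (k + l)" by (metis dvd_triv_left)
    then obtain j where "n = p ^ j" using divides_primepow_nat[OF p] by blast
    then have "U <#> A \<in> \<U>" using nUA n VU sub by (auto simp: \<U>_def)
    then have "card (U <#> A) \<le> card U" by (rule Umax)
    then have "U = U <#> A" using sub UAs by (intro card_seteq) auto
    then show ?thesis using sub by simp
  qed
  define J where "J = {g \<in> carrier G. \<forall>u\<in>U. \<exists>v\<in>V. u \<frown> g = u \<otimes> v}"
  have Js: "subgroup J G"
    unfolding J_def by (rule subgroup_centralizer_mod[OF Gs V(1) subgroup.subset[OF Us]])
  have nJ: "normal_in J (carrier G)"
  proof -
    have "g \<frown> h \<in> J" if g: "g \<in> J" and h: "h \<in> carrier G" for g h
    proof -
      have gc: "g \<in> carrier G" using g by (simp add: J_def)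
      have "\<exists>v\<in>V. u \<frown> (g \<frown> h) = u \<otimes> v" if u: "u \<in> U" for u
      proof -
        let ?u = "u \<frown> (inv h)"
        have u': "?u \<in> U" using normal_in_conj[OF nU u] h by simp
        then obtain v where v: "v \<in> V" "?u \<frown> g = ?u \<otimes> v" using g by (auto simp: J_def)
        have "u \<frown> (g \<frown> h) = ?u \<frown> g \<frown> h"
          using Uc[OF u] gc h by (simp add: conj_conj conjugate_def[of g h])
        also have "\<dots> = u \<otimes> v \<frown> h" unfolding v(2) using Uc[OF u] Vc[OF v(1)] h by (simp add: conj_mult)
        finally show ?thesis using normal_in_conj[OF V(1) v(1) h] by blast
      qed
      then show ?thesis using gc h by (simp add: J_def)
    qed
    then show ?thesis using Js subgroup.subset[OF Js] by (simp add: normal_in_def)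
  qed
  have VJ: "V \<subseteq> J"
  proof
    fix w assume w: "w \<in> V"
    have "\<exists>v\<in>V. u \<frown> w = u \<otimes> v" if u: "u \<in> U" for u
    proof -
      have "(inv w) \<frown> u \<otimes> w \<in> V"
        using w Vs normal_in_conj[OF V(1) _ Uc[OF u], of "inv w"] by (simp add: subgroup.m_closed subgroup.m_inv_closed)
      moreover have "u \<frown> w = u \<otimes> ((inv w) \<frown> u \<otimes> w)"
        using Uc[OF u] Vc[OF w] by (simp add: conjugate_def m_assoc inv_mult_cancel)
      ultimately show ?thesis by blast
    qed
    then show "w \<in> J" using Vc[OF w] by (simp add: J_def)
  qed
  \<comment> \<open>\<open>z\<close> centralises a Sylow p-subgroup P of \<open>G\<close>. As U/V is
    a p-group, U = (P \<inter> U) V, so \<open>z\<close> acts trivially on U/V.\<close>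
  have zJ: "z \<in> J"
  proof -
    obtain P where P: "sylow_in p (carrier G) P" "P \<subseteq> cz (carrier G) {z}"
      using sylow_centralizes[OF Gs z(1) p z(3)] by blast
    have PU: "sylow_in p U (P \<inter> U)" by (rule sylow_inter_normal[OF nU Gs P(1) p])
    note PUs = sylow_subgroup[OF PU]
    have nV: "normal_in V U" using normal_in_mono[OF V(1) VU] nU normal_in_subset by blast
    let ?A = "(P \<inter> U) <#> V"
    have A: "subgroup ?A G" by (rule subgroup_set_mult[OF nV PUs _ Us]) auto
    have AU: "?A \<subseteq> U" by (rule set_mult_sub[OF Us _ VU]) auto
    note sub = sub_set_mult[OF PUs Vs]
    obtain n where n: "card U = card ?A * n" by (rule subgroup_index[OF Us A AU])
    obtain m where m: "card ?A = card V * m" by (rule subgroup_index[OF A Vs sub(2)])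
    have "m * n = p ^ k" using n m k card_sub_pos[OF Vs] by simp
    then have "n dvd p ^ k" by (metis dvd_triv_right)
    moreover have "\<not> p dvd n" by (rule sylow_index[OF PU A sub(1) AU Us p n])
    ultimately have "n = 1" using divides_primepow_nat[OF p] by (metis dvd_power neq0_conv power_0)
    then have UA: "?A = U" using n AU Us by (intro card_seteq) auto
    have "\<exists>v\<in>V. u \<frown> z = u \<otimes> v" if u: "u \<in> U" for u
    proof -
      have "u \<in> ?A" using UA u by simp
      then obtain w v where w: "w \<in> P" "w \<in> U" "v \<in> V" "u = w \<otimes> v" unfolding set_mult_iff by blast
      have "w \<otimes> z = z \<otimes> w" using P(2) w(1) by (auto simp: cz_def)
      then have wz: "w \<frown> z = w" using conj_fix[OF Uc[OF w(2)] z(1)] by simp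
      have vz: "v \<frown> z \<in> V" using normal_in_conj[OF V(1) w(3) z(1)] .
      have "u \<frown> z = w \<otimes> v \<frown> z" using w z(1) wz Uc[OF w(2)] Vc[OF w(3)] by (simp add: conj_mult)
      also have "\<dots> = u \<otimes> (inv v \<otimes> v \<frown> z)" unfolding w(4)
        using Uc[OF w(2)] Vc[OF w(3)] Vc[OF vz] by (simp add: m_assoc inv_mult_cancel)
      finally show ?thesis using vz w(3) Vs by (blast intro: subgroup.m_closed subgroup.m_inv_closed)
    qed
    then show ?thesis using z(1) by (simp add: J_def)
  qed
  have JU: "J \<inter> N i \<subseteq> U" if "i \<le> r" for i
    using that
  proof (induction i)
    case 0
    then show ?case using N(1) subgroup.one_closed[OF Us] by auto
  next
    case (Suc i)
    then have ir: "i < r" and IH: "J \<inter> N i \<subseteq> U" by auto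
    let ?Y = "J \<inter> N (Suc i)" and ?Yo = "J \<inter> N i"
    have nN: "normal_in (N i) (carrier G)" "normal_in (N (Suc i)) (carrier G)" using N(3) ir by auto
    note Ns = normal_in_subgroup[OF nN(1)] normal_in_subgroup[OF nN(2)]
    have nY: "normal_in ?Y (carrier G)" "normal_in ?Yo (carrier G)" using normal_in_inter[OF nJ] nN by auto
    note Ys = normal_in_subgroup[OF nY(1)] normal_in_subgroup[OF nY(2)]
    obtain n where n: "card (N (Suc i)) = card (N i) * n" "(\<exists>k. n = p ^ k) \<or> \<not> p dvd n" using N(5)[OF ir] by blast
    obtain m where m: "card ?Y = card ?Yo * m" using subgroup_index[OF Ys] N(4)[OF ir] by blast
    have mn: "m dvd n"
    proof -
      have s: "subgroup (?Y <#> N i) G"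
        by (rule subgroup_set_mult[OF nN(1) Ys(1) normal_in_subset[OF nY(1)] Gs])
      have "?Y \<inter> N i = ?Yo" using N(4)[OF ir] by blast
      then have "card (?Y <#> N i) * card ?Yo = (card ?Yo * m) * card (N i)"
        using product_formula[OF Ys(1) Ns(1)] unfolding m by (simp only:)
      also have "\<dots> = (card (N i) * m) * card ?Yo" by (simp only: mult_ac)
      finally have c: "card (?Y <#> N i) = card (N i) * m"
        using card_sub_pos[OF Ys(2)] by (metis mult_right_cancel not_gr_zero)
      have "card (?Y <#> N i) dvd card (N (Suc i))"
        by (rule lagrange_sub[OF s Ns(2) set_mult_sub[OF Ns(2)]]) (use N(4)[OF ir] in auto)
      then show ?thesis using c n(1) card_sub_pos[OF Ns(1)] by simp
    qed
    \<comment> \<open>Both ends of the layer are enlarged by \<open>V\<close>. The lower end then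
      lies in \<open>U\<close> by induction, hence is central modulo \<open>V\<close> in the upper
      end, which lies in \<open>J\<close>.\<close>
    let ?Yv = "?Y <#> V" and ?Z = "?Yo <#> V"
    have nY1: "normal_in ?Yv (carrier G)" and nZ: "normal_in ?Z (carrier G)"
      using normal_in_set_mult[OF _ V(1) Gs] nY by auto
    note Y1s = normal_in_subgroup[OF nY1] and Zs = normal_in_subgroup[OF nZ]
    have ZU: "?Z \<subseteq> U" by (rule set_mult_sub[OF Us IH VU])
    have Y1J: "?Yv \<subseteq> J" by (rule set_mult_sub[OF Js _ VJ]) auto
    have VZ: "V \<subseteq> ?Z" and VY1: "V \<subseteq> ?Yv" and YY1: "?Y \<subseteq> ?Yv"
      using sub_set_mult[OF Ys(1) Vs] sub_set_mult[OF Ys(2) Vs] by auto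
    have ZY1: "?Z \<subseteq> ?Yv" using N(4)[OF ir] by (intro mono_set_mult) auto
    obtain m' where m': "card ?Yv = card ?Z * m'" by (rule subgroup_index[OF Y1s Zs ZY1])
    have "m' dvd m"
    proof -
      have "?Y <#> ?Z = ?Yv"
      proof
        show "?Y <#> ?Z \<subseteq> ?Yv" by (rule set_mult_sub[OF Y1s YY1 ZY1])
        show "?Yv \<subseteq> ?Y <#> ?Z" using VZ by (intro mono_set_mult) auto
      qed
      then have pf: "card ?Z * m' * card (?Y \<inter> ?Z) = card ?Yo * m * card ?Z"
        using product_formula[OF Ys(1) Zs] m m' by simp
      have "?Yo \<subseteq> ?Y \<inter> ?Z" using N(4)[OF ir] sub_set_mult[OF Ys(2) Vs] by blast
      then obtain t where t: "card (?Y \<inter> ?Z) = card ?Yo * t"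
        by (rule subgroup_index[OF subgroup_inter[OF Ys(1) Zs] Ys(2)])
      have "(card ?Z * card ?Yo) * (m' * t) = (card ?Z * card ?Yo) * m"
        using pf t by (simp add: algebra_simps)
      then have "m' * t = m" using card_sub_pos[OF Zs] card_sub_pos[OF Ys(2)] by simp
      then show ?thesis by (metis dvd_triv_left)
    qed
    then have m'n: "m' dvd n" using mn dvd_trans by blast
    obtain h where h: "card ?Z = card V * p ^ h"
    proof -
      obtain t where t: "card ?Z = card V * t" by (rule subgroup_index[OF Zs Vs VZ])
      have "card ?Z dvd card U" by (rule lagrange_sub[OF Zs Us ZU])
      then have "t dvd p ^ k" using t k card_sub_pos[OF Vs] by simp
      then obtain j where "t = p ^ j" using divides_primepow_nat[OF p] by blast
      with t have "card ?Z = card V * p ^ j" by simp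
      then show thesis by (rule that)
    qed
    \<comment> \<open>If \<open>p\<close> divides the index of the enlarged layer, that index is a
      power of \<open>p\<close>. Otherwise the p-regular elements of \<open>?Yv\<close> form a
      normal p'-subgroup, which lies in \<open>V\<close>. Either way \<open>?Yv\<close> has p-power
      index over \<open>V\<close>.\<close>
    have "?Yv \<in> \<U>"
    proof (cases "p dvd m'")
      case True
      then have "p dvd n" using m'n dvd_trans by blast
      then obtain l where "n = p ^ l" using n(2) by blast
      then obtain j where "m' = p ^ j" using m'n divides_primepow_nat[OF p] by blast
      then have "card ?Yv = card V * p ^ (h + j)" using m' h by (simp add: power_add)
      then show ?thesis using nY1 VY1 by (auto simp: \<U>_def)
    next
      case False
      have nVY: "normal_in V ?Yv" by (rule normal_in_mono[OF V(1) VY1 normal_in_subset[OF nY1]])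
      let ?L = "{y \<in> ?Yv. \<not> p dvd ord y}"
      have Ls: "subgroup ?L G"
      proof (rule regular_subgroup_mod[OF Y1s nVY Zs VZ ZY1 _ h m' False V(2) p])
        fix z y assume "z \<in> ?Z" "y \<in> ?Yv"
        then show "\<exists>v\<in>V. z \<frown> y = z \<otimes> v" using ZU Y1J by (auto simp: J_def)
      qed
      have "normal_in ?L (carrier G)"
        using Ls normal_in_conj[OF nY1] sub_carrier[OF Y1s] subgroup.subset[OF Y1s] by (auto simp: normal_in_def)
      moreover have "\<not> p dvd card ?L"
      proof
        assume "p dvd card ?L"
        then obtain x where "x \<in> ?L" "ord x = p" by (rule cauchy[OF Ls p])
        then show False by simp
      qed
      ultimately have LV: "?L \<subseteq> V" by (rule Vmax)
      obtain j where "card ?Yv = card V * p ^ j"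
        by (rule regular_index_power[OF Y1s Vs VY1 p]) (use LV in blast)
      then show ?thesis using nY1 VY1 by (auto simp: \<U>_def)
    qed
    then show ?case using Utop YY1 by blast
  qed
  have "z \<in> U" using JU[of r] N(2) zJ z(1) by auto
  moreover have "coprime (ord z) (p ^ k)"
    using z(2) p by (simp add: coprime_commute coprime_power_right_iff prime_imp_coprime)
  ultimately show ?thesis
    using coprime_ord_in_normal[OF normal_in_mono[OF V(1) VU normal_in_subset[OF nU]] Us k] by blast
qed

abbreviation cl :: "'a \<Rightarrow> nat" where
  "cl x \<equiv> card (orb (carrier G) x)"

text \<open>These elements generate the commutator subgroup [a, G]. Quotients of two arbitrary class
  members are taken so that the generating set is itself invariant under conjugation.\<close>

definition quotients :: "'a \<Rightarrow> 'a set" where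
  "quotients a = (\<lambda>(c, d). inv c \<otimes> d) ` (orb (carrier G) a \<times> orb (carrier G) a)"

subsection \<open>Classes of coprime size\<close>

lemma orb_G_closed: "x \<in> carrier G \<Longrightarrow> y \<in> orb (carrier G) x \<Longrightarrow> y \<in> carrier G"
  by (auto simp: orb_def)

lemma orb_G_conj: "x \<in> carrier G \<Longrightarrow> y \<in> orb (carrier G) x \<Longrightarrow> g \<in> carrier G \<Longrightarrow> y \<frown> g \<in> orb (carrier G) x"
  by (auto simp: orb_def conj_conj)

lemma orb_G_eq: "x \<in> carrier G \<Longrightarrow> y \<in> orb (carrier G) x \<Longrightarrow> orb (carrier G) y = orb (carrier G) x"
  by (auto simp: orb_def[of _ x] orb_conj[OF carrier_subgroup])

lemma orb_G_finite: "finite (orb (carrier G) x)"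
  by (rule orb_finite[OF carrier_subgroup])

text \<open>Computing the index of the common centraliser in two ways gives cl a times the length of
  the C(a)-orbit of \<open>b\<close> as a multiple of cl b; by coprimality cl b divides that
  length.\<close>

lemma centralizer_transitive:
  assumes a: "a \<in> carrier G" and b: "b \<in> carrier G" and co: "coprime (cl a) (cl b)"
  shows "orb (cz (carrier G) {a}) b = orb (carrier G) b"
    "card (carrier G) = cl a * cl b * card (cz (carrier G) {a} \<inter> cz (carrier G) {b})"
proof -
  let ?A = "cz (carrier G) {a}" and ?B = "cz (carrier G) {b}"
  have A: "subgroup ?A G" and B: "subgroup ?B G" using a b by (auto intro!: subgroup_cz carrier_subgroup)
  have AB: "cz ?A {b} = ?A \<inter> ?B" by (auto simp: cz_def)
  have I: "subgroup (?A \<inter> ?B) G" by (rule subgroup_inter[OF A B])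
  obtain t where t: "card ?B = card (?A \<inter> ?B) * t" by (rule subgroup_index[OF B I]) auto
  let ?s = "card (orb ?A b)"
  have s: "?s * card (?A \<inter> ?B) = card ?A" using orb_card[OF A b] AB by simp
  have Gs: "cl a * card ?A = card (carrier G)" "cl b * card ?B = card (carrier G)"
    using orb_card[OF carrier_subgroup] a b by auto
  have "(cl a * ?s) * card (?A \<inter> ?B) = (cl b * t) * card (?A \<inter> ?B)"
    using Gs(1)[folded s] Gs(2)[unfolded t] by (simp add: mult_ac)
  then have "cl a * ?s = cl b * t" using card_sub_pos[OF I] by simp
  then have "cl b dvd cl a * ?s" by simp
  then have "cl b dvd ?s" using co by (metis coprime_commute coprime_dvd_mult_right_iff)
  then have le: "cl b \<le> ?s" using orb_pos[OF A] dvd_imp_le by blast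
  have "orb ?A b \<subseteq> orb (carrier G) b" by (auto simp: orb_def cz_def)
  then show eq: "orb ?A b = orb (carrier G) b" using le orb_G_finite by (intro card_seteq)
  then show "card (carrier G) = cl a * cl b * card (?A \<inter> ?B)" using Gs s by (metis mult.assoc)
qed

text \<open>\<open>G\<close> is transitive on pairs of members of the two classes, so a relation
  holding for one pair holds for all.\<close>

lemma coprime_class_pairs:
  assumes a: "a \<in> carrier G" and b: "b \<in> carrier G" and co: "coprime (cl a) (cl b)"
    and c: "c \<in> orb (carrier G) a" and d: "d \<in> orb (carrier G) b"
  obtains g where "g \<in> carrier G" "c = a \<frown> g" "d = b \<frown> g"
proof -
  obtain h where h: "h \<in> carrier G" "c = a \<frown> h" using c by (auto simp: orb_def)
  have "d \<frown> (inv h) \<in> orb (carrier G) b" using orb_G_conj[OF b d] h by simp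
  then obtain k where k: "k \<in> cz (carrier G) {a}" "d \<frown> (inv h) = b \<frown> k"
    using centralizer_transitive(1)[OF a b co] by (auto simp: orb_def)
  have kc: "k \<in> carrier G" and ka: "a \<frown> k = a" using k a by (auto simp: cz_def conj_fix)
  have "d = d \<frown> (inv h) \<frown> h" using orb_G_closed[OF b d] h by simp
  then have "d = b \<frown> (k \<otimes> h)" unfolding k(2) using b kc h by (simp add: conj_conj)
  moreover have "c = a \<frown> (k \<otimes> h)" using h a kc ka by (simp add: conj_conj[symmetric])
  ultimately show thesis using that kc h by blast
qed

lemma coprime_class_product:
  assumes a: "a \<in> carrier G" and b: "b \<in> carrier G" and co: "coprime (cl a) (cl b)"
  shows "cl (a \<otimes> b) dvd cl a * cl b"
    "\<lbrakk>c \<in> orb (carrier G) a; d \<in> orb (carrier G) b\<rbrakk> \<Longrightarrow> c \<otimes> d \<in> orb (carrier G) (a \<otimes> b)"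
proof -
  let ?I = "cz (carrier G) {a} \<inter> cz (carrier G) {b}"
  have I: "subgroup ?I G" using a b by (intro subgroup_inter subgroup_cz carrier_subgroup) auto
  have C: "subgroup (cz (carrier G) {a \<otimes> b}) G" using a b by (auto intro!: subgroup_cz carrier_subgroup)
  obtain t where t: "card (cz (carrier G) {a \<otimes> b}) = card ?I * t"
    by (rule subgroup_index[OF C I cz_mult[OF order_refl a b]])
  have "cl (a \<otimes> b) * t * card ?I = cl a * cl b * card ?I"
    using orb_card[OF carrier_subgroup m_closed[OF a b]] t centralizer_transitive(2)[OF a b co]
    by (simp add: mult_ac)
  then have "cl (a \<otimes> b) * t = cl a * cl b" using card_sub_pos[OF I] by simp
  then show "cl (a \<otimes> b) dvd cl a * cl b" by (metis dvd_triv_left)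
  assume "c \<in> orb (carrier G) a" "d \<in> orb (carrier G) b"
  then obtain g where g: "g \<in> carrier G" "c = a \<frown> g" "d = b \<frown> g"
    by (rule coprime_class_pairs[OF a b co])
  then have "c \<otimes> d = (a \<otimes> b) \<frown> g" using a b by (simp add: conj_mult)
  then show "c \<otimes> d \<in> orb (carrier G) (a \<otimes> b)" using g by (auto simp: orb_def)
qed

text \<open>Each translate of b^G by a member of a^G lies in the class of ab. When the sizes agree
  all these translates coincide, so quotients of members of a^G stabilise b^G.\<close>

lemma coprime_class_left:
  assumes a: "a \<in> carrier G" and b: "b \<in> carrier G" and co: "coprime (cl a) (cl b)"
  shows "cl b \<le> cl (a \<otimes> b)"
    "\<lbrakk>cl (a \<otimes> b) = cl b; c \<in> orb (carrier G) a; c' \<in> orb (carrier G) a; d \<in> orb (carrier G) b\<rbrakk>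
      \<Longrightarrow> inv c \<otimes> c' \<otimes> d \<in> orb (carrier G) b"
proof -
  have sub: "(\<lambda>d. c \<otimes> d) ` orb (carrier G) b \<subseteq> orb (carrier G) (a \<otimes> b)" if "c \<in> orb (carrier G) a" for c
    using coprime_class_product(2)[OF a b co that] by blast
  have card: "card ((\<lambda>d. c \<otimes> d) ` orb (carrier G) b) = cl b" if "c \<in> orb (carrier G) a" for c
    using orb_G_closed[OF a that] orb_G_closed[OF b] by (intro card_image) (auto simp: inj_on_def)
  show "cl b \<le> cl (a \<otimes> b)"
    using card_mono[OF orb_G_finite sub] card orb_self[OF carrier_subgroup a] by metis
  assume eq: "cl (a \<otimes> b) = cl b" and c: "c \<in> orb (carrier G) a" and c': "c' \<in> orb (carrier G) a"
    and d: "d \<in> orb (carrier G) b"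
  have "(\<lambda>d. c \<otimes> d) ` orb (carrier G) b = orb (carrier G) (a \<otimes> b)"
    using card_seteq[OF orb_G_finite sub[OF c]] card[OF c] eq by simp
  moreover have "c' \<otimes> d \<in> orb (carrier G) (a \<otimes> b)" using sub[OF c'] d by blast
  ultimately obtain e where e: "e \<in> orb (carrier G) b" "c' \<otimes> d = c \<otimes> e" by (metis imageE)
  then have "inv c \<otimes> c' \<otimes> d = e"
    using orb_G_closed[OF a c] orb_G_closed[OF a c'] orb_G_closed[OF b d] orb_G_closed[OF b e(1)]
    by (simp add: m_assoc inv_mult_cancel)
  then show "inv c \<otimes> c' \<otimes> d \<in> orb (carrier G) b" using e by simp
qed

lemma coprime_class_right:
  assumes a: "a \<in> carrier G" and b: "b \<in> carrier G" and co: "coprime (cl a) (cl b)"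
  shows "cl a \<le> cl (a \<otimes> b)"
    "\<lbrakk>cl (a \<otimes> b) = cl a; c \<in> orb (carrier G) a; d \<in> orb (carrier G) b; d' \<in> orb (carrier G) b\<rbrakk>
      \<Longrightarrow> c \<otimes> (d' \<otimes> inv d) \<in> orb (carrier G) a"
proof -
  have sub: "(\<lambda>c. c \<otimes> d) ` orb (carrier G) a \<subseteq> orb (carrier G) (a \<otimes> b)" if "d \<in> orb (carrier G) b" for d
    using coprime_class_product(2)[OF a b co _ that] by blast
  have card: "card ((\<lambda>c. c \<otimes> d) ` orb (carrier G) a) = cl a" if "d \<in> orb (carrier G) b" for d
    using orb_G_closed[OF b that] orb_G_closed[OF a] by (intro card_image) (auto simp: inj_on_def)
  show "cl a \<le> cl (a \<otimes> b)"
    using card_mono[OF orb_G_finite sub] card orb_self[OF carrier_subgroup b] by metis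
  assume eq: "cl (a \<otimes> b) = cl a" and c: "c \<in> orb (carrier G) a" and d: "d \<in> orb (carrier G) b"
    and d': "d' \<in> orb (carrier G) b"
  have "(\<lambda>c. c \<otimes> d) ` orb (carrier G) a = orb (carrier G) (a \<otimes> b)"
    using card_seteq[OF orb_G_finite sub[OF d]] card[OF d] eq by simp
  moreover have "c \<otimes> d' \<in> orb (carrier G) (a \<otimes> b)" using sub[OF d'] c by blast
  ultimately obtain e where e: "e \<in> orb (carrier G) a" "c \<otimes> d' = e \<otimes> d" by (metis imageE)
  then have "c \<otimes> (d' \<otimes> inv d) = e"
    using orb_G_closed[OF a c] orb_G_closed[OF b d'] orb_G_closed[OF b d] orb_G_closed[OF a e(1)]
    by (simp add: m_assoc[symmetric]) (simp add: m_assoc)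
  then show "c \<otimes> (d' \<otimes> inv d) \<in> orb (carrier G) a" using e by simp
qed

subsection \<open>Subgroups acting freely by multiplication\<close>

text \<open>Left multiplication is a free action, so \<open>D\<close> is a disjoint union of right
  cosets of \<open>S\<close>.\<close>

lemma left_mult_dvd:
  assumes S: "subgroup S G" and D: "finite D" "D \<subseteq> carrier G"
    and st: "\<And>s d. s \<in> S \<Longrightarrow> d \<in> D \<Longrightarrow> s \<otimes> d \<in> D"
  shows "card S dvd card D"
proof -
  note Sc = sub_carrier[OF S]
  let ?o = "\<lambda>d. (\<lambda>s. s \<otimes> d) ` S"
  have self: "d \<in> ?o d" if "d \<in> D" for d
    using that D subgroup.one_closed[OF S] by (metis image_eqI l_one subsetD)
  have un: "\<Union> (?o ` D) = D"
  proof (rule subset_antisym)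
    show "\<Union> (?o ` D) \<subseteq> D" using st by auto
    show "D \<subseteq> \<Union> (?o ` D)"
    proof
      fix d assume d: "d \<in> D"
      show "d \<in> \<Union> (?o ` D)"
      proof (rule UN_I)
        show "d \<in> D" "d \<in> ?o d" using d self by auto
      qed
    qed
  qed
  have sub: "?o d \<subseteq> ?o e" if d: "d \<in> D" and e: "e \<in> D" and x: "x \<in> ?o d" "x \<in> ?o e" for d e x
  proof
    fix y assume "y \<in> ?o d"
    then obtain s where s: "s \<in> S" "y = s \<otimes> d" by blast
    obtain t u where tu: "t \<in> S" "x = t \<otimes> d" "u \<in> S" "x = u \<otimes> e" using x by blast
    have dc: "d \<in> carrier G" "e \<in> carrier G" using d e D by auto
    have "d = inv t \<otimes> (t \<otimes> d)" using tu(1) Sc dc by (simp add: inv_mult_cancel)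
    also have "t \<otimes> d = u \<otimes> e" using tu by simp
    finally have "y = (s \<otimes> inv t \<otimes> u) \<otimes> e" using s tu(1,3) Sc dc by (simp add: m_assoc)
    then show "y \<in> ?o e" using s tu S by (blast intro: subgroup.m_closed subgroup.m_inv_closed)
  qed
  have "card S dvd card (\<Union> (?o ` D))"
  proof (rule dvd_partition)
    show "finite (\<Union> (?o ` D))" using un D by simp
    have "card (?o d) = card S" if "d \<in> D" for d
      using that D Sc by (intro card_image) (auto simp: inj_on_def)
    then show "\<forall>c\<in>?o ` D. card S dvd card c" by auto
    show "\<forall>c1\<in>?o ` D. \<forall>c2\<in>?o ` D. c1 \<noteq> c2 \<longrightarrow> c1 \<inter> c2 = {}"
    proof (intro ballI impI)
      fix c1 c2 assume c: "c1 \<in> ?o ` D" "c2 \<in> ?o ` D" "c1 \<noteq> c2"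
      then obtain d e where de: "d \<in> D" "c1 = ?o d" "e \<in> D" "c2 = ?o e" by blast
      show "c1 \<inter> c2 = {}"
      proof (rule ccontr)
        assume "c1 \<inter> c2 \<noteq> {}"
        then obtain x where "x \<in> ?o d" "x \<in> ?o e" using de by blast
        then have "c1 = c2" using sub[OF de(1,3)] sub[OF de(3,1)] de by blast
        then show False using c by simp
      qed
    qed
  qed
  then show ?thesis using un by simp
qed

lemma right_mult_ord_dvd:
  assumes t: "t \<in> carrier G" and D: "finite D" "D \<subseteq> carrier G" and st: "\<And>d. d \<in> D \<Longrightarrow> d \<otimes> t \<in> D"
  shows "ord t dvd card D"
proof -
  \<comment> \<open>Inversion turns right multiplication into left multiplication, so that
    \<open>left_mult_dvd\<close> applies.\<close>
  let ?E = "m_inv G ` D" and ?S = "{s \<in> carrier G. \<forall>d\<in>D. d \<otimes> inv s \<in> D}"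
  have cE: "card ?E = card D" using D by (intro card_image) (auto simp: inj_on_def subset_iff)
  have S: "subgroup ?S G"
  proof (rule finite_subgroupI)
    fix x y assume "x \<in> ?S" "y \<in> ?S"
    then have xy: "x \<in> carrier G" "y \<in> carrier G" "\<And>d. d \<in> D \<Longrightarrow> d \<otimes> inv x \<in> D" "\<And>d. d \<in> D \<Longrightarrow> d \<otimes> inv y \<in> D"
      by auto
    have "d \<otimes> inv (x \<otimes> y) \<in> D" if d: "d \<in> D" for d
      using xy(3)[OF xy(4)[OF d]] xy(1,2) d D(2) by (simp add: inv_mult_group m_assoc subset_iff)
    then show "x \<otimes> y \<in> ?S" using xy by simp
  qed (use D in auto)
  have "inv t \<in> ?S" using t st by simp
  then have "ord (inv t) dvd card ?S" by (rule ord_dvd_sub[OF S])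
  also have "card ?S dvd card ?E"
  proof (rule left_mult_dvd[OF S])
    fix s e assume s: "s \<in> ?S" and "e \<in> ?E"
    then obtain d where d: "d \<in> D" "e = inv d" by blast
    then have "s \<otimes> e = inv (d \<otimes> inv s)" using s D by (simp add: inv_mult_group subset_iff)
    then show "s \<otimes> e \<in> ?E" using s d by blast
  qed (use D in auto)
  finally show ?thesis using cE t by simp
qed

lemma generate_sub: "subgroup S G \<Longrightarrow> D \<subseteq> S \<Longrightarrow> generate G D \<subseteq> S"
  by (rule generate_subgroup_incl)

lemma normal_in_generate:
  assumes D: "D \<subseteq> carrier G" and inv: "\<And>d g. d \<in> D \<Longrightarrow> g \<in> carrier G \<Longrightarrow> d \<frown> g \<in> D"
  shows "normal_in (generate G D) (carrier G)"
proof -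
  have s: "subgroup (generate G D) G" by (rule generate_is_subgroup[OF D])
  have "x \<frown> g \<in> generate G D" if x: "x \<in> generate G D" and g: "g \<in> carrier G" for x g
    using x
  proof (induction rule: generate.induct)
    case one
    then show ?case using g by (simp add: generate.one)
  next
    case (incl h)
    then show ?case using inv[OF _ g] by (simp add: generate.incl)
  next
    case (inv h)
    then show ?case using assms(2)[OF _ g] D g by (metis generate.inv inv_conj subsetD)
  next
    case (eng h1 h2)
    then show ?case using sub_carrier[OF s] g by (simp add: conj_mult generate.eng)
  qed
  then show ?thesis using s subgroup.subset[OF s] by (simp add: normal_in_def)
qed

lemma commute_generate:
  assumes x: "x \<in> carrier G" and D: "D \<subseteq> carrier G" "\<And>d. d \<in> D \<Longrightarrow> d \<otimes> x = x \<otimes> d"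
    and m: "m \<in> generate G D"
  shows "m \<otimes> x = x \<otimes> m"
proof -
  have "generate G D \<subseteq> cz (carrier G) {x}"
    using D x by (intro generate_sub subgroup_cz carrier_subgroup) (auto simp: cz_def)
  then show ?thesis using m by (auto simp: cz_def)
qed

subsection \<open>Replacing the small class by one inside an abelian normal subgroup\<close>

lemma quotients_closed: "a \<in> carrier G \<Longrightarrow> quotients a \<subseteq> carrier G"
  by (auto simp: quotients_def orb_def)

text \<open>\<open>M\<close> has order prime to \<open>|a\<^sup>G|\<close>, hence is centralised by \<open>a\<close>; then the product of the class of
  \<open>a\<close> is a central element of \<open>a\<^bsup>|a\<^sup>G|\<^esup> M\<close>, while \<open>a\<^bsup>|M|\<^esup>\<close> is central too, so that \<open>a\<close> lies in \<open>M Z(G)\<close>.\<close>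

lemma reduce_small_class:
  assumes a: "a \<in> carrier G" and b: "b \<in> carrier G" and co: "coprime (cl a) (cl b)"
    and eq: "cl (a \<otimes> b) = cl b"
  defines "M \<equiv> generate G (quotients a)"
  obtains a' where "a' \<in> M" "quotients a' = quotients a" "cl a' = cl a"
    "normal_in M (carrier G)" "card M dvd cl b" "\<And>m n. m \<in> M \<Longrightarrow> n \<in> M \<Longrightarrow> m \<otimes> n = n \<otimes> m"
proof -
  note Gs = carrier_subgroup
  let ?A = "orb (carrier G) a" and ?B = "orb (carrier G) b"
  have Qc: "quotients a \<subseteq> carrier G" by (rule quotients_closed[OF a])
  have nM: "normal_in M (carrier G)" unfolding M_def
  proof (rule normal_in_generate[OF Qc])
    fix d g assume d: "d \<in> quotients a" and g: "g \<in> carrier G"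
    then obtain c e where c: "c \<in> ?A" "e \<in> ?A" "d = inv c \<otimes> e" by (auto simp: quotients_def)
    then have "d \<frown> g = inv (c \<frown> g) \<otimes> e \<frown> g"
      using g orb_G_closed[OF a] by (simp add: conj_mult inv_conj)
    moreover have "c \<frown> g \<in> ?A" "e \<frown> g \<in> ?A" using c orb_G_conj[OF a _ g] by auto
    ultimately show "d \<frown> g \<in> quotients a" by (auto simp: quotients_def)
  qed
  note Ms = normal_in_subgroup[OF nM]
  note Mc = sub_carrier[OF Ms]
  define S where "S = {s \<in> carrier G. \<forall>d\<in>?B. s \<otimes> d \<in> ?B}"
  have Ss: "subgroup S G"
  proof (rule finite_subgroupI)
    fix x y assume xy: "x \<in> S" "y \<in> S"
    then show "x \<otimes> y \<in> S" using orb_G_closed[OF b] by (auto simp: S_def m_assoc)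
  qed (use orb_G_closed[OF b] in \<open>auto simp: S_def\<close>)
  have QS: "quotients a \<subseteq> S"
    using coprime_class_left(2)[OF a b co eq] Qc by (auto simp: quotients_def S_def)
  have MS: "M \<subseteq> S" unfolding M_def by (rule generate_sub[OF Ss QS])
  have dvb: "card M dvd cl b"
    by (rule left_mult_dvd[OF Ms orb_G_finite]) (use MS orb_G_closed[OF b] in \<open>auto simp: S_def\<close>)
  have coM: "coprime (cl a) (card M)" using co dvb by (meson coprime_divisors dvd_refl)
  \<comment> \<open>The size of the \<open>M\<close>-orbit of \<open>c\<close> divides both cl a and
    |M|, which are coprime.\<close>
  have AM: "c \<otimes> m = m \<otimes> c" if c: "c \<in> ?A" and m: "m \<in> M" for c m
  proof -
    have cc: "c \<in> carrier G" by (rule orb_G_closed[OF a c])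
    have "card (orb M c) dvd cl c" by (rule orb_normal_dvd[OF nM Gs cc])
    then have "card (orb M c) dvd cl a" using orb_G_eq[OF a c] by simp
    moreover have "card (orb M c) dvd card M" using orb_card[OF Ms cc] by (metis dvd_triv_left)
    ultimately have "card (orb M c) = 1" using coM by (metis coprime_common_divisor_nat)
    moreover have "c \<in> orb M c" "c \<frown> m \<in> orb M c" using orb_self[OF Ms cc] m by (auto simp: orb_def)
    ultimately have "c \<frown> m = c" by (metis card_1_singletonE singletonD)
    then show ?thesis using conj_fix[OF cc Mc[OF m]] by simp
  qed
  have QM: "inv c \<otimes> d \<in> M" if "c \<in> ?A" "d \<in> ?A" for c d
    unfolding M_def using that by (intro generate.incl) (auto simp: quotients_def)
  have AA: "c \<otimes> d = d \<otimes> c" if c: "c \<in> ?A" and d: "d \<in> ?A" for c d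
  proof -
    have "c \<otimes> (inv c \<otimes> d) = (inv c \<otimes> d) \<otimes> c" by (rule AM[OF c QM[OF c d]])
    then have "c \<otimes> (c \<otimes> (inv c \<otimes> d)) = c \<otimes> ((inv c \<otimes> d) \<otimes> c)" by simp
    then show ?thesis using orb_G_closed[OF a c] orb_G_closed[OF a d]
      by (simp add: inv_mult_cancel m_assoc)
  qed
  have MM: "m \<otimes> n = n \<otimes> m" if m: "m \<in> M" and n: "n \<in> M" for m n
  proof -
    have "d \<otimes> n = n \<otimes> d" if d: "d \<in> quotients a" for d
    proof -
      obtain c e where c: "c \<in> ?A" "e \<in> ?A" "d = inv c \<otimes> e" using d by (auto simp: quotients_def)
      have cc: "c \<in> carrier G" "e \<in> carrier G" using c orb_G_closed[OF a] by auto
      have "e \<otimes> n = n \<otimes> e" "c \<otimes> n = n \<otimes> c" using AM c n by auto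
      moreover then have "inv c \<otimes> n = n \<otimes> inv c"
        using cc Mc[OF n] by (metis inv_closed inv_solve_left inv_solve_right m_assoc m_closed)
      ultimately show ?thesis unfolding c(3) using cc Mc[OF n]
        by (simp add: m_assoc) (simp add: m_assoc[symmetric])
    qed
    then show ?thesis using commute_generate[OF Mc[OF n] Qc _ m[unfolded M_def]] by blast
  qed
  let ?n = "cl a" and ?l = "card M"
  have al: "(a [^] ?l) \<frown> g = a [^] ?l" if g: "g \<in> carrier G" for g
  proof -
    have aA: "a \<in> ?A" "a \<frown> g \<in> ?A" using orb_self[OF Gs a] g by (auto simp: orb_def)
    let ?t = "inv a \<otimes> a \<frown> g"
    have t: "?t \<in> M" by (rule QM[OF aA])
    have "(a [^] ?l) \<frown> g = (a \<otimes> ?t) [^] ?l" using a g by (simp add: pow_conj inv_mult_cancel)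
    also have "\<dots> = a [^] ?l \<otimes> ?t [^] ?l" by (rule pow_mult_distrib[OF AM[OF aA(1) t] a Mc[OF t]])
    also have "?t [^] ?l = \<one>" using ord_dvd_sub[OF Ms t] Mc[OF t] by (simp only: pow_eq_id)
    finally show ?thesis using a by simp
  qed
  have "\<exists>c0 m0. c0 \<in> carrier G \<and> m0 \<in> M \<and> c0 = a [^] ?n \<otimes> m0 \<and> (\<forall>g\<in>carrier G. c0 \<frown> g = c0)"
  proof -
    \<comment> \<open>\<open>N\<close> is the double centraliser of the class. It is commutative
      because the class members commute with one another, so \<open>finprod\<close> over the class
      is meaningful.\<close>
    define Z where "Z = cz (carrier G) ?A"
    define N where "N = cz (carrier G) Z"
    have Ac: "?A \<subseteq> carrier G" using orb_G_closed[OF a] by blast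
    have Zc: "Z \<subseteq> carrier G" by (auto simp: Z_def cz_def)
    have Ns: "subgroup N G" unfolding N_def by (rule subgroup_cz[OF Gs Zc])
    have AN: "?A \<subseteq> N" using Ac by (auto simp: N_def Z_def cz_def)
    have NZ: "N \<subseteq> Z" using AA Ac by (auto simp: N_def Z_def cz_def)
    interpret N: comm_group "G\<lparr>carrier := N\<rparr>"
    proof (rule group.group_comm_groupI)
      show "group (G\<lparr>carrier := N\<rparr>)" by (rule subgroup_imp_group[OF Ns])
      fix x y assume "x \<in> carrier (G\<lparr>carrier := N\<rparr>)" "y \<in> carrier (G\<lparr>carrier := N\<rparr>)"
      then have "x \<in> N" "y \<in> Z" using NZ by auto
      then show "x \<otimes>\<^bsub>G\<lparr>carrier := N\<rparr>\<^esub> y = y \<otimes>\<^bsub>G\<lparr>carrier := N\<rparr>\<^esub> x" by (simp add: N_def cz_def)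
    qed
    define P :: "('a \<Rightarrow> 'a) \<Rightarrow> 'a set \<Rightarrow> 'a" where "P = (\<lambda>f. finprod (G\<lparr>carrier := N\<rparr>) f)"
    have Pin: "P f D \<in> N" if "\<And>x. x \<in> D \<Longrightarrow> f x \<in> N" for f :: "'a \<Rightarrow> 'a" and D
      using N.finprod_closed[of f D] that by (auto simp: P_def)
    have Pins: "P f (insert x D) = f x \<otimes> P f D"
      if "finite D" "x \<notin> D" "\<And>y. y \<in> insert x D \<Longrightarrow> f y \<in> N" for f :: "'a \<Rightarrow> 'a" and x D
      using N.finprod_insert[of D x f] that by (auto simp: P_def)
    have conjP: "P (\<lambda>x. x) D \<frown> g = P (\<lambda>x. x \<frown> g) D" if "D \<subseteq> ?A" and g: "g \<in> carrier G" for D g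
      using finite_subset[OF that(1) orb_G_finite] that(1)
    proof (induction rule: finite_induct)
      case empty
      then show ?case using g by (simp add: P_def)
    next
      case (insert x D)
      have "P (\<lambda>x. x) (insert x D) = x \<otimes> P (\<lambda>x. x) D"
        by (rule Pins) (use insert AN in auto)
      moreover have "P (\<lambda>x. x \<frown> g) (insert x D) = x \<frown> g \<otimes> P (\<lambda>x. x \<frown> g) D"
        by (rule Pins) (use insert AN orb_G_conj[OF a _ g] in auto)
      moreover have "P (\<lambda>x. x) D \<in> carrier G"
        using Pin[of D "\<lambda>x. x"] insert AN sub_carrier[OF Ns] by auto
      moreover have "x \<in> carrier G" using insert Ac by auto
      ultimately show ?case using insert g by (simp add: conj_mult)
    qed
    have powP: "\<exists>m\<in>M. P (\<lambda>x. x) D = a [^] card D \<otimes> m" if "D \<subseteq> ?A" for D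
      using finite_subset[OF that orb_G_finite] that
    proof (induction rule: finite_induct)
      case empty
      have "P (\<lambda>x. x) {} = \<one> \<otimes> \<one>" by (simp add: P_def)
      then show ?case using subgroup.one_closed[OF Ms] by (intro bexI[of _ \<one>]) auto
    next
      case (insert x D)
      then obtain m where m: "m \<in> M" "P (\<lambda>x. x) D = a [^] card D \<otimes> m" by auto
      have aA: "a \<in> ?A" by (rule orb_self[OF Gs a])
      let ?t = "inv a \<otimes> x"
      have t: "?t \<in> M" using QM[OF aA] insert by simp
      have xc: "x \<in> carrier G" using insert Ac by auto
      then have x: "x = a \<otimes> ?t" using a by (simp add: inv_mult_cancel)
      have c: "?t \<otimes> a [^] card D = a [^] card D \<otimes> ?t"
        by (rule commute_pow[OF Mc[OF t] a AM[OF aA t, symmetric]])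
      have "P (\<lambda>x. x) (insert x D) = x \<otimes> P (\<lambda>x. x) D"
        by (rule Pins) (use insert AN in auto)
      also have "\<dots> = a \<otimes> (?t \<otimes> a [^] card D) \<otimes> m"
        unfolding m(2) by (subst x) (use a Mc[OF t] Mc[OF m(1)] in \<open>simp only: m_assoc m_closed nat_pow_closed\<close>)
      also have "\<dots> = a [^] card (insert x D) \<otimes> (?t \<otimes> m)"
        unfolding c card_insert_disjoint[OF insert(1,2)] nat_pow_Suc2[OF a]
        using a Mc[OF t] Mc[OF m(1)] by (simp only: m_assoc m_closed nat_pow_closed)
      finally show ?case using subgroup.m_closed[OF Ms t m(1)] by blast
    qed
    let ?c = "P (\<lambda>x. x) ?A"
    obtain m where m: "m \<in> M" "?c = a [^] ?n \<otimes> m" using powP[OF order_refl] by blast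
    have "?c \<frown> g = ?c" if g: "g \<in> carrier G" for g
    proof -
      have im: "(\<lambda>x. x \<frown> g) ` ?A = ?A"
        using orb_G_conj[OF a _ g] inj_on_conj[OF g Ac] orb_G_finite
        by (intro endo_inj_surj) auto
      have "P (\<lambda>x. x) ((\<lambda>x. x \<frown> g) ` ?A) = P (\<lambda>x. x \<frown> g) ?A"
        unfolding P_def using AN im by (intro N.finprod_reindex inj_on_conj[OF g Ac]) auto
      then show ?thesis using conjP[OF order_refl g] im by simp
    qed
    moreover have "?c \<in> carrier G" using m a Mc by simp
    ultimately show ?thesis using m by blast
  qed
  then obtain c0 m0 where c0: "c0 \<in> carrier G" "c0 = a [^] ?n \<otimes> m0" "\<And>g. g \<in> carrier G \<Longrightarrow> c0 \<frown> g = c0"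
    and m0: "m0 \<in> M" by blast
  have "?n \<noteq> 0" using orb_pos[OF Gs] by simp
  then obtain u v where uv: "?n * u = ?l * v + gcd ?n ?l" using bezout_nat by blast
  then have uv: "?n * u = ?l * v + 1" using coM by simp
  \<comment> \<open>With n = |a^G| and l = |M|, Bezout gives a^(l v) a = a^(n u). The right side is
    c0^u times m0^(-u), and c0 and a^l are central; so the central part of \<open>a\<close> is
    \<open>\<zeta>\<close> and the remaining factor is a' in \<open>M\<close>.\<close>
  define \<zeta> where "\<zeta> = inv ((a [^] ?l) [^] v) \<otimes> c0 [^] u"
  define a' where "a' = (inv m0) [^] u"
  have im: "inv m0 \<in> M" using m0 Ms by (simp add: subgroup.m_inv_closed)
  have a'M: "a' \<in> M" unfolding a'_def by (rule sub_pow[OF Ms im])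
  have \<zeta>c: "\<zeta> \<in> carrier G" using a c0(1) by (simp add: \<zeta>_def)
  have \<zeta>fix: "\<zeta> \<frown> g = \<zeta>" if g: "g \<in> carrier G" for g
    using g a c0(1) al[OF g] c0(3)[OF g] by (simp add: \<zeta>_def conj_mult inv_conj[symmetric] pow_conj)
  have a_eq: "a = \<zeta> \<otimes> a'"
  proof -
    have cm: "c0 \<otimes> inv m0 = inv m0 \<otimes> c0"
      using conj_fix[OF c0(1) Mc[OF im]] c0(3)[OF Mc[OF im]] by simp
    have "a [^] ?n = c0 \<otimes> inv m0" unfolding c0(2) using a Mc[OF m0] by (simp add: m_assoc)
    then have "a [^] (?n * u) = c0 [^] u \<otimes> a'"
      using pow_mult_distrib[OF cm c0(1) Mc[OF im], of u] a by (simp add: a'_def nat_pow_pow[symmetric])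
    moreover have "a [^] (?n * u) = (a [^] ?l) [^] v \<otimes> a"
      unfolding uv using a by (simp add: nat_pow_pow)
    ultimately have "(a [^] ?l) [^] v \<otimes> a = c0 [^] u \<otimes> a'" by simp
    then have "inv ((a [^] ?l) [^] v) \<otimes> ((a [^] ?l) [^] v \<otimes> a) = inv ((a [^] ?l) [^] v) \<otimes> (c0 [^] u \<otimes> a')" by simp
    then show ?thesis using a c0(1) Mc[OF a'M] by (simp add: \<zeta>_def inv_mult_cancel m_assoc)
  qed
  have orb': "?A = (\<lambda>x. \<zeta> \<otimes> x) ` orb (carrier G) a'"
  proof -
    have "a \<frown> g = \<zeta> \<otimes> a' \<frown> g" if "g \<in> carrier G" for g
      using that \<zeta>fix[OF that] \<zeta>c Mc[OF a'M] conj_mult[OF \<zeta>c Mc[OF a'M] that] a_eq by simp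
    then show ?thesis by (force simp: orb_def image_image intro!: image_cong)
  qed
  have a'c: "a' \<in> carrier G" using Mc[OF a'M] .
  have "cl a' = cl a" unfolding orb' using \<zeta>c orb_G_closed[OF a'c]
    by (subst card_image) (auto simp: inj_on_def)
  moreover have "quotients a' = quotients a"
  proof -
    have "inv (\<zeta> \<otimes> x) \<otimes> (\<zeta> \<otimes> y) = inv x \<otimes> y" if "x \<in> orb (carrier G) a'" "y \<in> orb (carrier G) a'" for x y
      using \<zeta>c orb_G_closed[OF a'c that(1)] orb_G_closed[OF a'c that(2)]
      by (simp add: inv_mult_group m_assoc inv_mult_cancel)
    then show ?thesis unfolding quotients_def orb' by (force simp: image_iff)
  qed
  ultimately show thesis using that a'M nM dvb MM by blast
qed

lemma orb_one_iff: "x \<in> carrier G \<Longrightarrow> cl x = 1 \<longleftrightarrow> (\<forall>g\<in>carrier G. x \<frown> g = x)"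
proof
  assume x: "x \<in> carrier G" and 1: "cl x = 1"
  then obtain y where y: "orb (carrier G) x = {y}" by (meson card_1_singletonE)
  have "x = y" using orb_self[OF carrier_subgroup x] y by blast
  moreover have "x \<frown> g = y" if "g \<in> carrier G" for g using y that by (auto simp: orb_def)
  ultimately show "\<forall>g\<in>carrier G. x \<frown> g = x" by simp
next
  assume x: "x \<in> carrier G" and "\<forall>g\<in>carrier G. x \<frown> g = x"
  then have "orb (carrier G) x = {x}" using orb_self[OF carrier_subgroup x] by (auto simp: orb_def)
  then show "cl x = 1" by simp
qed

text \<open>A subgroup is determined by its elements of prime-power order; if all of these were
  central in \<open>G\<close>, so would be the cyclic group of \<open>b\<close>.\<close>

lemma noncentral_prime_power:
  assumes b: "b \<in> carrier G" "cl b \<noteq> 1"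
  obtains c q k where "c \<in> generate G {b}" "prime q" "ord c = q ^ k" "cl c \<noteq> 1"
proof -
  let ?B = "generate G {b}"
  define Z where "Z = cz (carrier G) (carrier G)"
  have Bs: "subgroup ?B G" by (rule subgroup_cyclic[OF b(1)])
  have Zs: "subgroup Z G" unfolding Z_def by (rule subgroup_cz[OF carrier_subgroup order_refl])
  have Ziff: "x \<in> Z \<longleftrightarrow> cl x = 1" if "x \<in> carrier G" for x
    using that orb_one_iff[OF that] conj_fix[OF that] by (auto simp: Z_def cz_def)
  have "\<not> (\<forall>x r k. x \<in> ?B \<longrightarrow> prime r \<longrightarrow> ord x = r ^ k \<longrightarrow> x \<in> Z)"
  proof
    assume *: "\<forall>x r k. x \<in> ?B \<longrightarrow> prime r \<longrightarrow> ord x = r ^ k \<longrightarrow> x \<in> Z"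
    have "?B \<inter> Z = ?B"
      by (rule subgroup_eq_prime_powers[OF Bs subgroup_inter[OF Bs Zs]]) (use * in auto)
    then show False using mem_cyclic[of b] Ziff[OF b(1)] b(2) by blast
  qed
  then obtain x r k where x: "x \<in> ?B" "prime r" "ord x = r ^ k" "x \<notin> Z" by blast
  then have "cl x \<noteq> 1" using Ziff sub_carrier[OF Bs] by blast
  then show thesis using that x by blast
qed

lemma cz_generate_elem:
  assumes "b \<in> carrier G" "c \<in> generate G {b}"
  shows "cz (carrier G) {b} \<subseteq> cz (carrier G) {c}"
proof
  fix x assume x: "x \<in> cz (carrier G) {b}"
  then have "x \<in> carrier G" "b \<otimes> x = x \<otimes> b" by (auto simp: cz_def)
  then have "c \<otimes> x = x \<otimes> c" using commute_generate[of x "{b}" c] assms by simp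
  then show "x \<in> cz (carrier G) {c}" using x by (simp add: cz_def)
qed

text \<open>The order of z v divides |z| |V|, because z v lies in the product of the cyclic group of
  \<open>z\<close> with \<open>V\<close>. This keeps products within reach of separation.\<close>

lemma regular_mult_normal:
  assumes p: "prime p" and V: "normal_in V (carrier G)" "\<not> p dvd card V"
    and v: "v \<in> V" and z: "z \<in> carrier G" "\<not> p dvd ord z"
  shows "\<not> p dvd ord (z \<otimes> v)"
proof -
  let ?A = "generate G {z} <#> V"
  note Vs = normal_in_subgroup[OF V(1)] and Zs = subgroup_cyclic[OF z(1)]
  have A: "subgroup ?A G" by (rule subgroup_set_mult[OF V(1) Zs subgroup.subset[OF Zs] carrier_subgroup])
  have "z \<otimes> v \<in> ?A" unfolding set_mult_iff using mem_cyclic v by blast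
  then have "ord (z \<otimes> v) dvd card ?A" by (rule ord_dvd_sub[OF A])
  also have "card ?A dvd ord z * card V"
    using product_formula[OF Zs Vs] card_cyclic[OF z(1)] by (metis dvd_triv_left)
  finally show ?thesis using z(2) V(2) p by (metis dvd_trans prime_dvd_mult_iff)
qed

end

text \<open>\<open>V\<close> is \<open>O\<^sub>p\<^sub>'(G)\<close> and \<open>M\<close> the subgroup generated by the quotients of elements of \<open>a\<^sup>G\<close>, which
  enters only through \<open>Mgen\<close>; \<open>a\<close> and \<open>b\<close> are the modified representatives.\<close>

locale isolated_pair = finite_group +
  fixes p q k :: nat and V M :: "'a set" and a b :: 'a
  assumes p: "prime p" and q: "prime q" and qp: "q \<noteq> p"
    and V: "normal_in V (carrier G)" "\<not> p dvd card V"
    and core: "\<And>z. \<lbrakk>z \<in> carrier G; \<not> p dvd ord z; \<not> p dvd cl z\<rbrakk> \<Longrightarrow> z \<in> V"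
    and M: "normal_in M (carrier G)" "card M dvd cl b" "\<And>m n. m \<in> M \<Longrightarrow> n \<in> M \<Longrightarrow> m \<otimes> n = n \<otimes> m"
    and a: "a \<in> M"
    and Mgen: "\<And>x m. \<lbrakk>x \<in> carrier G; \<And>c. c \<in> orb (carrier G) a \<Longrightarrow> c \<otimes> x = x \<otimes> c; m \<in> M\<rbrakk> \<Longrightarrow> m \<otimes> x = x \<otimes> m"
    and stab: "\<And>m d. m \<in> M \<Longrightarrow> d \<in> orb (carrier G) b \<Longrightarrow> m \<otimes> d \<in> orb (carrier G) b"
    and b: "b \<in> carrier G" "ord b = q ^ k" "cl b \<noteq> 1"
    and co: "coprime (cl a) (cl b)" and pa: "p dvd cl a"
    and sep: "\<And>z. \<lbrakk>z \<in> carrier G; \<not> p dvd ord z\<rbrakk> \<Longrightarrow> coprime (cl z) (cl a) \<or> coprime (cl z) (cl b)"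

text \<open>Passing to a' inside \<open>M\<close> and to a primary component of \<open>b\<close>
  costs nothing in separation, as the new class sizes equal or divide the old ones. What has to be
  re-established is that multiplication by \<open>M\<close> stabilises the new class of b'.\<close>

lemma (in finite_group) isolated_pair_exists:
  assumes p: "prime p"
    and V: "normal_in V (carrier G)" "\<not> p dvd card V"
    and core: "\<And>z. \<lbrakk>z \<in> carrier G; \<not> p dvd ord z; \<not> p dvd cl z\<rbrakk> \<Longrightarrow> z \<in> V"
    and a: "a \<in> carrier G" "\<not> p dvd ord a" and b: "b \<in> carrier G" "\<not> p dvd ord b"
    and co: "coprime (cl a) (cl b)" and pa: "p dvd cl a" and less: "cl a < cl b"
    and sep: "\<And>z. \<lbrakk>z \<in> carrier G; \<not> p dvd ord z\<rbrakk> \<Longrightarrow> coprime (cl z) (cl a) \<or> coprime (cl z) (cl b)"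
  obtains q k M a' b' where "isolated_pair G p q k V M a' b'" "cl a' = cl a" "b' \<in> generate G {b}"
proof -
  note Gs = carrier_subgroup
  have pb: "\<not> p dvd cl b" using co pa p by (metis coprime_common_divisor_nat not_prime_1)
  have bV: "b \<in> V" by (rule core[OF b pb])
  have reg_ab: "\<not> p dvd ord (x \<otimes> y)" if "x \<in> carrier G" "\<not> p dvd ord x" "y \<in> V" for x y
    by (rule regular_mult_normal[OF p V that(3,1,2)])
  have b1: "cl b \<noteq> 1" using less orb_pos[OF Gs, of a] by simp
  have ab: "cl (a \<otimes> b) = cl b"
  proof -
    note dv = coprime_class_product(1)[OF a(1) b(1) co] and ge = coprime_class_left(1)[OF a(1) b(1) co]
    have "coprime (cl (a \<otimes> b)) (cl a) \<or> coprime (cl (a \<otimes> b)) (cl b)"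
      using sep[OF _ reg_ab[OF a bV]] a(1) b(1) by simp
    then show ?thesis
    proof
      assume "coprime (cl (a \<otimes> b)) (cl b)"
      then have "cl (a \<otimes> b) dvd cl a" using dv by (simp add: coprime_dvd_mult_left_iff)
      then have "cl (a \<otimes> b) \<le> cl a" using orb_pos[OF Gs] dvd_imp_le by blast
      then show ?thesis using ge less by simp
    next
      assume "coprime (cl (a \<otimes> b)) (cl a)"
      then have "cl (a \<otimes> b) dvd cl b" using dv by (simp add: coprime_dvd_mult_right_iff)
      then have "cl (a \<otimes> b) \<le> cl b" using orb_pos[OF Gs] dvd_imp_le by blast
      then show ?thesis using ge by simp
    qed
  qed
  define M where "M = generate G (quotients a)"
  obtain a' where a': "a' \<in> M" "quotients a' = quotients a" "cl a' = cl a"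
    and M: "normal_in M (carrier G)" "card M dvd cl b" "\<And>m n. m \<in> M \<Longrightarrow> n \<in> M \<Longrightarrow> m \<otimes> n = n \<otimes> m"
    using reduce_small_class[OF a(1) b(1) co ab] unfolding M_def by blast
  note Ms = normal_in_subgroup[OF M(1)]
  note Mc = sub_carrier[OF Ms]
  note a'c = Mc[OF a'(1)]
  have pM: "\<not> p dvd card M" using M(2) pb dvd_trans by blast
  have a'reg: "\<not> p dvd ord a'" using ord_dvd_sub[OF Ms a'(1)] pM dvd_trans by blast
  have A'M: "orb (carrier G) a' \<subseteq> M" using normal_in_conj[OF M(1) a'(1)] by (auto simp: orb_def)
  obtain c q k where c: "c \<in> generate G {b}" "prime q" "ord c = q ^ k" "cl c \<noteq> 1"
    using noncentral_prime_power[OF b(1) b1] by blast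
  have Bs: "subgroup (generate G {b}) G" by (rule subgroup_cyclic[OF b(1)])
  have cc: "c \<in> carrier G" using c(1) sub_carrier[OF Bs] by blast
  have cb: "cl c dvd cl b" by (rule orb_dvd[OF Gs cc b(1) cz_generate_elem[OF b(1) c(1)]])
  have ordc: "ord c dvd ord b" using ord_dvd_sub[OF Bs c(1)] card_cyclic[OF b(1)] by simp
  then have creg: "\<not> p dvd ord c" using b(2) dvd_trans by blast
  have pc: "\<not> p dvd cl c" using cb pb dvd_trans by blast
  have cV: "c \<in> V" by (rule core[OF cc creg pc])
  have co': "coprime (cl a') (cl c)" using coprime_divisors[OF dvd_refl cb co] a'(3) by simp
  have qp: "q \<noteq> p"
  proof
    assume "q = p"
    then have "k = 0" using creg c(3) by (cases k) auto
    then have "c = \<one>" using c(3) ord_eq_1[OF cc] by simp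
    then show False using c(4) orb_one_iff[of \<one>] by simp
  qed
  have sepc: "coprime (cl z) (cl a') \<or> coprime (cl z) (cl c)" if "z \<in> carrier G" "\<not> p dvd ord z" for z
    using sep[OF that] coprime_divisors[OF dvd_refl cb, of "cl z"] a'(3) by auto
  have ac: "cl (a' \<otimes> c) = cl c"
  proof -
    note dv = coprime_class_product(1)[OF a'c cc co'] and ge = coprime_class_left(1)[OF a'c cc co']
      and ge' = coprime_class_right(1)[OF a'c cc co']
    have "coprime (cl (a' \<otimes> c)) (cl a') \<or> coprime (cl (a' \<otimes> c)) (cl c)"
      using sepc[OF _ reg_ab[OF a'c a'reg cV]] a'c cc by simp
    then show ?thesis
    proof
      assume "coprime (cl (a' \<otimes> c)) (cl a')"
      then have "cl (a' \<otimes> c) dvd cl c" using dv by (simp add: coprime_dvd_mult_right_iff)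
      then have "cl (a' \<otimes> c) \<le> cl c" using orb_pos[OF Gs] dvd_imp_le by blast
      then show ?thesis using ge by simp
    next
      assume "coprime (cl (a' \<otimes> c)) (cl c)"
      then have "cl (a' \<otimes> c) dvd cl a'" using dv by (simp add: coprime_dvd_mult_left_iff)
      then have "cl (a' \<otimes> c) \<le> cl a'" using orb_pos[OF Gs] dvd_imp_le by blast
      then have eq: "cl (a' \<otimes> c) = cl a'" using ge' by simp
      \<comment> \<open>The primary component may have a class smaller than that of a', so sizes do
        not exclude this case. Instead the quotient of c^g by c stabilises the class of a' on the
        right and lies in \<open>M\<close>, so its order divides both cl a' and cl b. It is trivial,
        and \<open>c\<close> would be central.\<close>
      have "c \<frown> g = c" if g: "g \<in> carrier G" for g
      proof -
        have cs: "c \<in> orb (carrier G) c" "c \<frown> g \<in> orb (carrier G) c"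
          using orb_self[OF Gs cc] g by (auto simp: orb_def)
        let ?t = "c \<frown> g \<otimes> inv c"
        have tc: "?t \<in> carrier G" using cc g by simp
        have st: "d \<otimes> ?t \<in> orb (carrier G) a'" if "d \<in> orb (carrier G) a'" for d
          by (rule coprime_class_right(2)[OF a'c cc co' eq that cs])
        have "ord ?t dvd cl a'"
          using right_mult_ord_dvd[OF tc orb_G_finite _ st] orb_G_closed[OF a'c] by blast
        moreover have "?t \<in> M"
        proof -
          have "a' \<otimes> ?t \<in> M" using st[OF orb_self[OF Gs a'c]] A'M by blast
          then have "inv a' \<otimes> (a' \<otimes> ?t) \<in> M" using a'(1) Ms by (simp add: subgroup.m_closed subgroup.m_inv_closed)
          then show ?thesis using inv_mult_cancel(2)[OF a'c tc] by simp
        qed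
        then have "ord ?t dvd cl b" using ord_dvd_sub[OF Ms] M(2) dvd_trans by blast
        ultimately have "ord ?t = 1" using co a'(3) by (metis coprime_common_divisor_nat)
        then have "?t = \<one>" using ord_eq_1[OF tc] by simp
        then have "?t \<otimes> c = c" using cc by simp
        then show ?thesis using cc g by (simp add: m_assoc)
      qed
      then have "cl c = 1" using orb_one_iff[OF cc] by simp
      then show ?thesis using c(4) by simp
    qed
  qed
  have stab: "m \<otimes> d \<in> orb (carrier G) c" if m: "m \<in> M" and d: "d \<in> orb (carrier G) c" for m d
  proof -
    define S where "S = {s \<in> carrier G. \<forall>d\<in>orb (carrier G) c. s \<otimes> d \<in> orb (carrier G) c}"
    have Ss: "subgroup S G"
    proof (rule finite_subgroupI)
      fix x y assume xy: "x \<in> S" "y \<in> S"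
      then show "x \<otimes> y \<in> S" using orb_G_closed[OF cc] by (auto simp: S_def m_assoc)
    qed (use orb_G_closed[OF cc] in \<open>auto simp: S_def\<close>)
    \<comment> \<open>Both elements have the same quotients, so \<open>M\<close> is generated by
      those of a' as well.\<close>
    have "quotients a' \<subseteq> S"
      using coprime_class_left(2)[OF a'c cc co' ac] quotients_closed[OF a'c] by (auto simp: quotients_def S_def)
    then have "M \<subseteq> S" unfolding M_def a'(2)[symmetric] by (rule generate_sub[OF Ss])
    then show ?thesis using m d by (auto simp: S_def)
  qed
  have Mdvd: "card M dvd cl c"
    by (rule left_mult_dvd[OF Ms orb_G_finite _ stab]) (use orb_G_closed[OF cc] in auto)
  have Mgen: "m \<otimes> x = x \<otimes> m"
    if x: "x \<in> carrier G" and com: "\<And>c. c \<in> orb (carrier G) a' \<Longrightarrow> c \<otimes> x = x \<otimes> c" and m: "m \<in> M" for x m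
  proof (rule commute_generate[OF x])
    show "quotients a' \<subseteq> carrier G" by (rule quotients_closed[OF a'c])
    show "m \<in> generate G (quotients a')" using m a'(2) by (simp add: M_def)
    fix d assume "d \<in> quotients a'"
    then obtain u v where uv: "u \<in> orb (carrier G) a'" "v \<in> orb (carrier G) a'" "d = inv u \<otimes> v"
      by (auto simp: quotients_def)
    have uc: "u \<in> carrier G" "v \<in> carrier G" using uv orb_G_closed[OF a'c] by auto
    have "x \<frown> u = x" "x \<frown> v = x" using com[OF uv(1)] com[OF uv(2)] uc conj_fix[OF x] by auto
    moreover have "x \<frown> (inv u) = x" using calculation(1) uc x by (metis conj_inv_cancel(1))
    ultimately have "x \<frown> d = x" unfolding uv(3) using x uc by (simp add: conj_conj[symmetric])
    then show "d \<otimes> x = x \<otimes> d" using conj_fix[OF x, of d] uv(3) uc by simp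
  qed
  have "isolated_pair G p q k V M a' c"
    by unfold_locales
      (use p c(2) qp V core M(1,3) Mdvd a'(1) Mgen stab cc c(3,4) co' pa a'(3) sepc in auto)
  then show thesis using that a'(3) c(1) by blast
qed

section \<open>Normal Sylow subgroups and supplements\<close>

context finite_group
begin

text \<open>Every \<open>G\<close>-conjugate of \<open>S\<close> is again Sylow in \<open>W\<close>,
  hence a \<open>W\<close>-conjugate of \<open>S\<close>, hence \<open>S\<close>.\<close>

lemma normal_sylow_in_normal:
  assumes W: "normal_in W (carrier G)" and q: "prime q" and S: "sylow_in q W S" "normal_in S W"
  shows "normal_in S (carrier G)"
proof -
  have "cset S g = S" if g: "g \<in> carrier G" for g
  proof -
    obtain w where w: "w \<in> W" "cset S g = cset S w"
      using sylow_conj[OF q normal_in_subgroup[OF W] S(1) sylow_cset_normal[OF S(1) W g]] by blast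
    have "cset S w \<subseteq> S" using normal_in_conj[OF S(2) _ w(1)] by blast
    moreover have "card (cset S g) = card S"
      using card_cset[OF subgroup.subset[OF sylow_subgroup[OF S(1)]] g] .
    ultimately show ?thesis using w sylow_subgroup[OF S(1)] by (metis card_seteq finite_sub order_refl)
  qed
  then show ?thesis using sylow_subgroup[OF S(1)] subgroup.subset[OF sylow_subgroup[OF S(1)]]
    by (auto simp: normal_in_def)
qed

lemma normal_q_subgroup_in_sylow:
  assumes q: "prime q" and R: "sylow_in q (carrier G) R" and S: "normal_in S (carrier G)" "card S = q ^ n"
  shows "S \<subseteq> R"
proof -
  note Ss = normal_in_subgroup[OF S(1)]
  obtain h where h: "h \<in> carrier G" "S \<subseteq> cset R h"
    using sylow_contains[OF q carrier_subgroup R Ss subgroup.subset[OF Ss] S(2)] by blast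
  have "x \<in> R" if x: "x \<in> S" for x
  proof -
    have "x \<frown> h \<in> cset R h" using normal_in_conj[OF S(1) x h(1)] h(2) by blast
    then obtain r where r: "r \<in> R" "x \<frown> h = r \<frown> h" by blast
    then show ?thesis using conj_inj[of x r h] sub_carrier[OF Ss x] sub_carrier[OF sylow_subgroup[OF R]] h(1) by auto
  qed
  then show ?thesis by blast
qed

text \<open>The index of P N in \<open>H\<close> divides a power of \<open>p\<close>, as
  \<open>N\<close> contains the p-regular elements, and is prime to \<open>p\<close>, as P N
  contains a Sylow p-subgroup.\<close>

lemma sylow_supplement:
  assumes p: "prime p" and H: "subgroup H G" and P: "sylow_in p H P" and N: "normal_in N H"
    and reg: "\<And>x. x \<in> H \<Longrightarrow> \<not> p dvd ord x \<Longrightarrow> x \<in> N"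
  shows "P <#> N = H"
proof -
  note Ns = normal_in_subgroup[OF N] and Ps = sylow_subgroup[OF P]
  have A: "subgroup (P <#> N) G" by (rule subgroup_set_mult[OF N Ps sylow_subset[OF P] H])
  have AH: "P <#> N \<subseteq> H" by (rule set_mult_sub[OF H sylow_subset[OF P] normal_in_subset[OF N]])
  note sub = sub_set_mult[OF Ps Ns]
  obtain n where n: "card H = card (P <#> N) * n" by (rule subgroup_index[OF H A AH])
  obtain m where m: "card (P <#> N) = card N * m" by (rule subgroup_index[OF A Ns sub(2)])
  obtain k where k: "card H = card N * p ^ k"
    by (rule regular_index_power[OF H Ns normal_in_subset[OF N] p reg])
  have "card N * (m * n) = card N * p ^ k" using n m k by (metis mult.assoc)
  then have "m * n = p ^ k" using card_sub_pos[OF Ns] by (metis mult_left_cancel not_gr_zero)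
  then have "n dvd p ^ k" by (metis dvd_triv_right)
  moreover have "\<not> p dvd n" by (rule sylow_index[OF P A sub(1) AH H p n])
  ultimately have "n = 1" using divides_primepow_nat[OF p] by (metis dvd_power neq0_conv power_0)
  then show ?thesis using n AH H by (intro card_seteq) auto
qed

lemma normal_in_cz:
  assumes M: "normal_in M (carrier G)" shows "normal_in (cz (carrier G) M) (carrier G)"
proof -
  note Mc = subgroup.subset[OF normal_in_subgroup[OF M]]
  have s: "subgroup (cz (carrier G) M) G" by (rule subgroup_cz[OF carrier_subgroup Mc])
  have "x \<frown> g \<in> cz (carrier G) M" if x: "x \<in> cz (carrier G) M" and g: "g \<in> carrier G" for x g
  proof -
    have "x \<frown> g \<in> cset (cz (carrier G) M) g" using x by blast
    then show ?thesis using cz_cset[OF carrier_subgroup Mc g] normal_in_cset[OF M g] by simp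
  qed
  then show ?thesis using s subgroup.subset[OF s] by (simp add: normal_in_def)
qed

lemma cset_stable: "subgroup P G \<Longrightarrow> n \<in> P \<Longrightarrow> cset P n = P"
  by (intro card_seteq) (auto simp: conj_in_sub card_cset subgroup.subset sub_carrier)

lemma cset_cz: "D \<subseteq> carrier G \<Longrightarrow> H \<subseteq> carrier G \<Longrightarrow> c \<in> cz H D \<Longrightarrow> cset D c = D"
  by (auto simp: cz_conj_iff)

end

section \<open>The normal p-complement\<close>

context isolated_pair
begin

abbreviation "C_M \<equiv> cz (carrier G) M"

lemma Gs: "subgroup (carrier G) G" by (rule carrier_subgroup)

lemma Ms: "subgroup M G" by (rule normal_in_subgroup[OF M(1)])

lemma Mc: "m \<in> M \<Longrightarrow> m \<in> carrier G" by (rule sub_carrier[OF Ms])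

lemma ac: "a \<in> carrier G" by (rule Mc[OF a])

lemma Vs: "subgroup V G" by (rule normal_in_subgroup[OF V(1)])

lemma Vc: "v \<in> V \<Longrightarrow> v \<in> carrier G" by (rule sub_carrier[OF Vs])

lemma reg_V: "v \<in> V \<Longrightarrow> \<not> p dvd ord v"
  using ord_dvd_sub[OF Vs] V(2) dvd_trans by blast

lemma coprime_no_common: "\<lbrakk>coprime (m::nat) n; prime r; r dvd m; r dvd n\<rbrakk> \<Longrightarrow> False"
  by (metis coprime_common_divisor_nat not_prime_1)

lemma p_not_cl_b: "\<not> p dvd cl b"
  using coprime_no_common[OF co p pa] by blast

lemma reg_M: "m \<in> M \<Longrightarrow> \<not> p dvd ord m"
  by (meson M(2) dvd_trans ord_dvd_sub[OF Ms] p_not_cl_b)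

lemma reg_b: "\<not> p dvd ord b"
  using b(2) p q qp by (metis prime_dvd_power primes_dvd_imp_eq)

lemma b_V: "b \<in> V"
  by (rule core[OF b(1) reg_b p_not_cl_b])

lemma normal_CM: "normal_in C_M (carrier G)"
  by (rule normal_in_cz[OF M(1)])

lemma cl_a_neq1: "cl a \<noteq> 1"
  using pa p by (metis nat_dvd_1_iff_1 not_prime_1)

text \<open>If cl z were prime to cl b, the size of the \<open>M\<close>-orbit of \<open>z\<close>,
  dividing both cl z and |M|, would be 1. So separation makes cl z prime to cl a, in particular to
  \<open>p\<close>, and \<open>core\<close> applies.\<close>

lemma outside_CM:
  assumes z: "z \<in> carrier G" "\<not> p dvd ord z" "z \<notin> C_M"
  shows "coprime (cl z) (cl a)" "z \<in> V"
proof -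
  have "\<not> coprime (cl z) (cl b)"
  proof
    assume "coprime (cl z) (cl b)"
    then have "coprime (cl z) (card M)" by (rule coprime_divisors[OF dvd_refl M(2)])
    moreover have "card (orb M z) dvd cl z" by (rule orb_normal_dvd[OF M(1) Gs z(1)])
    moreover have "card (orb M z) dvd card M" using orb_card[OF Ms z(1)] by (metis dvd_triv_left)
    ultimately have "card (orb M z) = 1" by (metis coprime_common_divisor_nat)
    then obtain y where y: "orb M z = {y}" by (meson card_1_singletonE)
    have "z \<frown> m = z" if "m \<in> M" for m
      using y orb_self[OF Ms z(1)] that by (auto simp: orb_def)
    then have "m \<otimes> z = z \<otimes> m" if "m \<in> M" for m using that conj_fix[OF z(1) Mc[OF that]] by simp
    then show False using z by (simp add: cz_def)
  qed
  then show c: "coprime (cl z) (cl a)" using sep[OF z(1,2)] by blast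
  then show "z \<in> V" using core[OF z(1,2)] coprime_no_common[OF c p _ pa] by blast
qed

lemma regular_in_V:
  assumes v: "v \<in> V" "v \<notin> C_M" and z: "z \<in> carrier G" "\<not> p dvd ord z"
  shows "z \<in> V"
proof (cases "z \<in> C_M")
  case True
  note Es = normal_in_subgroup[OF normal_CM] and vc = Vc[OF v(1)]
  have "z \<otimes> v \<notin> C_M"
  proof
    assume "z \<otimes> v \<in> C_M"
    then have "inv z \<otimes> (z \<otimes> v) \<in> C_M" using True Es by (simp add: subgroup.m_closed subgroup.m_inv_closed)
    then show False using v(2) inv_mult_cancel(2)[OF z(1) vc] by simp
  qed
  then have "z \<otimes> v \<in> V"
    using outside_CM(2)[OF _ regular_mult_normal[OF p V v(1) z]] z vc by simp
  then have "z \<otimes> v \<otimes> inv v \<in> V" using v(1) Vs by (simp add: subgroup.m_closed subgroup.m_inv_closed)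
  then show ?thesis using z vc by (simp add: m_assoc)
qed (use outside_CM(2)[OF z] in blast)

lemma sylow_p_not_CM: "sylow_in p (carrier G) P \<Longrightarrow> \<not> P \<subseteq> C_M"
proof
  assume P: "sylow_in p (carrier G) P" "P \<subseteq> C_M"
  then have "P \<subseteq> cz (carrier G) {a}" using a by (auto simp: cz_def subset_iff)
  then have "\<not> p dvd cl a" by (rule sylow_centralizes_dvd[OF Gs ac p P(1)])
  then show False using pa by simp
qed

text \<open>By stability m b is conjugate to \<open>b\<close>, so it is a q-element. For
  \<open>m\<close> of order prime to \<open>q\<close> and commuting with \<open>b\<close>,
  \<open>m\<close> is a power of m b, so its order is also a power of \<open>q\<close>.\<close>

lemma fixed_by_b:
  assumes m: "m \<in> M" "m \<otimes> b = b \<otimes> m" "\<not> q dvd ord m"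
  shows "m = \<one>"
proof -
  have c: "coprime (ord m) (ord b)"
    using m(3) q b(2) by (simp add: coprime_commute coprime_power_right_iff prime_imp_coprime)
  obtain i :: nat where "(m \<otimes> b) [^] i = m"
    by (rule coprime_commuting_power[OF Mc[OF m(1)] b(1) m(2) c])
  moreover have mb: "m \<otimes> b \<in> orb (carrier G) b" by (rule stab[OF m(1) orb_self[OF Gs b(1)]])
  then have "ord (m \<otimes> b) = ord b" using b(1) by (auto simp: orb_def)
  moreover have "m \<otimes> b \<in> carrier G" using Mc[OF m(1)] b(1) by simp
  ultimately have "m [^] ord b = \<one>" by (metis nat_pow_pow mult.commute nat_pow_one pow_ord_eq_1)
  then have "ord m dvd ord b" using Mc[OF m(1)] by (simp add: pow_eq_id)
  then have "ord m = 1" using c by (metis coprime_common_divisor_nat dvd_refl)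
  then show ?thesis using ord_eq_1[OF Mc[OF m(1)]] by simp
qed

lemma regular_times_M:
  assumes "z \<in> carrier G" "\<not> p dvd ord z" "m \<in> M" shows "\<not> p dvd ord (z \<otimes> m)"
proof (rule regular_mult_normal[OF p M(1) _ assms(3,1,2)])
  show "\<not> p dvd card M" using M(2) p_not_cl_b dvd_trans by blast
qed

text \<open>Otherwise \<open>M\<close> is a \<open>q\<close>-group and \<open>V \<inter> C\<^sub>G(M) = S C(S)\<close> for its Sylow \<open>q\<close>-subgroup \<open>S \<ni> b\<close>. Every
  element of \<open>S\<close> is central in \<open>S\<close> or centralised by an \<open>S\<close>-conjugate of \<open>P\<close>, so \<open>S = C\<^sub>S(P) Z(S)\<close>; then
  \<open>P\<close> centralises the class of \<open>b\<close>, hence \<open>M\<close>.\<close>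

lemma b_notin_CM: "b \<notin> C_M"
proof
  assume bE: "b \<in> C_M"
  have bM: "m \<otimes> b = b \<otimes> m" if "m \<in> M" for m using bE that by (auto simp: cz_def)
  have Mq: "\<exists>j. ord m = q ^ j" if m: "m \<in> M" for m
  proof -
    obtain i j l :: nat where ij: "m = m [^] i \<otimes> m [^] j" "ord (m [^] i) = q ^ l" "\<not> q dvd ord (m [^] j)"
      using primary_decomp[OF Mc[OF m] q] by blast
    have mj: "m [^] j \<in> M" by (rule sub_pow[OF Ms m])
    have "m [^] j = \<one>" by (rule fixed_by_b[OF mj bM[OF mj] ij(3)])
    then show ?thesis using ij(1,2) Mc[OF m] by (metis nat_pow_closed r_one)
  qed
  have a1: "ord a \<noteq> 1" using cl_a_neq1 orb_one_iff[OF ac] ord_eq_1[OF ac] by auto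
  obtain j where j: "ord a = q ^ j" using Mq[OF a] by blast
  then have "q dvd ord a" using a1 by (cases j) auto
  then have qM: "q dvd card M" using ord_dvd_sub[OF Ms a] dvd_trans by blast
  then have qb: "q dvd cl b" using M(2) dvd_trans by blast
  define W where "W = V \<inter> C_M"
  have nW: "normal_in W (carrier G)" unfolding W_def by (rule normal_in_inter[OF V(1) normal_CM])
  note Ws = normal_in_subgroup[OF nW]
  \<comment> \<open>\<open>z\<close> commutes with the q-element \<open>a\<close> and has coprime
    order, so cl a divides the class size of z a. Separation makes this size, and its divisor cl z,
    prime to cl b and hence to \<open>q\<close>.\<close>
  have cov: "\<not> q dvd card (orb W z)" if z: "z \<in> W" "\<not> q dvd ord z" for z
  proof -
    have zV: "z \<in> V" and zE: "z \<in> C_M" using z by (auto simp: W_def)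
    have zc: "z \<in> carrier G" by (rule Vc[OF zV])
    have com: "z \<otimes> a = a \<otimes> z" using zE a by (auto simp: cz_def)
    have c: "coprime (ord z) (ord a)"
      using z(2) q j by (simp add: coprime_commute coprime_power_right_iff prime_imp_coprime)
    note dv = orb_coprime_dvd[OF Gs zc ac com c]
    have "\<not> coprime (cl (z \<otimes> a)) (cl a)" using dv(2) coprime_no_common[OF _ p _ pa] pa dvd_trans by blast
    then have "coprime (cl (z \<otimes> a)) (cl b)"
      using sep[OF _ regular_times_M[OF zc reg_V[OF zV] a]] zc ac by simp
    then have "coprime (cl z) (cl b)" by (rule coprime_divisors[OF dv(1) dvd_refl])
    then have "\<not> q dvd cl z" using coprime_no_common[OF _ q _ qb] by blast
    then show ?thesis using orb_normal_dvd[OF nW Gs zc] dvd_trans by blast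
  qed
  obtain S where S: "sylow_in q W S" by (rule sylow_exists[OF Ws q])
  note SW = sylow_direct_cover[OF Ws q cov S]
  have nS: "normal_in S (carrier G)" by (rule normal_sylow_in_normal[OF nW q S SW(2)])
  note Ss = normal_in_subgroup[OF nS]
  note Sc = sub_carrier[OF Ss]
  have bS: "b \<in> S"
    by (rule sylow_normal_contains[OF q Ws S SW(2) _ b(2)]) (use b_V bE in \<open>auto simp: W_def\<close>)
  define J where "J = cz (carrier G) S"
  have nJ: "normal_in J (carrier G)" unfolding J_def by (rule normal_in_cz[OF nS])
  note Js = normal_in_subgroup[OF nJ]
  note Jc = sub_carrier[OF Js]
  \<comment> \<open>The Sylow q-subgroup centralising \<open>z\<close> contains the normal
    q-subgroup \<open>S\<close>.\<close>
  have q_central: "z \<in> J" if z: "z \<in> carrier G" "\<not> q dvd cl z" for z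
  proof -
    obtain R where R: "sylow_in q (carrier G) R" "R \<subseteq> cz (carrier G) {z}"
      using sylow_centralizes[OF Gs z(1) q z(2)] by blast
    have "S \<subseteq> R" by (rule normal_q_subgroup_in_sylow[OF q R(1) nS sylow_card[OF S]])
    then show ?thesis using R(2) z(1) by (auto simp: J_def cz_def subset_iff)
  qed
  have p_central: "z \<in> J" if z: "z \<in> carrier G" "\<not> p dvd ord z" "p dvd cl z" for z
  proof -
    have "coprime (cl z) (cl b)" using sep[OF z(1,2)] coprime_no_common[OF _ p z(3) pa] by blast
    then show ?thesis using q_central[OF z(1)] coprime_no_common[OF _ q _ qb] by blast
  qed
  obtain P where P: "sylow_in p (carrier G) P" "P \<subseteq> cz (carrier G) {b}"
    using sylow_centralizes[OF Gs b(1) p p_not_cl_b] by blast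
  note Ps = sylow_subgroup[OF P(1)]
  note Pc = sub_carrier[OF Ps]
  have PG: "P \<subseteq> carrier G" using Pc by blast
  \<comment> \<open>Since \<open>n\<close> normalises \<open>P\<close> and \<open>j\<close>
    centralises \<open>S\<close>, an element of \<open>S\<close> that commutes with P^g already
    commutes with P^s. Conjugation of \<open>P\<close> by \<open>G\<close> is thereby reduced to
    conjugation by \<open>S\<close>.\<close>
  have fact: "\<exists>n s j. n \<in> carrier G \<and> cset P n = P \<and> s \<in> S \<and> j \<in> J \<and> g = n \<otimes> s \<otimes> j"
    if g: "g \<in> carrier G" for g
  \<comment> \<open>If \<open>V\<close> centralises \<open>M\<close>, the p-regular elements lie in
    S J, since those outside \<open>V\<close> have class size divisible by \<open>p\<close>.
    Otherwise \<open>V\<close> contains all p-regular elements, and C_V(P) supplements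
    \<open>W\<close> in \<open>V\<close> by the counting lemma.\<close>
  proof (cases "V \<subseteq> C_M")
    case True
    have "x \<in> S <#> J" if x: "x \<in> carrier G" "\<not> p dvd ord x" for x
    proof (cases "p dvd cl x")
      case True
      then show ?thesis using p_central[OF x True] sub_set_mult(2)[OF Ss Js] by blast
    next
      case False
      then have "x \<in> W" using core[OF x False] \<open>V \<subseteq> C_M\<close> by (auto simp: W_def)
      then have "x \<in> S <#> cz W S" using SW(1) by simp
      moreover have "cz W S \<subseteq> J" using sub_carrier[OF Ws] by (auto simp: J_def cz_def)
      ultimately show ?thesis by (auto simp: set_mult_def)
    qed
    then have "P <#> (S <#> J) = carrier G"
      by (intro sylow_supplement[OF p Gs P(1) normal_in_set_mult[OF nS nJ Gs]])
    then have "g \<in> P <#> (S <#> J)" using g by simp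
    then have "\<exists>x\<in>P. \<exists>y\<in>S <#> J. g = x \<otimes> y" by (simp only: set_mult_iff[of g P])
    then obtain x y where x: "x \<in> P" "y \<in> S <#> J" "g = x \<otimes> y" by blast
    then obtain s j where sj: "s \<in> S" "j \<in> J" "y = s \<otimes> j" unfolding set_mult_iff by blast
    have "g = x \<otimes> s \<otimes> j" using x sj Pc Sc Jc by (simp add: m_assoc)
    then show ?thesis using sj(1,2) Pc[OF x(1)] cset_stable[OF Ps x(1)] by blast
  next
    case False
    then obtain v where v: "v \<in> V" "v \<notin> C_M" by blast
    have PV: "P <#> V = carrier G"
      by (rule sylow_supplement[OF p Gs P(1) V(1)]) (rule regular_in_V[OF v])
    have nWV: "normal_in W V" by (rule normal_in_mono[OF nW]) (auto simp: W_def Vc)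
    have "cz V P <#> W = V"
    proof (rule union_of_conjugates(1)[OF Vs subgroup_cz[OF Vs PG] cz_subset nWV])
      fix z assume z: "z \<in> V" "z \<notin> W"
      then have zE: "z \<notin> C_M" by (simp add: W_def)
      have "\<not> p dvd cl z" using outside_CM(1)[OF Vc[OF z(1)] reg_V[OF z(1)] zE] coprime_no_common[OF _ p _ pa] by blast
      then obtain P' where P': "sylow_in p (carrier G) P'" "P' \<subseteq> cz (carrier G) {z}"
        using sylow_centralizes[OF Gs Vc[OF z(1)] p] by blast
      obtain h where h: "h \<in> carrier G" "P' = cset P h" using sylow_conj[OF p Gs P(1) P'(1)] by blast
      then have "h \<in> P <#> V" using PV by simp
      then obtain x w where xw: "x \<in> P" "w \<in> V" "h = x \<otimes> w" unfolding set_mult_iff by blast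
      have "P' = cset P w" using h(2) xw cset_cset[OF PG Pc[OF xw(1)] Vc[OF xw(2)]] cset_stable[OF Ps xw(1)] by simp
      then have "z \<in> cz V (cset P w)" using P'(2) z(1) by (auto simp: cz_def subset_iff)
      then show "\<exists>h\<in>V. z \<in> cset (cz V P) h" using cz_cset[OF Vs PG xw(2)] xw(2) by blast
    qed
    moreover have "g \<in> P <#> V" using PV g by simp
    then obtain x w where xw: "x \<in> P" "w \<in> V" "g = x \<otimes> w" unfolding set_mult_iff by blast
    ultimately have "w \<in> cz V P <#> W" by simp
    then obtain c y where cy: "c \<in> cz V P" "y \<in> W" "w = c \<otimes> y" unfolding set_mult_iff by blast
    then have "y \<in> S <#> cz W S" using SW(1) by simp
    then obtain s j where sj: "s \<in> S" "j \<in> cz W S" "y = s \<otimes> j" unfolding set_mult_iff by blast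
    have jJ: "j \<in> J" using sj(2) sub_carrier[OF Ws] by (auto simp: J_def cz_def)
    have cc: "c \<in> carrier G" using cy(1) Vc by (auto simp: cz_def)
    have "g = (x \<otimes> c) \<otimes> s \<otimes> j"
      using xw cy sj Pc[OF xw(1)] cc Sc[OF sj(1)] Jc[OF jJ] by (simp add: m_assoc)
    moreover have "cset P (x \<otimes> c) = P"
      using cset_cset[OF PG Pc[OF xw(1)] cc] cset_stable[OF Ps xw(1)] cset_cz[OF PG _ cy(1)] Vc by auto
    moreover have "x \<otimes> c \<in> carrier G" using Pc[OF xw(1)] cc by simp
    ultimately show ?thesis using sj(1) jJ by blast
  qed
  let ?F = "cz S P"
  have Fs: "subgroup ?F G" by (rule subgroup_cz[OF Ss PG])
  have nZ: "normal_in (cz S S) S"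
  proof -
    have "n \<frown> h = n" if "n \<in> cz S S" "h \<in> S" for n h
      using that conj_fix[of n h] Sc by (auto simp: cz_def)
    then show ?thesis using subgroup_cz[OF Ss subgroup.subset[OF Ss]] cz_subset by (auto simp: normal_in_def)
  qed
  have FZ: "?F <#> cz S S = S"
  proof (rule union_of_conjugates(1)[OF Ss Fs cz_subset nZ])
    fix u assume u: "u \<in> S" "u \<notin> cz S S"
    note uc = Sc[OF u(1)]
    have "u \<notin> J" using u by (auto simp: J_def cz_def)
    moreover have "u \<in> V" using u(1) sylow_subset[OF S] by (auto simp: W_def)
    ultimately have "\<not> p dvd cl u" using p_central[OF uc reg_V] by blast
    then obtain P' where P': "sylow_in p (carrier G) P'" "P' \<subseteq> cz (carrier G) {u}"
      using sylow_centralizes[OF Gs uc p] by blast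
    obtain g where g: "g \<in> carrier G" "P' = cset P g" using sylow_conj[OF p Gs P(1) P'(1)] by blast
    obtain n s j where nsj: "n \<in> carrier G" "cset P n = P" "s \<in> S" "j \<in> J" "g = n \<otimes> s \<otimes> j"
      using fact[OF g(1)] by blast
    note sc = Sc[OF nsj(3)] and jc = Jc[OF nsj(4)]
    have P'': "P' = cset (cset P s) j"
      using g(2) nsj cset_cset[OF PG nsj(1) sc] cset_cset[OF PG, of "n \<otimes> s" j] cset_cset[OF PG sc jc] sc jc
        cset_cset[OF PG nsj(1), of "s \<otimes> j"] by (simp add: m_assoc)
    have uj: "u \<frown> j = u" using nsj(4) u(1) conj_fix[OF uc jc] by (auto simp: J_def cz_def)
    have "u \<otimes> x = x \<otimes> u" if x: "x \<in> cset P s" for x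
    proof -
      have xc: "x \<in> carrier G" using x PG sc by auto
      have "x \<frown> j \<in> P'" using x P'' by blast
      then have "x \<frown> j \<otimes> u \<frown> j = u \<frown> j \<otimes> x \<frown> j" using P'(2) uj by (auto simp: cz_def subset_iff)
      then show ?thesis using conj_commute_iff[OF xc uc jc] by simp
    qed
    then have "u \<in> cz S (cset P s)" using u(1) by (simp add: cz_def)
    then show "\<exists>h\<in>S. u \<in> cset ?F h" using cz_cset[OF Ss PG nsj(3)] nsj(3) by blast
  qed
  \<comment> \<open>b^n is centralised by P^n = P. The factor in \<open>S\<close> is split as an
    element of C_S(P) times an element of Z(S); the first preserves C_S(P), while the second and
    \<open>j\<close> fix elements of \<open>S\<close>.\<close>
  have orbF: "orb (carrier G) b \<subseteq> ?F"
  proof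
    fix d assume "d \<in> orb (carrier G) b"
    then obtain g where g: "g \<in> carrier G" "d = b \<frown> g" by (auto simp: orb_def)
    obtain n s j where nsj: "n \<in> carrier G" "cset P n = P" "s \<in> S" "j \<in> J" "g = n \<otimes> s \<otimes> j"
      using fact[OF g(1)] by blast
    note sc = Sc[OF nsj(3)] and jc = Jc[OF nsj(4)]
    let ?b = "b \<frown> n"
    have bnS: "?b \<in> S" by (rule normal_in_conj[OF nS bS nsj(1)])
    have bn: "?b \<in> ?F"
    proof -
      have "?b \<otimes> x = x \<otimes> ?b" if "x \<in> P" for x
      proof -
        have "x \<in> cset P n" using that nsj(2) by simp
        then obtain y where y: "y \<in> P" "x = y \<frown> n" by blast
        have "b \<otimes> y = y \<otimes> b" using P(2) y(1) by (auto simp: cz_def subset_iff)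
        then show ?thesis using conj_commute_iff[OF b(1) Pc[OF y(1)] nsj(1)] y(2) by simp
      qed
      then show ?thesis using bnS by (simp add: cz_def)
    qed
    have "s \<in> ?F <#> cz S S" using FZ nsj(3) by simp
    then obtain c z where cz: "c \<in> ?F" "z \<in> cz S S" "s = c \<otimes> z" unfolding set_mult_iff by blast
    have cc: "c \<in> carrier G" "z \<in> carrier G" using cz Sc by (auto simp: cz_def)
    let ?e = "?b \<frown> c"
    have eF: "?e \<in> ?F" by (rule conj_in_sub[OF Fs bn cz(1)])
    then have eS: "?e \<in> S" by (simp add: cz_def)
    have "?e \<frown> z = ?e" using conj_fix[OF Sc[OF eS] cc(2)] cz(2) eS by (auto simp: cz_def)
    moreover have "?e \<frown> j = ?e" using conj_fix[OF Sc[OF eS] jc] nsj(4) eS by (auto simp: J_def cz_def)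
    moreover have "d = ?e \<frown> z \<frown> j"
      unfolding g(2) nsj(5) cz(3) using b(1) nsj(1) cc jc by (simp add: conj_conj m_assoc)
    ultimately show "d \<in> ?F" using eF by simp
  qed
  have "M \<subseteq> ?F"
  proof
    fix m assume m: "m \<in> M"
    have bo: "b \<in> orb (carrier G) b" by (rule orb_self[OF Gs b(1)])
    \<comment> \<open>Both \<open>b\<close> and m b are conjugates of \<open>b\<close>, so they lie
      in C_S(P), and \<open>m\<close> is their quotient.\<close>
    have "m \<otimes> b \<in> ?F" "b \<in> ?F" using stab[OF m bo] bo orbF by auto
    then have "m \<otimes> b \<otimes> inv b \<in> ?F" using Fs by (simp add: subgroup.m_closed subgroup.m_inv_closed)
    then show "m \<in> ?F" using Mc[OF m] b(1) by (simp add: m_assoc)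
  qed
  then have "P \<subseteq> C_M" using PG by (auto simp: cz_def subset_iff)
  then show False using sylow_p_not_CM[OF P(1)] by blast
qed

lemma regular_iff_V: "z \<in> carrier G \<Longrightarrow> \<not> p dvd ord z \<longleftrightarrow> z \<in> V"
  using regular_in_V[OF b_V b_notin_CM] reg_V by blast

text \<open>By transitivity on pairs, one commuting pair makes \<open>b\<close> commute with all of
  a^G, hence with \<open>M\<close>, which is excluded.\<close>

lemma no_conjugate_commutes:
  assumes c: "c \<in> orb (carrier G) a" "d \<in> orb (carrier G) b" shows "c \<otimes> d \<noteq> d \<otimes> c"
proof
  assume cd: "c \<otimes> d = d \<otimes> c"
  have ab: "a \<otimes> b = b \<otimes> a"
  proof -
    obtain g where g: "g \<in> carrier G" "c = a \<frown> g" "d = b \<frown> g"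
      by (rule coprime_class_pairs[OF ac b(1) co c])
    then show ?thesis using cd conj_commute_iff[OF ac b(1) g(1)] by simp
  qed
  have "e \<otimes> b = b \<otimes> e" if e: "e \<in> orb (carrier G) a" for e
  proof -
    obtain g where g: "g \<in> carrier G" "e = a \<frown> g" "b = b \<frown> g"
      by (rule coprime_class_pairs[OF ac b(1) co e orb_self[OF Gs b(1)]])
    then show ?thesis using ab conj_commute_iff[OF ac b(1) g(1)] by metis
  qed
  then have "m \<otimes> b = b \<otimes> m" if "m \<in> M" for m using Mgen[OF b(1) _ that] by blast
  then have "b \<in> C_M" using b(1) by (simp add: cz_def)
  then show False using b_notin_CM by simp
qed

text \<open>Otherwise \<open>a\<close> is centralised by a Sylow q-subgroup; a conjugate of that
  subgroup contains the q-element \<open>b\<close>, giving a commuting pair. As |M| divides cl b,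
  \<open>q\<close> is then prime to |M|, and \<open>q\<close> is available as a prime of cl
  a.\<close>

lemma q_cl_a: "q dvd cl a"
proof (rule ccontr)
  assume "\<not> q dvd cl a"
  then obtain R where R: "sylow_in q (carrier G) R" "R \<subseteq> cz (carrier G) {a}"
    using sylow_centralizes[OF Gs ac q] by blast
  obtain h where h: "h \<in> carrier G" "b \<in> cset R h"
    using sylow_contains_elem[OF q Gs R(1) b(1,2)] by blast
  then obtain r where r: "r \<in> R" "b = r \<frown> h" by blast
  have "a \<otimes> r = r \<otimes> a" "r \<in> carrier G" using R(2) r(1) by (auto simp: cz_def subset_iff)
  then have "a \<frown> h \<otimes> b = b \<otimes> a \<frown> h" using conj_commute_iff[OF ac _ h(1)] r(2) by simp
  then show False using no_conjugate_commutes[of "a \<frown> h" b] h(1) orb_self[OF Gs b(1)] by (auto simp: orb_def)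
qed

lemma fixed_in_M: "m \<in> M \<Longrightarrow> m \<otimes> b = b \<otimes> m \<Longrightarrow> m = \<one>"
proof (rule fixed_by_b)
  assume m: "m \<in> M"
  have "\<not> q dvd card M" using coprime_no_common[OF co q q_cl_a] M(2) dvd_trans by blast
  then show "\<not> q dvd ord m" using ord_dvd_sub[OF Ms m] dvd_trans by blast
qed

end

section \<open>Coprime indices and central Sylow subgroups\<close>

context finite_group
begin

lemma coprime_index_product:
  assumes H: "subgroup H G" and A: "subgroup A G" "A \<subseteq> H" and B: "subgroup B G" "B \<subseteq> H"
    and m: "card H = card A * m" and n: "card H = card B * n" and co: "coprime m n"
  shows "A <#> B = H"
proof -
  have I: "subgroup (A \<inter> B) G" by (rule subgroup_inter[OF A(1) B(1)])
  obtain s where s: "card A = card (A \<inter> B) * s" by (rule subgroup_index[OF A(1) I]) auto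
  obtain t where t: "card B = card (A \<inter> B) * t" by (rule subgroup_index[OF B(1) I]) auto
  have pos: "card (A \<inter> B) > 0" by (rule card_sub_pos[OF I])
  have "card (A \<inter> B) * (s * m) = card (A \<inter> B) * (t * n)"
    using m[unfolded s] n[unfolded t] by (metis mult.assoc)
  then have sm: "s * m = t * n" using pos by (metis mult_left_cancel not_gr_zero)
  then have "n dvd s * m" by simp
  then have "n dvd s" using co by (metis coprime_commute coprime_dvd_mult_left_iff)
  then obtain l where l: "s = n * l" by blast
  have "card (A <#> B) * card (A \<inter> B) = card B * s * card (A \<inter> B)"
    using product_formula[OF A(1) B(1)] s by (simp add: mult_ac)
  then have "card (A <#> B) = card B * s" using pos by simp
  then have "card (A <#> B) = card H * l" using n l by simp
  moreover have "card (A <#> B) > 0"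
    using product_formula[OF A(1) B(1)] card_sub_pos[OF A(1)] card_sub_pos[OF B(1)]
    by (metis mult_eq_0_iff not_gr_zero)
  ultimately have "card H \<le> card (A <#> B)" by (cases l) auto
  moreover have "A <#> B \<subseteq> H" by (rule set_mult_sub[OF H A(2) B(2)])
  ultimately show ?thesis using H by (intro card_seteq) auto
qed

lemma subgroup_prime_elements:
  assumes A: "subgroup A G" and com: "\<And>x y. x \<in> A \<Longrightarrow> y \<in> A \<Longrightarrow> x \<otimes> y = y \<otimes> x"
  shows "subgroup {x \<in> A. \<forall>r. prime r \<longrightarrow> r dvd ord x \<longrightarrow> Q r} G"
    "\<lbrakk>prime r; r dvd card {x \<in> A. \<forall>r. prime r \<longrightarrow> r dvd ord x \<longrightarrow> Q r}\<rbrakk> \<Longrightarrow> Q r"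
proof -
  note Ac = sub_carrier[OF A]
  show s: "subgroup {x \<in> A. \<forall>r. prime r \<longrightarrow> r dvd ord x \<longrightarrow> Q r} G"
  proof (rule finite_subgroupI)
    show "{x \<in> A. \<forall>r. prime r \<longrightarrow> r dvd ord x \<longrightarrow> Q r} \<subseteq> carrier G" using Ac by blast
    show "\<one> \<in> {x \<in> A. \<forall>r. prime r \<longrightarrow> r dvd ord x \<longrightarrow> Q r}"
      using A subgroup.one_closed not_prime_unit by (auto simp: subgroup.one_closed)
    fix x y
    assume x: "x \<in> {x \<in> A. \<forall>r. prime r \<longrightarrow> r dvd ord x \<longrightarrow> Q r}"
      and y: "y \<in> {x \<in> A. \<forall>r. prime r \<longrightarrow> r dvd ord x \<longrightarrow> Q r}"
    then have xy: "x \<in> A" "y \<in> A" by auto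
    have "ord (x \<otimes> y) dvd ord x * ord y"
      by (rule ord_mul_divides[OF com[OF xy] Ac[OF xy(1)] Ac[OF xy(2)]])
    then have "r dvd ord x \<or> r dvd ord y" if "prime r" "r dvd ord (x \<otimes> y)" for r
      using that by (meson dvd_trans prime_dvd_mult_iff)
    then show "x \<otimes> y \<in> {x \<in> A. \<forall>r. prime r \<longrightarrow> r dvd ord x \<longrightarrow> Q r}"
      using x y A by (auto simp: subgroup.m_closed)
  qed
  assume r: "prime r" "r dvd card {x \<in> A. \<forall>r. prime r \<longrightarrow> r dvd ord x \<longrightarrow> Q r}"
  obtain x where "x \<in> {x \<in> A. \<forall>r. prime r \<longrightarrow> r dvd ord x \<longrightarrow> Q r}" "ord x = r"
    by (rule cauchy[OF s r])
  then show "Q r" using r(1) by auto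
qed

lemma normal_in_center:
  assumes "subgroup A G" shows "normal_in (cz A A) A"
proof -
  have "n \<frown> h = n" if "n \<in> cz A A" "h \<in> A" for n h
    using that conj_fix[of n h] sub_carrier[OF assms] by (auto simp: cz_def)
  then show ?thesis
    using subgroup_cz[OF assms subgroup.subset[OF assms]] cz_subset by (auto simp: normal_in_def)
qed

lemma sylow_central_normal:
  assumes T: "sylow_in t A T" "T \<subseteq> cz A A" and A: "subgroup A G"
  shows "normal_in T A"
proof -
  have "n \<frown> h = n" if "n \<in> T" "h \<in> A" for n h
    using that T conj_fix[of n h] sub_carrier[OF A] by (auto simp: cz_def subset_iff)
  then show ?thesis using sylow_subgroup[OF T(1)] sylow_subset[OF T(1)] by (auto simp: normal_in_def)
qed

text \<open>\<open>R\<close> is Sylow in C_G(b), so it contains a C_G(b)-conjugate of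
  \<open>b\<close>, which is \<open>b\<close> itself.\<close>

lemma q_element_in_central_sylow:
  assumes q: "prime q" and b: "b \<in> carrier G" "ord b = q ^ k"
    and R: "sylow_in q (carrier G) R" "R \<subseteq> cz (carrier G) {b}"
  shows "b \<in> R"
proof -
  let ?C = "cz (carrier G) {b}"
  have Cs: "subgroup ?C G" using b(1) by (intro subgroup_cz carrier_subgroup) auto
  have RC: "sylow_in q ?C R" by (rule sylow_intermediate(1)[OF R(1) Cs R(2) cz_subset carrier_subgroup q])
  have "b \<in> ?C" using b(1) by (simp add: cz_def)
  then obtain c where c: "c \<in> ?C" "b \<in> cset R c" using sylow_contains_elem[OF q Cs RC _ b(2)] by blast
  then obtain x where x: "x \<in> R" "b = x \<frown> c" by blast
  have cc: "c \<in> carrier G" using c by (simp add: cz_def)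
  have "b \<frown> c = b" using c(1) cc conj_fix[OF b(1) cc] by (simp add: cz_def)
  then have "x \<frown> c = b \<frown> c" using x by simp
  then have "x = b" using conj_inj[OF sub_carrier[OF sylow_subgroup[OF R(1)] x(1)] b(1) cc] by simp
  then show ?thesis using x by simp
qed

end

section \<open>The subgroups \<open>W\<close> and \<open>Y\<close> of the p-complement\<close>

context isolated_pair
begin

definition W :: "'a set" where "W = V \<inter> C_M"

definition Y :: "'a set" where "Y = cz V {b}"

lemma nW: "normal_in W (carrier G)"
  unfolding W_def by (rule normal_in_inter[OF V(1) normal_CM])

lemma Ws: "subgroup W G" by (rule normal_in_subgroup[OF nW])

lemma Wc: "w \<in> W \<Longrightarrow> w \<in> carrier G" by (rule sub_carrier[OF Ws])

lemma WV: "W \<subseteq> V" by (auto simp: W_def)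

lemma nWV: "normal_in W V"
  by (rule normal_in_mono[OF nW WV]) (use Vc in blast)

lemma Ys: "subgroup Y G" unfolding Y_def by (rule subgroup_cz[OF Vs]) (use b in auto)

lemma Yc: "y \<in> Y \<Longrightarrow> y \<in> carrier G" by (rule sub_carrier[OF Ys])

lemma YV: "Y \<subseteq> V" by (auto simp: Y_def cz_def)

lemma MW: "M \<subseteq> W"
  using M(3) regular_iff_V Mc reg_M by (auto simp: W_def cz_def)

lemma WM: "w \<in> W \<Longrightarrow> m \<in> M \<Longrightarrow> w \<otimes> m = m \<otimes> w"
  by (auto simp: W_def cz_def)

lemma b_Y: "b \<in> Y" using b_V by (simp add: Y_def cz_def)

lemma b_notin_W: "b \<notin> W" using b_notin_CM by (simp add: W_def)

lemma cl_V: "card (orb V z) dvd cl z" if "z \<in> carrier G"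
  by (rule orb_normal_dvd[OF V(1) Gs that])

lemma p_not_card_V: "r dvd card V \<Longrightarrow> r \<noteq> p"
  using V(2) by blast

lemma P_times_V: "sylow_in p (carrier G) P \<Longrightarrow> P <#> V = carrier G"
  by (rule sylow_supplement[OF p Gs _ V(1)]) (use regular_iff_V in auto)

lemma sylow_in_V:
  assumes r: "prime r" "r \<noteq> p" and R: "sylow_in r (carrier G) R"
  shows "R \<subseteq> V" "sylow_in r V R"
proof -
  show RV: "R \<subseteq> V"
  proof
    fix x assume x: "x \<in> R"
    obtain i where "ord x = r ^ i" by (rule sylow_elem_ord[OF r(1) R x])
    then have "\<not> p dvd ord x" using p r by (metis prime_dvd_power primes_dvd_imp_eq)
    then show "x \<in> V" using regular_iff_V sub_carrier[OF sylow_subgroup[OF R] x] by blast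
  qed
  show "sylow_in r V R"
    by (rule sylow_intermediate(1)[OF R Vs RV subgroup.subset[OF Vs] Gs r(1)])
qed

text \<open>For \<open>r\<close> other than \<open>p\<close> all Sylow subgroups lie in
  \<open>V\<close>; for r = p the factorisation G = P V absorbs the part normalising
  \<open>P\<close>.\<close>

lemma sylow_conj_V:
  assumes r: "prime r" and R: "sylow_in r (carrier G) R" and R': "sylow_in r (carrier G) R'"
  shows "\<exists>h\<in>V. R' = cset R h"
proof (cases "r = p")
  case True
  note Rs = sylow_subgroup[OF R]
  obtain g where g: "g \<in> carrier G" "R' = cset R g" using sylow_conj[OF r Gs R R'] by blast
  then have "g \<in> R <#> V" using P_times_V R True by simp
  then obtain x v where xv: "x \<in> R" "v \<in> V" "g = x \<otimes> v" unfolding set_mult_iff by blast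
  then have "R' = cset R v"
    using g cset_cset[OF subgroup.subset[OF Rs] sub_carrier[OF Rs xv(1)] Vc[OF xv(2)]] cset_stable[OF Rs xv(1)] by simp
  then show ?thesis using xv by blast
next
  case False
  then show ?thesis using sylow_conj[OF r Vs sylow_in_V(2)[OF r False R] sylow_in_V(2)[OF r False R']] by blast
qed

lemma centralized_by_conjugate:
  assumes r: "prime r" and R: "sylow_in r (carrier G) R" and z: "z \<in> V" "\<not> r dvd cl z"
  obtains h where "h \<in> V" "z \<in> cset (cz V R) h" "z \<in> cz V (cset R h)"
proof -
  obtain R' where R': "sylow_in r (carrier G) R'" "R' \<subseteq> cz (carrier G) {z}"
    using sylow_centralizes[OF Gs Vc[OF z(1)] r z(2)] by blast
  obtain h where h: "h \<in> V" "R' = cset R h" using sylow_conj_V[OF r R R'(1)] by blast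
  have "z \<in> cz V (cset R h)" using R'(2) h(2) z(1) by (auto simp: cz_def subset_iff)
  moreover then have "z \<in> cset (cz V R) h"
    using cz_cset[OF Vs subgroup.subset[OF sylow_subgroup[OF R]] h(1)] by simp
  ultimately show thesis using that h(1) by blast
qed

text \<open>\<open>union_of_conjugates\<close> with the roles of \<open>H\<close> and
  \<open>Y\<close> taken by \<open>V\<close> and C_V(R). The prime r = p is included, which later
  brings in a Sylow p-subgroup of \<open>G\<close>.\<close>

lemma cz_sylow:
  assumes r: "prime r" "r dvd cl a" and R: "sylow_in r (carrier G) R"
  shows "cz V R <#> W = V"
    "\<lbrakk>h \<in> V; y \<in> cz V R; y \<notin> W; y \<frown> h \<in> cz V R\<rbrakk> \<Longrightarrow> h \<in> cz V R"
    "\<lbrakk>z \<in> V; z \<notin> W\<rbrakk> \<Longrightarrow> \<exists>h\<in>V. z \<in> cset (cz V R) h"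
proof -
  have Rs: "subgroup (cz V R) G" by (rule subgroup_cz[OF Vs subgroup.subset[OF sylow_subgroup[OF R]]])
  show cov: "\<exists>h\<in>V. z \<in> cset (cz V R) h" if z: "z \<in> V" "z \<notin> W" for z
  proof -
    have "z \<notin> C_M" using z by (simp add: W_def)
    then have "coprime (cl z) (cl a)" by (rule outside_CM(1)[OF Vc[OF z(1)] reg_V[OF z(1)]])
    then have "\<not> r dvd cl z" using coprime_no_common[OF _ r(1) _ r(2)] by blast
    then show ?thesis using centralized_by_conjugate[OF r(1) R z(1)] by blast
  qed
  show "cz V R <#> W = V" by (rule union_of_conjugates(1)[OF Vs Rs cz_subset nWV cov])
  show "\<lbrakk>h \<in> V; y \<in> cz V R; y \<notin> W; y \<frown> h \<in> cz V R\<rbrakk> \<Longrightarrow> h \<in> cz V R"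
    by (rule union_of_conjugates(2)[OF Vs Rs cz_subset nWV cov])
qed

text \<open>The elements acting trivially on \<open>V/W\<close> contain a Sylow \<open>r\<close>-subgroup for every prime \<open>r\<close> dividing
  \<open>|a\<^sup>G|\<close>, so together with \<open>C\<^sub>G(a)\<close> they generate \<open>G\<close>. Both normalise \<open>C\<^sub>V(a)\<close>, which therefore
  centralises all of \<open>a\<^sup>G\<close>.\<close>

lemma cz_a_eq_W: "cz V {a} = W"
proof
  let ?D = "{g \<in> carrier G. \<forall>u\<in>V. \<exists>w\<in>W. u \<frown> g = u \<otimes> w}" and ?T = "cz (carrier G) {a}"
  have Ds: "subgroup ?D G" by (rule subgroup_centralizer_mod[OF Gs nW subgroup.subset[OF Vs]])
  have Ts: "subgroup ?T G" using ac by (intro subgroup_cz Gs) auto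
  show WT: "W \<subseteq> cz V {a}" using a by (auto simp: W_def cz_def)
  have RD: "R \<subseteq> ?D" if r: "prime r" "r dvd cl a" and R: "sylow_in r (carrier G) R" for r R
  proof
    fix x assume x: "x \<in> R"
    have xc: "x \<in> carrier G" using sub_carrier[OF sylow_subgroup[OF R] x] .
    have "\<exists>w\<in>W. u \<frown> x = u \<otimes> w" if u: "u \<in> V" for u
    proof -
      have "u \<in> cz V R <#> W" using cz_sylow(1)[OF r R] u by simp
      then obtain c w where cw: "c \<in> cz V R" "w \<in> W" "u = c \<otimes> w" unfolding set_mult_iff by blast
      have cc: "c \<in> carrier G" and cx: "c \<frown> x = c"
        using cw(1) x xc Vc conj_fix[of c x] by (auto simp: cz_def)
      have wx: "w \<frown> x \<in> W" by (rule normal_in_conj[OF nW cw(2) xc])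
      have "u \<frown> x = c \<otimes> w \<frown> x" using cw(3) cc cx Wc[OF cw(2)] xc by (simp add: conj_mult)
      also have "\<dots> = u \<otimes> (inv w \<otimes> w \<frown> x)"
        unfolding cw(3) using cc Wc[OF cw(2)] Wc[OF wx] by (simp add: m_assoc inv_mult_cancel)
      finally show ?thesis using wx cw(2) Ws by (blast intro: subgroup.m_closed subgroup.m_inv_closed)
    qed
    then show "x \<in> ?D" using xc by simp
  qed
  obtain m where m: "card (carrier G) = card ?D * m" "m > 0"
    using subgroup_index[OF Gs Ds subgroup.subset[OF Ds]] by blast
  have "coprime m (cl a)"
  proof (rule ccontr)
    assume "\<not> coprime m (cl a)"
    then obtain r where r: "prime r" "r dvd m" "r dvd cl a"
      using prime_factor_nat[of "gcd m (cl a)"] by (auto simp: coprime_iff_gcd_eq_1)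
    obtain R where R: "sylow_in r (carrier G) R" by (rule sylow_exists[OF Gs r(1)])
    show False
      using sylow_index[OF R Ds RD[OF r(1,3) R] subgroup.subset[OF Ds] Gs r(1) m(1)] r(2) by blast
  qed
  then have DT: "?D <#> ?T = carrier G"
    by (rule coprime_index_product[OF Gs Ds subgroup.subset[OF Ds] Ts cz_subset m(1) orb_index[OF Gs ac]])
  have TV: "cz V {a} = V \<inter> ?T" using Vc by (auto simp: cz_def)
  have norm: "t \<frown> g \<in> cz V {a}" if t: "t \<in> cz V {a}" and g: "g \<in> carrier G" for t g
  proof -
    have tV: "t \<in> V" and tc: "t \<in> carrier G" using t Vc by (auto simp: cz_def)
    have "g \<in> ?D <#> ?T" using DT g by simp
    then obtain d c where dc: "d \<in> ?D" "c \<in> ?T" "g = d \<otimes> c" unfolding set_mult_iff by blast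
    have dcc: "d \<in> carrier G" "c \<in> carrier G" using dc by (auto simp: cz_def)
    obtain w where w: "w \<in> W" "t \<frown> d = t \<otimes> w" using dc(1) tV by blast
    have tdV: "t \<frown> d \<in> cz V {a}"
      unfolding w(2) using t w(1) WT subgroup_cz[OF Vs, of "{a}"] ac by (auto intro: subgroup.m_closed)
    then have "t \<frown> d \<frown> c \<in> V" "t \<frown> d \<frown> c \<in> ?T"
      using TV normal_in_conj[OF V(1) _ dcc(2)] conj_in_sub[OF Ts _ dc(2)] by auto
    moreover have "t \<frown> g = t \<frown> d \<frown> c" unfolding dc(3) using tc dcc by (simp add: conj_conj)
    ultimately show ?thesis using TV by simp
  qed
  show "cz V {a} \<subseteq> W"
  proof
    fix t assume t: "t \<in> cz V {a}"
    then have tV: "t \<in> V" and tc: "t \<in> carrier G" using Vc by (auto simp: cz_def)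
    have "c \<otimes> t = t \<otimes> c" if c: "c \<in> orb (carrier G) a" for c
    proof -
      obtain g where g: "g \<in> carrier G" "c = a \<frown> g" using c by (auto simp: orb_def)
      have "t \<frown> (inv g) \<in> cz V {a}" using norm[OF t] g by simp
      then have "a \<otimes> t \<frown> (inv g) = t \<frown> (inv g) \<otimes> a" by (simp add: cz_def)
      then have "a \<frown> g \<otimes> t \<frown> (inv g) \<frown> g = t \<frown> (inv g) \<frown> g \<otimes> a \<frown> g"
        using conj_commute_iff[OF ac _ g(1), of "t \<frown> (inv g)"] tc g(1) by simp
      then show ?thesis using g tc by simp
    qed
    then have "m \<otimes> t = t \<otimes> m" if "m \<in> M" for m using Mgen[OF tc _ that] by blast
    then show "t \<in> W" using tV tc by (simp add: W_def cz_def)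
  qed
qed

lemma index_W: obtains n where "card V = card W * n" "n dvd cl a"
  using orb_index[OF Vs ac] cl_V[OF ac] cz_a_eq_W by metis

text \<open>\<open>b\<close> lies in C_V(R) outside \<open>W\<close> and is fixed by
  \<open>y\<close>, so the meeting condition for conjugates of C_V(R) puts \<open>y\<close> into
  C_V(R).\<close>

lemma Y_central:
  assumes r: "prime r" "r dvd cl a" and R: "sylow_in r (carrier G) R" "R \<subseteq> cz (carrier G) {b}"
    and y: "y \<in> Y" "x \<in> R"
  shows "y \<otimes> x = x \<otimes> y"
proof -
  have bR: "b \<in> cz V R" using R(2) b_V by (auto simp: cz_def subset_iff)
  have yV: "y \<in> V" and "y \<otimes> b = b \<otimes> y" using y(1) by (auto simp: Y_def cz_def)
  then have "b \<frown> y = b" using conj_fix[OF b(1) Vc[OF yV]] by simp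
  then have "y \<in> cz V R" using cz_sylow(2)[OF r R(1) yV bR b_notin_W] bR by simp
  then show ?thesis using y(2) by (simp add: cz_def)
qed

lemma sylow_centralizing_b:
  assumes r: "prime r" "r dvd cl a"
  obtains R where "sylow_in r (carrier G) R" "R \<subseteq> cz (carrier G) {b}"
proof -
  have "\<not> r dvd cl b" using coprime_no_common[OF co r] by blast
  then show thesis using sylow_centralizes[OF Gs b(1) r(1)] that by blast
qed

text \<open>For the prime \<open>q\<close> the Sylow subgroup contains \<open>b\<close>, so
  centralising it implies centralising \<open>b\<close>.\<close>

lemma Y_eq_cz:
  assumes R: "sylow_in q (carrier G) R" "R \<subseteq> cz (carrier G) {b}"
  shows "cz V R = Y"
proof
  have bR: "b \<in> R" by (rule q_element_in_central_sylow[OF q b(1,2) R])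
  then show "cz V R \<subseteq> Y" by (auto simp: Y_def cz_def)
  show "Y \<subseteq> cz V R" using Y_central[OF q q_cl_a R] YV by (auto simp: cz_def)
qed

lemma Y_facts:
  shows YW: "Y <#> W = V"
    and Y_TI: "\<lbrakk>h \<in> V; y \<in> Y; y \<notin> W; y \<frown> h \<in> Y\<rbrakk> \<Longrightarrow> h \<in> Y"
    and Y_cover: "\<lbrakk>z \<in> V; z \<notin> W\<rbrakk> \<Longrightarrow> \<exists>h\<in>V. z \<in> cset Y h"
proof -
  obtain R where R: "sylow_in q (carrier G) R" "R \<subseteq> cz (carrier G) {b}"
    by (rule sylow_centralizing_b[OF q q_cl_a])
  note * = cz_sylow[OF q q_cl_a R(1), unfolded Y_eq_cz[OF R]]
  show "Y <#> W = V" by (rule *(1))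
  show "\<lbrakk>h \<in> V; y \<in> Y; y \<notin> W; y \<frown> h \<in> Y\<rbrakk> \<Longrightarrow> h \<in> Y" by (rule *(2))
  show "\<lbrakk>z \<in> V; z \<notin> W\<rbrakk> \<Longrightarrow> \<exists>h\<in>V. z \<in> cset Y h" by (rule *(3))
qed

lemma Y_inter_M: "m \<in> Y \<Longrightarrow> m \<in> M \<Longrightarrow> m = \<one>"
  using fixed_in_M by (simp add: Y_def cz_def)

text \<open>A Sylow p-subgroup centralises \<open>b\<close> and supplements \<open>V\<close>, so
  \<open>V\<close> is already transitive on the class of \<open>b\<close>.\<close>

lemma index_Y: "card V = card Y * cl b"
proof -
  obtain P where P: "sylow_in p (carrier G) P" "P \<subseteq> cz (carrier G) {b}"
    by (rule sylow_centralizing_b[OF p pa])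
  have "orb (carrier G) b \<subseteq> orb V b"
  proof
    fix d assume "d \<in> orb (carrier G) b"
    then obtain g where g: "g \<in> carrier G" "d = b \<frown> g" by (auto simp: orb_def)
    then have "g \<in> P <#> V" using P_times_V[OF P(1)] by simp
    then obtain x v where xv: "x \<in> P" "v \<in> V" "g = x \<otimes> v" unfolding set_mult_iff by blast
    have xc: "x \<in> carrier G" and xb: "x \<otimes> b = b \<otimes> x" using P(2) xv(1) by (auto simp: cz_def subset_iff)
    have "d = b \<frown> x \<frown> v" using g xv b(1) xc Vc by (simp add: conj_conj)
    also have "b \<frown> x = b" using conj_fix[OF b(1) xc] xb by simp
    finally show "d \<in> orb V b" using xv(2) by (auto simp: orb_def)
  qed
  moreover have "orb V b \<subseteq> orb (carrier G) b" using Vc by (auto simp: orb_def)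
  ultimately have "orb V b = orb (carrier G) b" by blast
  then show ?thesis using orb_index[OF Vs b(1)] by (simp add: Y_def)
qed

lemma sep_q: "z \<in> V \<Longrightarrow> q dvd cl z \<Longrightarrow> coprime (cl z) (cl b)"
  using sep[OF Vc reg_V] coprime_no_common[OF _ q _ q_cl_a] by blast

text \<open>Because V = Y W, the element conjugating into \<open>Y\<close> can be chosen in
  \<open>W\<close>.\<close>

lemma conj_of_Y:
  assumes z: "z \<in> V" "\<not> q dvd cl z" obtains w where "w \<in> W" "z \<in> cset Y w"
proof -
  obtain R where R: "sylow_in q (carrier G) R" "R \<subseteq> cz (carrier G) {b}"
    by (rule sylow_centralizing_b[OF q q_cl_a])
  obtain h where h: "h \<in> V" "z \<in> cset (cz V R) h" by (rule centralized_by_conjugate[OF q R(1) z])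
  then have "h \<in> Y <#> W" using YW by simp
  then obtain y w where yw: "y \<in> Y" "w \<in> W" "h = y \<otimes> w" unfolding set_mult_iff by blast
  have "cset Y h = cset (cset Y y) w"
    unfolding yw(3) using cset_cset[OF subgroup.subset[OF Ys] Yc[OF yw(1)] Wc[OF yw(2)]] by simp
  then have "z \<in> cset Y w" using h(2) Y_eq_cz[OF R] cset_stable[OF Ys yw(1)] by simp
  then show thesis using that yw(2) by blast
qed

text \<open>Otherwise \<open>m\<close> would be conjugate to an element of Y \<inter> M, which is
  trivial.\<close>

lemma q_cl_M:
  assumes m: "m \<in> M" "m \<noteq> \<one>" shows "q dvd cl m"
proof (rule ccontr)
  assume nq: "\<not> q dvd cl m"
  have "m \<in> V" using m MW WV by blast
  then obtain w where w: "w \<in> W" "m \<in> cset Y w" by (rule conj_of_Y[OF _ nq])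
  then obtain y where y: "y \<in> Y" "m = y \<frown> w" by blast
  have "y \<in> M" using normal_in_conj_iff[OF M(1) Gs Yc[OF y(1)] Wc[OF w(1)]] m y by simp
  then have "y = \<one>" using Y_inter_M y(1) by simp
  then show False using m y Wc[OF w(1)] by simp
qed

text \<open>Multiply \<open>z\<close> by an element \<open>m\<close> of \<open>M\<close> of order
  \<open>s\<close>: the class size of z m is divisible by \<open>q\<close>, so separation applies to
  z m, and cl z divides its class size.\<close>

lemma coprime_cl_b_of_prime:
  assumes s: "prime s" "s dvd card M" and z: "z \<in> W" "\<not> s dvd ord z"
  shows "coprime (cl z) (cl b)"
proof -
  obtain m where m: "m \<in> M" "ord m = s" by (rule cauchy[OF Ms s])
  have "m \<noteq> \<one>" using m(2) s(1) by auto
  have c: "coprime (ord z) (ord m)" using z(2) s(1) m(2) by (simp add: coprime_commute prime_imp_coprime)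
  note dv = orb_coprime_dvd[OF Gs Wc[OF z(1)] Mc[OF m(1)] WM[OF z(1) m(1)] c]
  have "z \<otimes> m \<in> V" using z(1) m(1) MW WV Vs by (auto intro: subgroup.m_closed)
  then have "coprime (cl (z \<otimes> m)) (cl b)"
    using sep_q q_cl_M[OF m(1) \<open>m \<noteq> \<one>\<close>] dv(2) dvd_trans by blast
  then show ?thesis by (rule coprime_divisors[OF dv(1) dvd_refl])
qed

text \<open>For s-regular elements of \<open>W\<close> the class size is prime to \<open>s\<close>,
  so W = S C_W(S), and it remains to see that \<open>S\<close> is abelian. Elements of
  \<open>S\<close> not central in \<open>S\<close> are conjugate in \<open>S\<close> into C_S(b), so
  S = C_S(b) Z(S); an element of order \<open>s\<close> in \<open>M\<close> is then used to show
  that C_S(b) is central as well.\<close>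

lemma sylow_W_of_M:
  assumes s: "prime s" "s dvd card M" and S: "sylow_in s W S"
  shows "S \<subseteq> cz W W"
proof -
  have sb: "s dvd cl b" using s(2) M(2) dvd_trans by blast
  have nsW: "\<not> s dvd cl z" if "coprime (cl z) (cl b)" for z
    using coprime_no_common[OF that s(1) _ sb] by blast
  have cov: "\<not> s dvd card (orb W z)" if z: "z \<in> W" "\<not> s dvd ord z" for z
    using nsW[OF coprime_cl_b_of_prime[OF s z]] orb_normal_dvd[OF nW Gs Wc[OF z(1)]] dvd_trans by blast
  note SW = sylow_direct_cover[OF Ws s(1) cov S]
  have nS: "normal_in S (carrier G)" by (rule normal_sylow_in_normal[OF nW s(1) S SW(2)])
  note Ss = normal_in_subgroup[OF nS]
  note Sc = sub_carrier[OF Ss]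
  have SWs: "S \<subseteq> W" by (rule sylow_subset[OF S])
  have central: "u \<in> cz S S" if u: "u \<in> S" "coprime (cl u) (cl b)" for u
  proof -
    obtain R where R: "sylow_in s (carrier G) R" "R \<subseteq> cz (carrier G) {u}"
      using sylow_centralizes[OF Gs Sc[OF u(1)] s(1) nsW[OF u(2)]] by blast
    have "S \<subseteq> R" by (rule normal_q_subgroup_in_sylow[OF s(1) R(1) nS sylow_card[OF S]])
    then show ?thesis using R(2) u(1) by (auto simp: cz_def subset_iff)
  qed
  let ?F = "cz S {b}"
  have Fs: "subgroup ?F G" using b(1) by (intro subgroup_cz[OF Ss]) auto
  have FY: "x \<in> ?F \<longleftrightarrow> x \<in> S \<and> x \<in> Y" for x using SWs WV by (auto simp: cz_def Y_def)
  have inF: "\<exists>\<sigma>\<in>S. u \<in> cset ?F \<sigma>" if u: "u \<in> S" "\<not> q dvd cl u" for u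
  proof -
    have "u \<in> V" using u(1) SWs WV by blast
    then obtain w where w: "w \<in> W" "u \<in> cset Y w" using conj_of_Y u(2) by blast
    then obtain y where y: "y \<in> Y" "u = y \<frown> w" by blast
    have "w \<in> S <#> cz W S" using SW(1) w(1) by simp
    then obtain \<sigma> j where sj: "\<sigma> \<in> S" "j \<in> cz W S" "w = \<sigma> \<otimes> j" unfolding set_mult_iff by blast
    have jc: "j \<in> carrier G" using sj(2) Wc by (auto simp: cz_def)
    have "u \<frown> j = u" using sj(2) u(1) conj_fix[OF Sc[OF u(1)] jc] by (auto simp: cz_def)
    moreover have "u = (y \<frown> \<sigma>) \<frown> j" using y(2) sj Yc[OF y(1)] Sc[OF sj(1)] jc by (simp add: conj_conj)
    ultimately have "u = y \<frown> \<sigma>"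
      using conj_inj[OF Sc[OF u(1)] _ jc, of "y \<frown> \<sigma>"] Yc[OF y(1)] Sc[OF sj(1)] by simp
    moreover then have "y \<in> S" using normal_in_conj_iff[OF nS Gs Yc[OF y(1)] Sc[OF sj(1)]] u(1) by simp
    ultimately show ?thesis using y(1) sj(1) FY by blast
  qed
  have FZ: "?F <#> cz S S = S"
  proof (rule union_of_conjugates(1)[OF Ss Fs cz_subset normal_in_center[OF Ss]])
    fix u assume u: "u \<in> S" "u \<notin> cz S S"
    have "u \<in> V" using u(1) SWs WV by blast
    then have "\<not> q dvd cl u" using central[OF u(1)] u(2) sep_q by blast
    then show "\<exists>h\<in>S. u \<in> cset ?F h" by (rule inF[OF u(1)])
  qed
  obtain m where m: "m \<in> M" "ord m = s" by (rule cauchy[OF Ms s])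
  have mS: "m \<in> S" using sylow_normal_contains[OF s(1) Ws S SW(2), of m 1] m MW by auto
  have mZ: "m \<in> cz S S" using mS WM[OF _ m(1)] SWs by (auto simp: cz_def)
  note Zs = normal_in_subgroup[OF normal_in_center[OF Ss]]
  have "e \<in> cz S S" if e: "e \<in> ?F" for e
  proof -
    have eS: "e \<in> S" using e by (simp add: cz_def)
    \<comment> \<open>\<open>m\<close> is central in \<open>S\<close>. If \<open>q\<close> divides
      the class size of e m, then e m, and so \<open>e\<close>, is central in \<open>S\<close>.
      Otherwise e m is conjugate into C_S(b) by S = C_S(b) Z(S), hence lies in C_S(b), and
      \<open>m\<close> falls into Y \<inter> M, a contradiction.\<close>
    have em: "e \<otimes> m \<in> S" using eS mS Ss by (simp add: subgroup.m_closed)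
    show ?thesis
    proof (cases "q dvd cl (e \<otimes> m)")
      case True
      then have "e \<otimes> m \<in> cz S S" using central[OF em] sep_q em SWs WV by blast
      then have "e \<otimes> m \<otimes> inv m \<in> cz S S" using mZ Zs by (simp add: subgroup.m_closed subgroup.m_inv_closed)
      then show ?thesis using Sc[OF eS] Mc[OF m(1)] by (simp add: m_assoc)
    next
      case False
      then obtain \<sigma> y where y: "\<sigma> \<in> S" "y \<in> ?F" "e \<otimes> m = y \<frown> \<sigma>" using inF[OF em] by blast
      then have "\<sigma> \<in> ?F <#> cz S S" using FZ by simp
      then obtain c z where cz: "c \<in> ?F" "z \<in> cz S S" "\<sigma> = c \<otimes> z" unfolding set_mult_iff by blast
      have cc: "c \<in> carrier G" "z \<in> carrier G" using cz Sc by (auto simp: cz_def)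
      have yc: "y \<frown> c \<in> ?F" by (rule conj_in_sub[OF Fs y(2) cz(1)])
      then have ycS: "y \<frown> c \<in> S" by (simp add: cz_def)
      have yS: "y \<in> S" using y(2) by (simp add: cz_def)
      have "y \<frown> c \<frown> z = y \<frown> c" using cz(2) ycS conj_fix[OF Sc[OF ycS] cc(2)] by (simp add: cz_def)
      then have "e \<otimes> m = y \<frown> c" using y(3) cz(3) cc Sc[OF yS] by (simp add: conj_conj)
      then have "inv e \<otimes> (e \<otimes> m) \<in> ?F" using yc e Fs by (simp add: subgroup.m_closed subgroup.m_inv_closed)
      then have "m \<in> Y" using FY Sc[OF eS] Mc[OF m(1)] by (simp add: inv_mult_cancel)
      then have "m = \<one>" using Y_inter_M m(1) by simp
      then show ?thesis using m(2) s(1) by (metis not_prime_1 ord_id)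
    qed
  qed
  then have "S \<subseteq> cz S S"
    using set_mult_sub[OF Zs, of ?F "cz S S"] FZ by blast
  then have ab: "x \<otimes> y = y \<otimes> x" if "x \<in> S" "y \<in> S" for x y using that by (auto simp: cz_def subset_iff)
  have "x \<otimes> w = w \<otimes> x" if x: "x \<in> S" and w: "w \<in> W" for x w
  proof -
    have "w \<in> S <#> cz W S" using SW(1) w by simp
    then obtain \<sigma> j where sj: "\<sigma> \<in> S" "j \<in> cz W S" "w = \<sigma> \<otimes> j" unfolding set_mult_iff by blast
    have jc: "j \<in> carrier G" using sj(2) Wc by (auto simp: cz_def)
    have "x \<frown> \<sigma> = x" "x \<frown> j = x"
      using conj_fix[OF Sc[OF x] Sc[OF sj(1)]] conj_fix[OF Sc[OF x] jc] ab[OF x sj(1)] sj(2) x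
      by (auto simp: cz_def)
    then have "x \<frown> w = x" unfolding sj(3) using Sc[OF x] Sc[OF sj(1)] jc by (simp add: conj_conj[symmetric])
    then show ?thesis using conj_fix[OF Sc[OF x] Wc[OF w]] by simp
  qed
  then show ?thesis using SWs by (auto simp: cz_def)
qed

text \<open>Since \<open>W\<close> centralises \<open>x\<close>, a prime dividing cl x divides the
  index of \<open>W\<close> in \<open>G\<close>, hence cl a. For such a prime a Sylow subgroup
  centralising \<open>b\<close> centralises all of \<open>Y\<close>, including
  \<open>x\<close>.\<close>

lemma central_of_Y_and_W:
  assumes x: "x \<in> Y" "x \<in> cz W W" shows "cl x = 1"
proof (rule ccontr)
  assume "cl x \<noteq> 1"
  then obtain r where r: "prime r" "r dvd cl x" using prime_factor_nat by blast
  note xc = Yc[OF x(1)]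
  let ?C = "cz (carrier G) {x}"
  have Cs: "subgroup ?C G" using xc by (intro subgroup_cz Gs) auto
  have "W \<subseteq> ?C" using x(2) Wc by (auto simp: cz_def)
  then obtain l where l: "card ?C = card W * l" by (rule subgroup_index[OF Cs Ws])
  obtain n where n: "card V = card W * n" "n dvd cl a" by (rule index_W)
  obtain k where k: "card (carrier G) = card V * p ^ k"
    by (rule regular_index_power[OF Gs Vs subgroup.subset[OF Vs] p]) (use regular_iff_V in blast)
  have "card W * (n * p ^ k) = card W * (l * cl x)" using k n l orb_index[OF Gs xc] by (metis mult.assoc)
  then have "n * p ^ k = l * cl x" using card_sub_pos[OF Ws] by (metis mult_left_cancel not_gr_zero)
  then have "r dvd n * p ^ k" using r(2) by simp
  then have "r dvd n \<or> r dvd p ^ k" using r(1) by (simp add: prime_dvd_mult_iff)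
  then have ra: "r dvd cl a"
    using n(2) pa r(1) p by (metis dvd_trans prime_dvd_power primes_dvd_imp_eq)
  obtain R where R: "sylow_in r (carrier G) R" "R \<subseteq> cz (carrier G) {b}"
    by (rule sylow_centralizing_b[OF r(1) ra])
  have "R \<subseteq> ?C" using Y_central[OF r(1) ra R x(1)] sub_carrier[OF sylow_subgroup[OF R(1)]] by (auto simp: cz_def)
  then show False using sylow_centralizes_dvd[OF Gs xc r(1) R(1)] r(2) by blast
qed

text \<open>Only the case of \<open>q\<close> not dividing cl z is left by separation. Then
  \<open>z\<close> is conjugate to some y in Y \<inter> W. For a prime \<open>s\<close> of |M| the
  s-part of y is central in \<open>W\<close>, hence in \<open>G\<close>, so the s-regular part has
  the same class size up to divisibility and \<open>coprime_cl_b_of_prime\<close> applies.\<close>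

lemma coprime_cl_b: "z \<in> W \<Longrightarrow> coprime (cl z) (cl b)"
proof -
  assume z: "z \<in> W"
  have "card M \<noteq> 1"
  proof
    assume "card M = 1"
    then have "a = \<one>" using a subgroup.one_closed[OF Ms] by (metis card_1_singletonE singletonD)
    then show False using cl_a_neq1 orb_one_iff[OF ac] by simp
  qed
  then obtain s where s: "prime s" "s dvd card M" using prime_factor_nat by blast
  obtain S where S: "sylow_in s W S" by (rule sylow_exists[OF Ws s(1)])
  note SZ = sylow_W_of_M[OF s S]
  show ?thesis
  proof (cases "q dvd cl z")
    case True
    then show ?thesis using sep_q z WV by blast
  next
    case False
    then obtain w where w: "w \<in> W" "z \<in> cset Y w" using conj_of_Y z WV by blast
    then obtain y where y: "y \<in> Y" "z = y \<frown> w" by blast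
    note yc = Yc[OF y(1)]
    have yW: "y \<in> W" using normal_in_conj_iff[OF nW Gs yc Wc[OF w(1)]] y(2) z by simp
    have clz: "cl z = cl y" unfolding y(2) using orb_conj[OF Gs yc] Wc[OF w(1)] by simp
    obtain i j l :: nat where ij: "y = y [^] i \<otimes> y [^] j" "ord (y [^] i) = s ^ l" "\<not> s dvd ord (y [^] j)"
      using primary_decomp[OF yc s(1)] by blast
    have yi: "y [^] i \<in> W" "y [^] j \<in> W" "y [^] i \<in> Y" using sub_pow[OF Ws yW] sub_pow[OF Ys y(1)] by auto
    have "y [^] i \<in> S"
      by (rule sylow_normal_contains[OF s(1) Ws S sylow_central_normal[OF S SZ Ws] yi(1) ij(2)])
    then have "cl (y [^] i) = 1" using central_of_Y_and_W[OF yi(3)] SZ by blast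
    then have cen: "g \<otimes> y [^] i = y [^] i \<otimes> g" if "g \<in> carrier G" for g
      using orb_one_iff[of "y [^] i"] conj_fix[of "y [^] i" g] that yc by auto
    have "cz (carrier G) {y [^] j} \<subseteq> cz (carrier G) {y}"
    proof -
      have "cz (carrier G) {y [^] j} \<subseteq> cz (carrier G) {y [^] i} \<inter> cz (carrier G) {y [^] j}"
        using cen by (auto simp: cz_def)
      also have "\<dots> \<subseteq> cz (carrier G) {y [^] i \<otimes> y [^] j}" using yc by (intro cz_mult) auto
      finally show ?thesis using ij(1) by simp
    qed
    then have "cl y dvd cl (y [^] j)" using yc by (intro orb_dvd[OF Gs]) auto
    moreover have "coprime (cl (y [^] j)) (cl b)" by (rule coprime_cl_b_of_prime[OF s yi(2) ij(3)])
    ultimately show ?thesis using clz coprime_divisors[OF _ dvd_refl] by metis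
  qed
qed

lemma sylow_W_central:
  assumes t: "prime t" "t dvd cl b" and T: "sylow_in t W T" shows "T \<subseteq> cz W W"
proof (rule sylow_central_cover[OF Ws t(1) _ T])
  fix z assume z: "z \<in> W"
  have "\<not> t dvd cl z" using coprime_no_common[OF coprime_cl_b[OF z] t(1) _ t(2)] by blast
  then show "\<not> t dvd card (orb W z)" using orb_normal_dvd[OF nW Gs Wc[OF z]] dvd_trans by blast
qed

section \<open>Splitting the p-complement into its pi-part and pi'-part\<close>

definition N where "N = {x \<in> cz W W. \<forall>r. prime r \<longrightarrow> r dvd ord x \<longrightarrow> r dvd cl b}"

definition D where "D = {x \<in> cz Y Y. \<forall>r. prime r \<longrightarrow> r dvd ord x \<longrightarrow> r dvd cl a}"

text \<open>\<open>K\<close> will be the pi-core of \<open>V\<close>, with pi the primes of both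
  class sizes. \<open>N\<close> supplies the Sylow subgroups for primes of cl b, and
  \<open>D\<close> those for the primes of cl a other than \<open>p\<close>.\<close>

definition K where "K = D <#> N"

definition Z\<^sub>1 where "Z\<^sub>1 = Y \<inter> W"

definition Z\<^sub>2 where "Z\<^sub>2 = {x \<in> cz Z\<^sub>1 Z\<^sub>1. \<forall>r. prime r \<longrightarrow> r dvd ord x \<longrightarrow> r dvd cl a * cl b}"

text \<open>The complement of \<open>Z\<^sub>2\<close> in \<open>Z\<^sub>1\<close>, in the form
  delivered by \<open>central_hall_complement\<close>; it will be the pi'-core of
  \<open>V\<close>.\<close>

definition L where "L = {x \<in> Z\<^sub>1. coprime (ord x) (card Z\<^sub>2)}"

lemma cz_W_W: "subgroup (cz W W) G" "\<lbrakk>x \<in> cz W W; w \<in> W\<rbrakk> \<Longrightarrow> x \<otimes> w = w \<otimes> x"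
  using normal_in_subgroup[OF normal_in_center[OF Ws]] by (auto simp: cz_def)

lemma cz_Y_Y: "subgroup (cz Y Y) G" "\<lbrakk>x \<in> cz Y Y; y \<in> Y\<rbrakk> \<Longrightarrow> x \<otimes> y = y \<otimes> x"
  using normal_in_subgroup[OF normal_in_center[OF Ys]] by (auto simp: cz_def)

lemma NW: "x \<in> N \<Longrightarrow> x \<in> W" and NZ: "x \<in> N \<Longrightarrow> x \<in> cz W W" by (auto simp: N_def cz_def)

lemma DY: "x \<in> D \<Longrightarrow> x \<in> Y" and DZ: "x \<in> D \<Longrightarrow> x \<in> cz Y Y" by (auto simp: D_def cz_def)

lemma Ns: "subgroup N G"
  unfolding N_def using cz_W_W(2) cz_subset[of W W]
  by (intro subgroup_prime_elements(1)[OF cz_W_W(1)]) blast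

lemma card_N: "prime r \<Longrightarrow> r dvd card N \<Longrightarrow> r dvd cl b"
  unfolding N_def using cz_W_W(2) cz_subset[of W W]
  by (intro subgroup_prime_elements(2)[OF cz_W_W(1), where Q = "\<lambda>r. r dvd cl b"]) blast+

lemma Ds: "subgroup D G"
  unfolding D_def using cz_Y_Y(2) cz_subset[of Y Y]
  by (intro subgroup_prime_elements(1)[OF cz_Y_Y(1)]) blast

lemma card_D: "prime r \<Longrightarrow> r dvd card D \<Longrightarrow> r dvd cl a"
  unfolding D_def using cz_Y_Y(2) cz_subset[of Y Y]
  by (intro subgroup_prime_elements(2)[OF cz_Y_Y(1), where Q = "\<lambda>r. r dvd cl a"]) blast+

lemma nN: "normal_in N (carrier G)"
proof -
  have "normal_in (W \<inter> cz (carrier G) W) (carrier G)"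
    by (rule normal_in_inter[OF nW normal_in_cz[OF nW]])
  moreover have "W \<inter> cz (carrier G) W = cz W W" using Wc by (auto simp: cz_def)
  ultimately have n: "normal_in (cz W W) (carrier G)" by simp
  have "x \<frown> g \<in> N" if x: "x \<in> N" and g: "g \<in> carrier G" for x g
    using normal_in_conj[OF n NZ[OF x] g] x ord_conj[OF Wc[OF NW[OF x]] g] by (simp add: N_def)
  then show ?thesis using Ns subgroup.subset[OF Ns] by (simp add: normal_in_def)
qed

lemma Ks: "subgroup K G"
  unfolding K_def by (rule subgroup_set_mult[OF nN Ds subgroup.subset[OF Ds] Gs])

lemma DK: "D \<subseteq> K" and NK: "N \<subseteq> K"
  unfolding K_def using sub_set_mult[OF Ds Ns] by simp_all

lemma KV: "K \<subseteq> V"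
  unfolding K_def by (rule set_mult_sub[OF Vs]) (use DY YV NW WV in auto)

lemma K_elim:
  assumes "x \<in> K" obtains d n where "d \<in> D" "n \<in> N" "x = d \<otimes> n"
  using assms unfolding K_def set_mult_iff by blast

lemma b_D: "b \<in> D"
proof -
  have "b \<in> cz Y Y" using b_Y by (auto simp: cz_def Y_def)
  moreover have "r dvd cl a" if "prime r" "r dvd ord b" for r
    using that b(2) q q_cl_a by (metis prime_dvd_power primes_dvd_imp_eq)
  ultimately show ?thesis by (simp add: D_def)
qed

lemma M_N: "M \<subseteq> N"
proof
  fix m assume m: "m \<in> M"
  have "m \<in> cz W W" using m MW WM[OF _ m, symmetric] by (auto simp: cz_def)
  moreover have "ord m dvd cl b" using ord_dvd_sub[OF Ms m] M(2) dvd_trans by blast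
  ultimately show "m \<in> N" unfolding N_def using dvd_trans by blast
qed

text \<open>Such an \<open>R\<close> lies in \<open>V\<close> because \<open>r\<close> is not
  \<open>p\<close>, hence in \<open>Y\<close> because it centralises \<open>b\<close>, and
  \<open>Y_central\<close> makes it central there.\<close>

lemma sylow_sub_D:
  assumes r: "prime r" "r dvd cl a" "r \<noteq> p" and R: "sylow_in r (carrier G) R" "R \<subseteq> cz (carrier G) {b}"
  shows "R \<subseteq> D" "R \<subseteq> cz Y Y"
proof -
  have "R \<subseteq> Y" using sylow_in_V(1)[OF r(1,3) R(1)] R(2) by (auto simp: Y_def cz_def)
  then show RZ: "R \<subseteq> cz Y Y" using Y_central[OF r(1,2) R] by (auto simp: cz_def)
  show "R \<subseteq> D"
  proof
    fix x assume x: "x \<in> R"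
    obtain i where i: "ord x = r ^ i" by (rule sylow_elem_ord[OF r(1) R(1) x])
    have "s dvd cl a" if "prime s" "s dvd ord x" for s
      using that i r by (metis prime_dvd_power primes_dvd_imp_eq)
    then show "x \<in> D" using RZ x by (auto simp: D_def)
  qed
qed

lemma sylow_sub_N:
  assumes t: "prime t" "t dvd cl b" and T: "sylow_in t W T" shows "T \<subseteq> N"
proof
  fix x assume x: "x \<in> T"
  obtain i where i: "ord x = t ^ i" by (rule sylow_elem_ord[OF t(1) T x])
  have "s dvd cl b" if "prime s" "s dvd ord x" for s
    using that i t by (metis prime_dvd_power primes_dvd_imp_eq)
  then show "x \<in> N" using sylow_W_central[OF t T] x by (auto simp: N_def)
qed

lemma card_K: "prime r \<Longrightarrow> r dvd card K \<Longrightarrow> r dvd cl a * cl b"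
proof -
  assume r: "prime r" "r dvd card K"
  have "card K dvd card D * card N" using product_formula[OF Ds Ns] by (metis K_def dvd_triv_left)
  with r(2) have "r dvd card D * card N" by (rule dvd_trans)
  then have "r dvd card D \<or> r dvd card N" using r(1) by (simp add: prime_dvd_mult_iff)
  then show ?thesis using card_D card_N r(1) by (metis dvd_mult dvd_mult2)
qed

lemma Z1s: "subgroup Z\<^sub>1 G" unfolding Z\<^sub>1_def by (rule subgroup_inter[OF Ys Ws])

text \<open>A t-element of \<open>Z\<^sub>1\<close> lies in the Sylow t-subgroup of \<open>W\<close>
  when t divides cl b, and in that of \<open>Y\<close> when t divides cl a; in each case this Sylow
  subgroup is central.\<close>

lemma Z1_central_prime:
  assumes x: "x \<in> Z\<^sub>1" "ord x = t ^ i" and t: "prime t" "t dvd cl a * cl b"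
  shows "x \<in> cz Z\<^sub>1 Z\<^sub>1"
proof -
  have xY: "x \<in> Y" and xW: "x \<in> W" using x by (auto simp: Z\<^sub>1_def)
  have "t dvd cl a \<or> t dvd cl b" using t by (simp add: prime_dvd_mult_iff)
  then show ?thesis
  proof
    assume tb: "t dvd cl b"
    obtain T where T: "sylow_in t W T" by (rule sylow_exists[OF Ws t(1)])
    note TZ = sylow_W_central[OF t(1) tb T]
    have "x \<in> T" by (rule sylow_normal_contains[OF t(1) Ws T sylow_central_normal[OF T TZ Ws] xW x(2)])
    then show ?thesis using TZ x(1) by (auto simp: cz_def Z\<^sub>1_def)
  next
    assume ta: "t dvd cl a"
    show ?thesis
    proof (cases "t = p")
      case True
      then have "i = 0" using reg_V[of x] xW WV x(2) by (cases i) auto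
      then have "x = \<one>" using x(2) ord_eq_1[OF Wc[OF xW]] by simp
      then show ?thesis using x(1) sub_carrier[OF Z1s] by (auto simp: cz_def)
    next
      case False
      obtain R where R: "sylow_in t (carrier G) R" "R \<subseteq> cz (carrier G) {b}"
        by (rule sylow_centralizing_b[OF t(1) ta])
      note RZ = sylow_sub_D(2)[OF t(1) ta False R]
      have RY: "sylow_in t Y R"
        by (rule sylow_intermediate(1)[OF R(1) Ys _ subgroup.subset[OF Ys] Gs t(1)])
           (use RZ cz_subset in blast)
      have "x \<in> R" by (rule sylow_normal_contains[OF t(1) Ys RY sylow_central_normal[OF RY RZ Ys] xY x(2)])
      then show ?thesis using RZ x(1) by (auto simp: cz_def Z\<^sub>1_def)
    qed
  qed
qed

lemma cz_Z1: "subgroup (cz Z\<^sub>1 Z\<^sub>1) G" "\<lbrakk>x \<in> cz Z\<^sub>1 Z\<^sub>1; y \<in> Z\<^sub>1\<rbrakk> \<Longrightarrow> x \<otimes> y = y \<otimes> x"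
  using normal_in_subgroup[OF normal_in_center[OF Z1s]] by (auto simp: cz_def)

lemma Z2s: "subgroup Z\<^sub>2 G"
  unfolding Z\<^sub>2_def using cz_Z1(2) cz_subset[of Z\<^sub>1 Z\<^sub>1]
  by (intro subgroup_prime_elements(1)[OF cz_Z1(1)]) blast

lemma card_Z2: "prime r \<Longrightarrow> r dvd card Z\<^sub>2 \<Longrightarrow> r dvd cl a * cl b"
  unfolding Z\<^sub>2_def using cz_Z1(2) cz_subset[of Z\<^sub>1 Z\<^sub>1]
  by (intro subgroup_prime_elements(2)[OF cz_Z1(1), where Q = "\<lambda>r. r dvd cl a * cl b"]) blast+

text \<open>\<open>Z\<^sub>2\<close> contains a Sylow subgroup of \<open>Z\<^sub>1\<close> for every
  prime of pi, so it is a central Hall subgroup and the transfer splits it off.\<close>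

lemma L_facts: shows Ls: "subgroup L G" and card_L: "prime r \<Longrightarrow> r dvd card L \<Longrightarrow> \<not> r dvd cl a * cl b"
proof -
  have Z21: "Z\<^sub>2 \<subseteq> cz Z\<^sub>1 Z\<^sub>1" by (auto simp: Z\<^sub>2_def)
  then have "Z\<^sub>2 \<subseteq> Z\<^sub>1" using cz_subset by blast
  then obtain n where n: "card Z\<^sub>1 = card Z\<^sub>2 * n" "n > 0" by (rule subgroup_index[OF Z1s Z2s])
  have nd: "\<not> r dvd n" if r: "prime r" "r dvd cl a * cl b" for r
  proof -
    obtain R where R: "sylow_in r Z\<^sub>1 R" by (rule sylow_exists[OF Z1s r(1)])
    have "R \<subseteq> Z\<^sub>2"
    proof
      fix x assume x: "x \<in> R"
      obtain i where i: "ord x = r ^ i" by (rule sylow_elem_ord[OF r(1) R x])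
      have "x \<in> cz Z\<^sub>1 Z\<^sub>1" using Z1_central_prime[OF _ i r] sylow_subset[OF R] x by blast
      moreover have "s dvd cl a * cl b" if "prime s" "s dvd ord x" for s
        using that i r by (metis prime_dvd_power primes_dvd_imp_eq)
      ultimately show "x \<in> Z\<^sub>2" by (simp add: Z\<^sub>2_def)
    qed
    then show ?thesis by (rule sylow_index[OF R Z2s _ \<open>Z\<^sub>2 \<subseteq> Z\<^sub>1\<close> Z1s r(1) n(1)])
  qed
  have co: "coprime (card Z\<^sub>2) n"
  proof (rule ccontr)
    assume "\<not> coprime (card Z\<^sub>2) n"
    then obtain r where r: "prime r" "r dvd card Z\<^sub>2" "r dvd n"
      using prime_factor_nat[of "gcd (card Z\<^sub>2) n"] by (auto simp: coprime_iff_gcd_eq_1)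
    then show False using nd card_Z2 by blast
  qed
  note * = central_hall_complement[OF Z1s Z2s Z21 n(1) co, folded L_def]
  show "subgroup L G" by (rule *(1))
  show "prime r \<Longrightarrow> r dvd card L \<Longrightarrow> \<not> r dvd cl a * cl b" using *(2) nd by blast
qed

lemma LY: "x \<in> L \<Longrightarrow> x \<in> Y" and LW: "x \<in> L \<Longrightarrow> x \<in> W" by (auto simp: L_def Z\<^sub>1_def)

text \<open>\<open>D\<close> is central in \<open>Y\<close>, \<open>N\<close> is central in
  \<open>W\<close>, and \<open>L\<close> lies in both.\<close>

lemma K_L_commute: assumes x: "x \<in> K" and y: "y \<in> L" shows "x \<otimes> y = y \<otimes> x"
proof -
  obtain d n where dn: "d \<in> D" "n \<in> N" "x = d \<otimes> n" using x by (rule K_elim)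
  have c: "d \<in> carrier G" "n \<in> carrier G" "y \<in> carrier G" using dn DY Yc NW Wc LY y by auto
  have "d \<otimes> y = y \<otimes> d" "n \<otimes> y = y \<otimes> n"
    using cz_Y_Y(2)[OF DZ[OF dn(1)] LY[OF y]] cz_W_W(2)[OF NZ[OF dn(2)] LW[OF y]] by auto
  then have "y \<frown> d = y" "y \<frown> n = y" using conj_fix c by auto
  then have "y \<frown> x = y" unfolding dn(3) using c by (simp add: conj_conj[symmetric])
  then show ?thesis using conj_fix[OF c(3), of x] dn(3) c by simp
qed

text \<open>K L contains a Sylow subgroup of \<open>V\<close> for each prime: inside
  \<open>D\<close> for primes of cl a; inside \<open>N\<close> for primes of cl b, as the index of
  \<open>W\<close> divides cl a; and inside \<open>L\<close> for the rest, as neither the index of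
  \<open>Y\<close> in \<open>V\<close> nor that of \<open>Z\<^sub>1\<close> in \<open>Y\<close>
  involves them.\<close>

lemma K_L_V: "K <#> L = V"
proof -
  have s: "subgroup (K <#> L) G" by (rule subgroup_set_mult_comm[OF Ks Ls K_L_commute])
  have sub: "K <#> L \<subseteq> V" by (rule set_mult_sub[OF Vs KV]) (use LY YV in auto)
  have KKL: "K \<subseteq> K <#> L" and LKL: "L \<subseteq> K <#> L" by (rule sub_set_mult[OF Ks Ls])+
  obtain i where i: "card V = card (K <#> L) * i" by (rule subgroup_index[OF Vs s sub])
  obtain n where n: "card V = card W * n" "n dvd cl a" by (rule index_W)
  have nYZ: "card Y = card Z\<^sub>1 * n"
  proof -
    have "card V * card Z\<^sub>1 = card Y * card W" using product_formula[OF Ys Ws] YW by (simp add: Z\<^sub>1_def)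
    then have "card W * (card Z\<^sub>1 * n) = card W * card Y" using n(1) by (simp add: mult_ac)
    then show ?thesis using card_sub_pos[OF Ws] by (metis mult_left_cancel not_gr_zero)
  qed
  have "i = 1"
  proof (rule ccontr)
    assume "i \<noteq> 1"
    then obtain r where r: "prime r" "r dvd i" using prime_factor_nat by blast
    have rV: "r dvd card V" using i r(2) by simp
    have rp: "r \<noteq> p" using p_not_card_V[OF rV] .
    have "\<exists>R. sylow_in r V R \<and> R \<subseteq> K <#> L"
    proof (cases "r dvd cl a")
      case True
      obtain R where R: "sylow_in r (carrier G) R" "R \<subseteq> cz (carrier G) {b}"
        by (rule sylow_centralizing_b[OF r(1) True])
      have "R \<subseteq> K <#> L" using sylow_sub_D(1)[OF r(1) True rp R] DK KKL by blast
      then show ?thesis using sylow_in_V(2)[OF r(1) rp R(1)] by blast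
    next
      case ra: False
      have rn: "\<not> r dvd n" using n(2) ra dvd_trans by blast
      show ?thesis
      proof (cases "r dvd cl b")
        case True
        obtain T where T: "sylow_in r W T" by (rule sylow_exists[OF Ws r(1)])
        have "sylow_in r V T" by (rule sylow_of_index[OF T Ws WV Vs r(1) n(1) rn])
        then show ?thesis using sylow_sub_N[OF r(1) True T] NK KKL by blast
      next
        case rb: False
        obtain R where R: "sylow_in r Z\<^sub>1 R" by (rule sylow_exists[OF Z1s r(1)])
        have "sylow_in r Y R" by (rule sylow_of_index[OF R Z1s _ Ys r(1) nYZ rn]) (auto simp: Z\<^sub>1_def)
        then have RV: "sylow_in r V R" by (rule sylow_of_index[OF _ Ys YV Vs r(1) index_Y rb])
        have "R \<subseteq> L"
        proof
          fix x assume x: "x \<in> R"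
          obtain i where i: "ord x = r ^ i" by (rule sylow_elem_ord[OF r(1) R x])
          have "\<not> r dvd card Z\<^sub>2" using card_Z2[OF r(1)] ra rb r(1) by (auto simp: prime_dvd_mult_iff)
          then have "coprime (ord x) (card Z\<^sub>2)" using i r(1) by (simp add: coprime_power_left_iff prime_imp_coprime)
          then show "x \<in> L" using x sylow_subset[OF R] by (auto simp: L_def)
        qed
        then show ?thesis using RV LKL by blast
      qed
    qed
    then obtain R where "sylow_in r V R" "R \<subseteq> K <#> L" by blast
    then show False using sylow_index[OF _ s _ sub Vs r(1) i] r(2) by blast
  qed
  then show ?thesis using i sub Vs by (intro card_seteq) auto
qed

lemma coprime_K_L: "coprime (card K) (card L)"
proof (rule ccontr)
  assume "\<not> coprime (card K) (card L)"
  then obtain r where "prime r" "r dvd card K" "r dvd card L"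
    using prime_factor_nat[of "gcd (card K) (card L)"] by (auto simp: coprime_iff_gcd_eq_1)
  then show False using card_K card_L by blast
qed

lemma coprime_ord_K_L: "x \<in> K \<Longrightarrow> y \<in> L \<Longrightarrow> coprime (ord x) (ord y)"
  using coprime_divisors[OF ord_dvd_sub[OF Ks] ord_dvd_sub[OF Ls] coprime_K_L] by blast

lemma Kc: "x \<in> K \<Longrightarrow> x \<in> carrier G" by (rule sub_carrier[OF Ks])

lemma Lc: "x \<in> L \<Longrightarrow> x \<in> carrier G" by (rule sub_carrier[OF Ls])

lemma K_inter_L: "K \<inter> L = {\<one>}"
proof -
  have "x = \<one>" if "x \<in> K" "x \<in> L" for x
    using coprime_ord_K_L[OF that] ord_eq_1[OF Kc[OF that(1)]] by simp
  then show ?thesis using subgroup.one_closed[OF Ks] subgroup.one_closed[OF Ls] by blast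
qed

lemma V_elim:
  assumes "x \<in> V" obtains u v where "u \<in> K" "v \<in> L" "x = u \<otimes> v"
proof -
  have "x \<in> K <#> L" using assms K_L_V by simp
  then show thesis using that unfolding set_mult_iff by blast
qed

text \<open>The components of \<open>x\<close> in \<open>K\<close> and \<open>L\<close> are powers
  of \<open>x\<close>, so their orders divide that of \<open>x\<close>, and the component for the
  wrong set of primes is trivial.\<close>

lemma pi_elements:
  assumes x: "x \<in> V"
  shows "(\<And>r. prime r \<Longrightarrow> r dvd ord x \<Longrightarrow> r dvd cl a * cl b) \<Longrightarrow> x \<in> K"
    "(\<And>r. prime r \<Longrightarrow> r dvd ord x \<Longrightarrow> \<not> r dvd cl a * cl b) \<Longrightarrow> x \<in> L"
proof -
  obtain k l where kl: "k \<in> K" "l \<in> L" "x = k \<otimes> l" by (rule V_elim[OF x])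
  note kc = Kc[OF kl(1)] and lc = Lc[OF kl(2)]
  obtain i j :: nat where ij: "(k \<otimes> l) [^] i = k" "(k \<otimes> l) [^] j = l"
    by (rule coprime_commuting_power[OF kc lc K_L_commute[OF kl(1,2)] coprime_ord_K_L[OF kl(1,2)]])
  have xc: "x \<in> carrier G" using Vc[OF x] .
  have od: "ord (x [^] (n::nat)) dvd ord x" for n
    using ord_dvd_sub[OF subgroup_cyclic[OF xc] sub_pow[OF subgroup_cyclic[OF xc] mem_cyclic]] card_cyclic[OF xc] by simp
  have ok: "ord k dvd ord x" "ord l dvd ord x" using od[of i] od[of j] ij kl(3) by simp_all
  have one: "z = \<one>" if "z \<in> carrier G" "\<And>r. prime r \<Longrightarrow> r dvd ord z \<Longrightarrow> False" for z
    using that prime_factor_nat[of "ord z"] ord_eq_1[OF that(1)] by blast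
  show "x \<in> K" if "\<And>r. prime r \<Longrightarrow> r dvd ord x \<Longrightarrow> r dvd cl a * cl b"
  proof -
    have "l = \<one>"
    proof (rule one[OF lc])
      fix r assume r: "prime r" "r dvd ord l"
      have "r dvd card L" using r(2) ord_dvd_sub[OF Ls kl(2)] dvd_trans by blast
      then show False using card_L[OF r(1)] that[OF r(1)] r(2) ok(2) dvd_trans by blast
    qed
    then show ?thesis using kl kc by simp
  qed
  show "x \<in> L" if "\<And>r. prime r \<Longrightarrow> r dvd ord x \<Longrightarrow> \<not> r dvd cl a * cl b"
  proof -
    have "k = \<one>"
    proof (rule one[OF kc])
      fix r assume r: "prime r" "r dvd ord k"
      have "r dvd card K" using r(2) ord_dvd_sub[OF Ks kl(1)] dvd_trans by blast
      then show False using card_K[OF r(1)] that[OF r(1)] r(2) ok(1) dvd_trans by blast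
    qed
    then show ?thesis using kl lc by simp
  qed
qed

lemma nKV: "normal_in K V" and nLV: "normal_in L V"
proof -
  have "x \<frown> h \<in> K" if x: "x \<in> K" and h: "h \<in> V" for x h
  proof -
    obtain k l where kl: "k \<in> K" "l \<in> L" "h = k \<otimes> l" by (rule V_elim[OF h])
    have xk: "x \<frown> k \<in> K" by (rule conj_in_sub[OF Ks x kl(1)])
    then have "x \<frown> k \<frown> l = x \<frown> k" using conj_fix[OF Kc[OF xk] Lc[OF kl(2)]] K_L_commute[OF xk kl(2)] by simp
    then show ?thesis using xk kl Kc x Lc by (simp add: conj_conj)
  qed
  then show "normal_in K V" using Ks KV by (simp add: normal_in_def)
  have "x \<frown> h \<in> L" if x: "x \<in> L" and h: "h \<in> V" for x h
  proof -
    obtain k l where kl: "k \<in> K" "l \<in> L" "h = k \<otimes> l" by (rule V_elim[OF h])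
    have "x \<frown> k = x" using conj_fix[OF Lc[OF x] Kc[OF kl(1)]] K_L_commute[OF kl(1) x] by simp
    then have "x \<frown> h = x \<frown> l" unfolding kl(3) using kl Kc Lc x by (simp add: conj_conj[symmetric])
    then show ?thesis using conj_in_sub[OF Ls x kl(2)] by simp
  qed
  then show "normal_in L V" using Ls LY YV by (auto simp: normal_in_def)
qed

text \<open>Commuting with \<open>b\<close> in \<open>D\<close> and with \<open>M\<close> inside
  \<open>N\<close> puts a central element into \<open>Y\<close> and \<open>W\<close>; conversely
  \<open>D\<close> and \<open>N\<close> are central in \<open>Y\<close> and in
  \<open>W\<close>.\<close>

lemma center_K: "cz K K = K \<inter> Y \<inter> W"
proof
  show "cz K K \<subseteq> K \<inter> Y \<inter> W"
  proof
    fix x assume x: "x \<in> cz K K"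
    then have xK: "x \<in> K" by (simp add: cz_def)
    then have xV: "x \<in> V" and xc: "x \<in> carrier G" using KV Kc by auto
    have "x \<otimes> b = b \<otimes> x" using x b_D DK by (auto simp: cz_def)
    then have "x \<in> Y" using xV by (simp add: Y_def cz_def)
    moreover have "x \<otimes> m = m \<otimes> x" if "m \<in> M" for m using x that M_N NK by (auto simp: cz_def)
    then have "x \<in> W" using xV xc by (simp add: W_def cz_def)
    ultimately show "x \<in> K \<inter> Y \<inter> W" using xK by simp
  qed
  show "K \<inter> Y \<inter> W \<subseteq> cz K K"
  proof
    fix x assume x: "x \<in> K \<inter> Y \<inter> W"
    then have xc: "x \<in> carrier G" using Kc by simp
    have "x \<otimes> k = k \<otimes> x" if k: "k \<in> K" for k
    proof -
      obtain d n where dn: "d \<in> D" "n \<in> N" "k = d \<otimes> n" using k by (rule K_elim)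
      have c: "d \<in> carrier G" "n \<in> carrier G" using dn DY Yc NW Wc by auto
      have "d \<otimes> x = x \<otimes> d" "n \<otimes> x = x \<otimes> n"
        using cz_Y_Y(2)[OF DZ[OF dn(1)]] cz_W_W(2)[OF NZ[OF dn(2)]] x by auto
      then have "x \<frown> d = x" "x \<frown> n = x" using conj_fix c xc by auto
      then have "x \<frown> k = x" unfolding dn(3) using c xc by (simp add: conj_conj[symmetric])
      then show ?thesis using conj_fix[OF xc, of k] dn(3) c by simp
    qed
    then show "x \<in> cz K K" using x by (simp add: cz_def)
  qed
qed

lemma abelian_product:
  assumes "A \<subseteq> carrier G" "\<And>x y. x \<in> A \<Longrightarrow> y \<in> A \<Longrightarrow> x \<otimes> y = y \<otimes> x"
    and "B \<subseteq> carrier G" "\<And>x y. x \<in> B \<Longrightarrow> y \<in> A \<union> B \<Longrightarrow> x \<otimes> y = y \<otimes> x"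
    and "x \<in> A" "y \<in> B" "x' \<in> A" "y' \<in> B"
  shows "(x \<otimes> y) \<otimes> (x' \<otimes> y') = (x' \<otimes> y') \<otimes> (x \<otimes> y)"
proof -
  have c: "x \<in> carrier G" "y \<in> carrier G" "x' \<in> carrier G" "y' \<in> carrier G" using assms by auto
  have "x \<frown> x' = x" "x \<frown> y' = x" "y \<frown> x' = y" "y \<frown> y' = y"
    using conj_fix c assms by (metis UnI1 UnI2)+
  then have "(x \<otimes> y) \<frown> (x' \<otimes> y') = x \<otimes> y" using c by (simp add: conj_conj[symmetric] conj_mult)
  then show ?thesis using conj_fix[of "x \<otimes> y" "x' \<otimes> y'"] c by simp
qed

text \<open>For d n in \<open>W\<close> with n in \<open>N\<close> the factor d lies in
  \<open>W\<close> too, hence in Z(K). So K \<inter> W is the product of the abelian group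
  \<open>N\<close> with Z(K).\<close>

lemma abelian_KW: assumes "x \<in> K \<inter> W" "y \<in> K \<inter> W" shows "x \<otimes> y = y \<otimes> x"
proof -
  have dec: "\<exists>n\<in>N. \<exists>z\<in>cz K K. x = n \<otimes> z" if x: "x \<in> K \<inter> W" for x
  proof -
    obtain d n where dn: "d \<in> D" "n \<in> N" "x = d \<otimes> n" using x K_elim by blast
    have c: "d \<in> carrier G" "n \<in> carrier G" using dn DY Yc NW Wc by auto
    have "x \<otimes> inv n \<in> W" using x NW[OF dn(2)] Ws by (simp add: subgroup.m_closed subgroup.m_inv_closed)
    then have "d \<in> W" unfolding dn(3) using c by (simp add: m_assoc)
    then have dz: "d \<in> cz K K" using dn(1) DY DK by (auto simp: center_K)
    then have "x = n \<otimes> d" unfolding dn(3) using dn(2) NK by (auto simp: cz_def)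
    then show ?thesis using dn(2) dz by blast
  qed
  obtain n z where 1: "n \<in> N" "z \<in> cz K K" "x = n \<otimes> z" using dec[OF assms(1)] by blast
  obtain n' z' where 2: "n' \<in> N" "z' \<in> cz K K" "y = n' \<otimes> z'" using dec[OF assms(2)] by blast
  show ?thesis unfolding 1(3) 2(3)
  proof (rule abelian_product[of N "cz K K"])
    show "N \<subseteq> carrier G" "cz K K \<subseteq> carrier G" using NW Wc Kc by (auto simp: cz_def)
    show "x \<otimes> y = y \<otimes> x" if "x \<in> N" "y \<in> N" for x y using cz_W_W(2)[OF NZ NW] that by blast
    show "x \<otimes> y = y \<otimes> x" if "x \<in> cz K K" "y \<in> N \<union> cz K K" for x y
      using that NK by (auto simp: cz_def)
  qed (use 1 2 in auto)
qed

lemma abelian_KY: assumes "x \<in> K \<inter> Y" "y \<in> K \<inter> Y" shows "x \<otimes> y = y \<otimes> x"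
proof -
  have dec: "\<exists>d\<in>D. \<exists>z\<in>cz K K. x = d \<otimes> z" if x: "x \<in> K \<inter> Y" for x
  proof -
    obtain d n where dn: "d \<in> D" "n \<in> N" "x = d \<otimes> n" using x K_elim by blast
    have c: "d \<in> carrier G" "n \<in> carrier G" using dn DY Yc NW Wc by auto
    have "inv d \<otimes> x \<in> Y" using x DY[OF dn(1)] Ys by (simp add: subgroup.m_closed subgroup.m_inv_closed)
    then have "n \<in> Y" unfolding dn(3) using c by (simp add: inv_mult_cancel)
    then have "n \<in> cz K K" using dn(2) NW NK by (auto simp: center_K)
    then show ?thesis using dn by blast
  qed
  obtain n z where 1: "n \<in> D" "z \<in> cz K K" "x = n \<otimes> z" using dec[OF assms(1)] by blast
  obtain n' z' where 2: "n' \<in> D" "z' \<in> cz K K" "y = n' \<otimes> z'" using dec[OF assms(2)] by blast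
  show ?thesis unfolding 1(3) 2(3)
  proof (rule abelian_product[of D "cz K K"])
    show "D \<subseteq> carrier G" "cz K K \<subseteq> carrier G" using DY Yc Kc by (auto simp: cz_def)
    show "x \<otimes> y = y \<otimes> x" if "x \<in> D" "y \<in> D" for x y using cz_Y_Y(2)[OF DZ DY] that by blast
    show "x \<otimes> y = y \<otimes> x" if "x \<in> cz K K" "y \<in> D \<union> cz K K" for x y
      using that DK by (auto simp: cz_def)
  qed (use 1 2 in auto)
qed

text \<open>The conjugating element is a product of parts in \<open>L\<close> and \<open>K\<close>;
  the part in \<open>L\<close> normalises \<open>Y\<close>, since \<open>L\<close> lies in
  \<open>Y\<close>, and only the part in \<open>K\<close> remains.\<close>

lemma K_cover:
  assumes z: "z \<in> K" "z \<notin> W" shows "\<exists>k\<in>K. z \<in> cset (K \<inter> Y) k"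
proof -
  obtain h where h: "h \<in> V" "z \<in> cset Y h" using Y_cover z KV by blast
  then obtain y where y: "y \<in> Y" "z = y \<frown> h" by blast
  obtain k l where kl: "k \<in> K" "l \<in> L" "h = k \<otimes> l" by (rule V_elim[OF h(1)])
  have h': "h = l \<otimes> k" using kl K_L_commute by simp
  have yl: "y \<frown> l \<in> Y" by (rule conj_in_sub[OF Ys y(1) LY[OF kl(2)]])
  have zk: "z = y \<frown> l \<frown> k" unfolding y(2) h' using Yc[OF y(1)] Lc[OF kl(2)] Kc[OF kl(1)] by (simp add: conj_conj)
  then have "y \<frown> l = z \<frown> (inv k)" using Yc[OF yl] Kc[OF kl(1)] by simp
  also have "\<dots> \<in> K" by (rule conj_in_sub[OF Ks z(1)]) (use kl Ks in \<open>simp add: subgroup.m_inv_closed\<close>)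
  finally show ?thesis using zk yl kl(1) by blast
qed

text \<open>\<open>b\<close> was obtained as a power of the given element \<open>b\<^sub>0\<close>; the set \<open>\<pi>\<close> refers to the class of \<open>b\<^sub>0\<close>.\<close>

lemma primes_of_root_class:
  assumes b0: "b0 \<in> carrier G" "\<not> p dvd ord b0" "b \<in> generate G {b0}" and co0: "coprime (cl a) (cl b0)"
    and sep0: "\<And>z. \<lbrakk>z \<in> carrier G; \<not> p dvd ord z\<rbrakk> \<Longrightarrow> coprime (cl z) (cl a) \<or> coprime (cl z) (cl b0)"
    and r: "prime r"
  shows "r dvd cl b0 \<longleftrightarrow> r dvd cl b"
proof
  assume "r dvd cl b"
  moreover have "cl b dvd cl b0" by (rule orb_dvd[OF Gs b(1) b0(1) cz_generate_elem[OF b0(1,3)]])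
  ultimately show "r dvd cl b0" by (rule dvd_trans)
next
  assume r0: "r dvd cl b0"
  have b0V: "b0 \<in> V" using regular_iff_V b0 by blast
  have "b0 \<in> cz (carrier G) {b}" using cz_generate_elem[OF b0(1,3)] b0(1) by (auto simp: cz_def)
  then have b0Y: "b0 \<in> Y" using b0V by (simp add: Y_def cz_def)
  obtain k l where kl: "k \<in> K" "l \<in> L" "b0 = k \<otimes> l" by (rule V_elim[OF b0V])
  note kc = Kc[OF kl(1)] and lc = Lc[OF kl(2)]
  \<comment> \<open>Write b0 = k l along V = K L. The class size of a l is divisible by cl a, so
    separation makes it prime to cl b0; then cl l, which divides both, is 1 and \<open>l\<close> is
    central.\<close>
  have aK: "a \<in> K" using a M_N NK by blast
  have al: "cl a dvd cl (a \<otimes> l)" "cl l dvd cl (a \<otimes> l)"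
    using orb_coprime_dvd[OF Gs ac lc K_L_commute[OF aK kl(2)] coprime_ord_K_L[OF aK kl(2)]] by auto
  have "a \<otimes> l \<in> V" using aK KV kl(2) LY YV Vs by (auto intro: subgroup.m_closed)
  then have "coprime (cl (a \<otimes> l)) (cl a) \<or> coprime (cl (a \<otimes> l)) (cl b0)" using sep0[OF Vc reg_V] by blast
  moreover have "\<not> coprime (cl (a \<otimes> l)) (cl a)"
    using coprime_no_common[OF _ p _ pa] pa al(1) dvd_trans by blast
  ultimately have "coprime (cl (a \<otimes> l)) (cl b0)" by blast
  then have "coprime (cl l) (cl b0)" by (rule coprime_divisors[OF al(2) dvd_refl])
  moreover have "cl l dvd cl b0"
    unfolding kl(3) by (rule orb_coprime_dvd(2)[OF Gs kc lc K_L_commute[OF kl(1,2)] coprime_ord_K_L[OF kl(1,2)]])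
  ultimately have "cl l = 1" by (metis coprime_common_divisor_nat dvd_refl)
  then have lz: "g \<otimes> l = l \<otimes> g" if "g \<in> carrier G" for g
    using orb_one_iff[OF lc] conj_fix[OF lc that] that by simp
  have kY: "k \<in> Y"
  proof -
    have "b0 \<otimes> inv l \<in> Y" using b0Y LY[OF kl(2)] Ys by (simp add: subgroup.m_closed subgroup.m_inv_closed)
    then show ?thesis unfolding kl(3) using kc lc by (simp add: m_assoc)
  qed
  let ?C = "cz (carrier G) {b0}"
  have Cs: "subgroup ?C G" using b0(1) by (intro subgroup_cz Gs) auto
  \<comment> \<open>Up to the central factor \<open>l\<close>, b0 lies in the abelian group K
    \<inter> Y, which also commutes with \<open>L\<close>; so \<open>Y\<close> centralises b0.
    Comparing indices, cl b0 divides cl b times a power of \<open>p\<close>.\<close>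
  have "Y \<subseteq> ?C"
  proof
    fix y assume y: "y \<in> Y"
    note yc = Yc[OF y]
    obtain k' l' where kl': "k' \<in> K" "l' \<in> L" "y = k' \<otimes> l'" using V_elim y YV by blast
    note k'c = Kc[OF kl'(1)] and l'c = Lc[OF kl'(2)]
    have "y \<otimes> inv l' \<in> Y" using y LY[OF kl'(2)] Ys by (simp add: subgroup.m_closed subgroup.m_inv_closed)
    then have "k' \<in> Y" unfolding kl'(3) using k'c l'c by (simp add: m_assoc)
    then have "k' \<otimes> k = k \<otimes> k'" using abelian_KY kl kl' kY by blast
    then have "k \<frown> k' = k" "k \<frown> l' = k"
      using conj_fix[OF kc k'c] conj_fix[OF kc l'c] K_L_commute[OF kl(1) kl'(2)] by auto
    then have "k \<frown> y = k" unfolding kl'(3) using kc k'c l'c by (simp add: conj_conj[symmetric])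
    moreover have "l \<frown> y = l" using lz[OF yc] conj_fix[OF lc yc] by simp
    ultimately have "b0 \<frown> y = b0" unfolding kl(3) using kc lc yc by (simp add: conj_mult)
    then show "y \<in> ?C" using conj_fix[OF b0(1) yc] yc by (simp add: cz_def)
  qed
  then obtain m where m: "card ?C = card Y * m" by (rule subgroup_index[OF Cs Ys])
  obtain i where i: "card (carrier G) = card V * p ^ i"
    by (rule regular_index_power[OF Gs Vs subgroup.subset[OF Vs] p]) (use regular_iff_V in blast)
  have "card Y * (cl b * p ^ i) = card Y * (m * cl b0)"
    using i index_Y m orb_index[OF Gs b0(1)] by (metis mult.assoc)
  then have "cl b * p ^ i = m * cl b0" using card_sub_pos[OF Ys] by (metis mult_left_cancel not_gr_zero)
  then have "r dvd cl b * p ^ i" using r0 by simp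
  moreover have "r \<noteq> p" using coprime_no_common[OF co0 p pa] r0 by blast
  ultimately show "r dvd cl b" using r p by (metis prime_dvd_mult_iff prime_dvd_power primes_dvd_imp_eq)
qed

end

subsection \<open>Quasi-Frobenius groups\<close>

lemma (in finite_group) center_eq_cz: "center G = cz (carrier G) (carrier G)"
  by (auto simp: center_def centralizer_def cz_def)

lemma (in finite_group) normal_center: "normal_in (center G) (carrier G)"
  unfolding center_eq_cz by (rule normal_in_center[OF carrier_subgroup])

locale finite_group_center = finite_group
begin

definition Q where "Q = G Mod center G"

definition proj :: "'a \<Rightarrow> 'a set" where "proj x = center G #> x"

lemma normal_center_G: "center G \<lhd> G"
  using normal_center normal_in_iff by blast

lemma Zs: "subgroup (center G) G" by (rule normal_in_subgroup[OF normal_center])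

lemma Zc: "z \<in> center G \<Longrightarrow> z \<in> carrier G" by (rule sub_carrier[OF Zs])

lemma Z_commute: "z \<in> center G \<Longrightarrow> x \<in> carrier G \<Longrightarrow> z \<otimes> x = x \<otimes> z"
  by (simp add: center_eq_cz cz_def)

lemma Z_conj: "z \<in> center G \<Longrightarrow> x \<in> carrier G \<Longrightarrow> z \<frown> x = z"
  using Z_commute Zc conj_fix by simp

lemma Q_group: "group Q"
  unfolding Q_def by (rule normal.factorgroup_is_group[OF normal_center_G])

lemma Q_carrier: "carrier Q = proj ` carrier G"
  by (auto simp: Q_def proj_def carrier_FactGroup)

lemma Q_one: "\<one>\<^bsub>Q\<^esub> = center G"
  by (simp add: Q_def)

lemma proj_hom: "group_hom G Q proj"
  using normal.r_coset_hom_Mod[OF normal_center_G] group_axioms Q_group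
  by (simp add: group_hom_def group_hom_axioms_def Q_def proj_def[abs_def])

lemma proj_eq: "\<lbrakk>x \<in> carrier G; y \<in> carrier G\<rbrakk> \<Longrightarrow> proj x = proj y \<longleftrightarrow> (\<exists>z\<in>center G. x = z \<otimes> y)"
proof -
  assume xy: "x \<in> carrier G" "y \<in> carrier G"
  have "proj x = proj y \<longleftrightarrow> x \<in> center G #> y"
    using repr_independence[of x "center G" y] rcos_self[of x "center G"] Zs xy by (auto simp: proj_def)
  then show ?thesis by (auto simp: r_coset_def)
qed

lemma proj_one_iff: "x \<in> carrier G \<Longrightarrow> proj x = \<one>\<^bsub>Q\<^esub> \<longleftrightarrow> x \<in> center G"
  unfolding Q_one using coset_join1[of "center G" x] coset_join2[of x "center G"] Zs subgroup.subset[OF Zs]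
  by (auto simp: proj_def)

lemma proj_in_image:
  assumes "subgroup C G" "center G \<subseteq> C" "x \<in> carrier G" shows "proj x \<in> proj ` C \<longleftrightarrow> x \<in> C"
proof
  assume "proj x \<in> proj ` C"
  then obtain c where c: "c \<in> C" "proj x = proj c" by blast
  then obtain z where "z \<in> center G" "x = z \<otimes> c"
    using proj_eq[OF assms(3) sub_carrier[OF assms(1) c(1)]] by blast
  then show "x \<in> C" using c(1) assms by (auto intro: subgroup.m_closed)
qed blast

lemma proj_conj:
  "\<lbrakk>c \<in> carrier G; g \<in> carrier G\<rbrakk> \<Longrightarrow> inv\<^bsub>Q\<^esub> proj g \<otimes>\<^bsub>Q\<^esub> proj c \<otimes>\<^bsub>Q\<^esub> proj g = proj (c \<frown> g)"
proof -
  interpret h: group_hom G Q proj by (rule proj_hom)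
  show "\<lbrakk>c \<in> carrier G; g \<in> carrier G\<rbrakk> \<Longrightarrow> inv\<^bsub>Q\<^esub> proj g \<otimes>\<^bsub>Q\<^esub> proj c \<otimes>\<^bsub>Q\<^esub> proj g = proj (c \<frown> g)"
    by (simp add: conjugate_def)
qed

lemma proj_conj_set:
  "\<lbrakk>C \<subseteq> carrier G; g \<in> carrier G\<rbrakk> \<Longrightarrow> conj_set Q (proj ` C) (proj g) = proj ` cset C g"
  using proj_conj[of _ g] by (force simp: conj_set_def image_image subset_iff intro!: image_cong)

lemma center_preimage_eq: "center_preimage G S = {k \<in> carrier G. proj k \<in> S}"
  by (simp add: center_preimage_def proj_def)

text \<open>The trivial-intersection condition of the quotient is pulled back to elements of the
  group: if an element and its conjugate by \<open>g\<close> both lie in the preimage, then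
  \<open>g\<close> does or the element is central.\<close>

lemma frobenius_complementD:
  assumes S: "frobenius_complement Q S"
  defines "C \<equiv> center_preimage G S"
  shows "subgroup C G" "center G \<subseteq> C" "C \<noteq> center G" "C \<noteq> carrier G" "S = proj ` C"
    "\<lbrakk>c \<in> C; g \<in> carrier G; c \<frown> g \<in> C\<rbrakk> \<Longrightarrow> g \<in> C \<or> c \<in> center G"
proof -
  interpret h: group_hom G Q proj by (rule proj_hom)
  have Ss: "subgroup S Q" using S by (simp add: frobenius_complement_def)
  have Ciff: "k \<in> C \<longleftrightarrow> k \<in> carrier G \<and> proj k \<in> S" for k by (simp add: C_def center_preimage_eq)
  show Cs: "subgroup C G"
    by (rule finite_subgroupI) (use Ss in \<open>auto simp: Ciff subgroup.one_closed subgroup.m_closed\<close>)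
  show ZC: "center G \<subseteq> C"
  proof
    fix z assume z: "z \<in> center G"
    then have "proj z = \<one>\<^bsub>Q\<^esub>" using proj_one_iff[OF Zc[OF z]] by simp
    then show "z \<in> C" using subgroup.one_closed[OF Ss] Zc[OF z] by (simp add: Ciff)
  qed
  show SC: "S = proj ` C" using subgroup.subset[OF Ss] by (auto simp: Ciff Q_carrier)
  show "C \<noteq> carrier G" using S SC by (auto simp: frobenius_complement_def Q_carrier)
  show "C \<noteq> center G"
  proof
    assume "C = center G"
    then have "S \<subseteq> {\<one>\<^bsub>Q\<^esub>}" using SC proj_one_iff Zc by auto
    then have "S = {\<one>\<^bsub>Q\<^esub>}" using subgroup.one_closed[OF Ss] by blast
    then show False using S by (simp add: frobenius_complement_def)
  qed
  assume c: "c \<in> C" and g: "g \<in> carrier G" and cg: "c \<frown> g \<in> C"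
  note cc = sub_carrier[OF Cs c]
  show "g \<in> C \<or> c \<in> center G"
  proof (rule disjCI)
    assume "c \<notin> center G"
    show "g \<in> C"
    proof (rule ccontr)
      assume "g \<notin> C"
      then have "proj g \<in> carrier Q - S" using g by (auto simp: Ciff)
      then have "S \<inter> conj_set Q S (proj g) = {\<one>\<^bsub>Q\<^esub>}" using S by (auto simp: frobenius_complement_def)
      moreover have "proj (c \<frown> g) \<in> S" using cg by (simp add: Ciff)
      moreover have "proj (c \<frown> g) \<in> conj_set Q S (proj g)"
        unfolding SC proj_conj_set[OF subgroup.subset[OF Cs] g] using c by blast
      ultimately have "proj (c \<frown> g) = \<one>\<^bsub>Q\<^esub>" by blast
      then have "c \<frown> g \<in> center G" using proj_one_iff cc g by simp
      then have "c \<in> center G" using normal_in_conj_iff[OF normal_center carrier_subgroup cc g] by simp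
      then show False using \<open>c \<notin> center G\<close> by simp
    qed
  qed
qed

lemma frobenius_complementI:
  assumes B: "subgroup B G" "center G \<subseteq> B" "B \<noteq> center G" "B \<noteq> carrier G"
    and TI: "\<And>y g. \<lbrakk>y \<in> B; y \<notin> center G; g \<in> carrier G; y \<frown> g \<in> B\<rbrakk> \<Longrightarrow> g \<in> B"
  shows "frobenius_complement Q (proj ` B)"
proof -
  interpret h: group_hom G Q proj by (rule proj_hom)
  note Bc = sub_carrier[OF B(1)]
  have s: "subgroup (proj ` B) Q" by (rule h.subgroup_img_is_subgroup[OF B(1)])
  have "proj ` B \<noteq> {\<one>\<^bsub>Q\<^esub>}"
  proof
    assume 1: "proj ` B = {\<one>\<^bsub>Q\<^esub>}"
    have "y \<in> center G" if "y \<in> B" for y using 1 that proj_one_iff[OF Bc[OF that]] by blast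
    then show False using B(2,3) by blast
  qed
  moreover have "proj ` B \<noteq> carrier Q"
  proof
    assume "proj ` B = carrier Q"
    then have "x \<in> B" if "x \<in> carrier G" for x
      using proj_in_image[OF B(1,2) that] that by (auto simp: Q_carrier)
    then show False using B(4) Bc by blast
  qed
  moreover have "proj ` B \<inter> conj_set Q (proj ` B) g = {\<one>\<^bsub>Q\<^esub>}" if g: "g \<in> carrier Q - proj ` B" for g
  proof -
    obtain k where k: "k \<in> carrier G" "g = proj k" using g by (auto simp: Q_carrier)
    have kB: "k \<notin> B" using g k by blast
    have eq: "conj_set Q (proj ` B) g = proj ` cset B k"
      unfolding k(2) by (rule proj_conj_set[OF subgroup.subset[OF B(1)] k(1)])
    have "s = \<one>\<^bsub>Q\<^esub>" if s: "s \<in> proj ` B" "s \<in> proj ` cset B k" for s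
    proof -
      obtain y where y: "y \<in> B" "s = proj (y \<frown> k)" using s(2) by blast
      have ykc: "y \<frown> k \<in> carrier G" using Bc[OF y(1)] k(1) by simp
      have "y \<frown> k \<in> B" using s(1) y(2) proj_in_image[OF B(1,2) ykc] by simp
      then have "y \<in> center G" using TI y(1) k(1) kB by blast
      then have "y \<frown> k \<in> center G" using Z_conj k(1) by simp
      then show ?thesis using y(2) proj_one_iff[OF ykc] by simp
    qed
    moreover have "\<one>\<^bsub>Q\<^esub> \<in> proj ` B" by (rule subgroup.one_closed[OF s])
    moreover have "\<one>\<^bsub>Q\<^esub> \<in> proj ` cset B k"
    proof -
      have "\<one> \<frown> k \<in> cset B k" using subgroup.one_closed[OF B(1)] by blast
      then have "proj (\<one> \<frown> k) \<in> proj ` cset B k" by blast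
      then show ?thesis using k(1) h.hom_one by simp
    qed
    ultimately show ?thesis unfolding eq by blast
  qed
  ultimately show ?thesis using s by (simp add: frobenius_complement_def)
qed

text \<open>This is applied to the group \<open>K\<close> with A = K \<inter> W and B = K \<inter>
  Y. As kernels and complements of a quasi-Frobenius group may come from any Frobenius complement of
  the quotient, all of these are compared with \<open>B\<close>.\<close>

context
  fixes A B
  assumes A: "normal_in A (carrier G)" "\<And>x y. x \<in> A \<Longrightarrow> y \<in> A \<Longrightarrow> x \<otimes> y = y \<otimes> x"
    and B: "subgroup B G" "\<And>x y. x \<in> B \<Longrightarrow> y \<in> B \<Longrightarrow> x \<otimes> y = y \<otimes> x"
    and AB: "A \<inter> B = center G" and BZ: "B \<noteq> center G" and AZ: "A \<noteq> center G"
    and TI: "\<And>y g. \<lbrakk>y \<in> B; y \<notin> center G; g \<in> carrier G; y \<frown> g \<in> B\<rbrakk> \<Longrightarrow> g \<in> B"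
    and cover: "\<And>z. \<lbrakk>z \<in> carrier G; z \<notin> A\<rbrakk> \<Longrightarrow> \<exists>g\<in>carrier G. z \<in> cset B g"
begin

lemma quasi_frobenius_split: "quasi_frobenius G"
proof -
  have "B \<noteq> carrier G" using AB AZ subgroup.subset[OF normal_in_subgroup[OF A(1)]] by blast
  moreover have "center G \<subseteq> B" using AB by blast
  ultimately have "frobenius_complement Q (proj ` B)"
    using TI by (intro frobenius_complementI[OF B(1) _ BZ])
  then have "frobenius_group Q" using Q_group fin by (auto simp: frobenius_group_def Q_carrier)
  then show ?thesis using group_axioms by (simp add: quasi_frobenius_def Q_def)
qed

text \<open>A complement avoids \<open>A\<close> outside the centre, so it meets a conjugate of \<open>B\<close>, which it then
  contains because that conjugate is abelian; orders force equality.\<close>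

lemma quasi_frobenius_complement_conj:
  assumes S: "frobenius_complement Q S"
  shows "\<exists>g\<in>carrier G. center_preimage G S = cset B g"
proof -
  define C where "C = center_preimage G S"
  note Cf = frobenius_complementD[OF S, folded C_def]
  note As = normal_in_subgroup[OF A(1)] and Cc = sub_carrier[OF Cf(1)]
  note Ac = sub_carrier[OF As] and Bc = sub_carrier[OF B(1)]
  have CA: "C \<inter> A = center G"
  proof
    show "center G \<subseteq> C \<inter> A" using Cf(2) AB by blast
    \<comment> \<open>A noncentral n in the intersection is fixed by the abelian group
      \<open>A\<close>, which puts \<open>A\<close> into \<open>C\<close>. As \<open>A\<close> is
      normal, all conjugates of n then lie in \<open>C\<close>, which forces C = G.\<close>
    show "C \<inter> A \<subseteq> center G"
    proof (rule ccontr)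
      assume "\<not> C \<inter> A \<subseteq> center G"
      then obtain n where n: "n \<in> C" "n \<in> A" "n \<notin> center G" by blast
      have AC: "A \<subseteq> C"
      proof
        fix g assume g: "g \<in> A"
        have "n \<frown> g = n" using conj_fix[OF Ac[OF n(2)] Ac[OF g]] A(2)[OF g n(2)] by simp
        then show "g \<in> C" using Cf(6)[OF n(1) Ac[OF g]] n by simp
      qed
      obtain g where g: "g \<in> carrier G" "g \<notin> C" using Cf(4) Cc by blast
      have "n \<frown> g \<in> C" using normal_in_conj[OF A(1) n(2) g(1)] AC by blast
      then show False using Cf(6)[OF n(1) g(1)] g(2) n(3) by blast
    qed
  qed
  obtain s where s: "s \<in> C" "s \<notin> center G" using Cf(2,3) by blast
  then have "s \<notin> A" using CA by blast
  then obtain k where k: "k \<in> carrier G" "s \<in> cset B k" using cover Cc[OF s(1)] by blast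
  then obtain y where y: "y \<in> B" "s = y \<frown> k" by blast
  have sub: "cset B k \<subseteq> C"
  proof
    fix g assume "g \<in> cset B k"
    then obtain u where u: "u \<in> B" "g = u \<frown> k" by blast
    have gc: "g \<in> carrier G" using u Bc k(1) by simp
    have "s \<otimes> g = g \<otimes> s" using conj_commute_iff[OF Bc[OF y(1)] Bc[OF u(1)] k(1)] B(2)[OF y(1) u(1)] y u by simp
    then have "s \<frown> g = s" using conj_fix[OF Cc[OF s(1)] gc] by simp
    then show "g \<in> C" using Cf(6)[OF s(1) gc] s by simp
  qed
  have "card C \<le> card (cset B k)"
  proof -
    have "carrier G = B <#> A"
    proof (rule union_of_conjugates(1)[OF carrier_subgroup B(1) subgroup.subset[OF B(1)] A(1), symmetric])
      show "\<exists>h\<in>carrier G. z \<in> cset B h" if "z \<in> carrier G" "z \<notin> A" for z using cover[OF that] .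
    qed
    then have "card (carrier G) * card (center G) = card B * card A"
      using product_formula[OF B(1) As] AB by (simp add: Int_commute)
    moreover have "card (C <#> A) * card (center G) = card C * card A"
      using product_formula[OF Cf(1) As] CA by simp
    moreover have "card (C <#> A) \<le> card (carrier G)"
      using set_mult_sub[OF carrier_subgroup subgroup.subset[OF Cf(1)] subgroup.subset[OF As]] fin
      by (intro card_mono) auto
    ultimately have "card C * card A \<le> card B * card A" by (metis mult_le_mono1)
    then show ?thesis using card_sub_pos[OF As] card_cset[OF subgroup.subset[OF B(1)] k(1)] by simp
  qed
  then have "cset B k = C" using sub Cf(1) by (intro card_seteq) auto
  then show ?thesis using k(1) C_def by blast
qed

text \<open>The chosen complement is a conjugate of \<open>B\<close>, so the union of its conjugates
  is that of \<open>B\<close>. These conjugates cover everything outside \<open>A\<close> and meet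
  \<open>A\<close> in the centre.\<close>

lemma quasi_frobenius_kernel_eq: assumes "qf_kernel G N" shows "N = A"
proof -
  obtain S T where S: "frobenius_complement Q S"
    and T: "T = insert \<one>\<^bsub>Q\<^esub> (carrier Q - (\<Union>g\<in>carrier Q. conj_set Q S g))" "N = center_preimage G T"
    using assms by (auto simp: qf_kernel_def frobenius_kernel_def Q_def)
  obtain k where k: "k \<in> carrier G" "center_preimage G S = cset B k"
    using quasi_frobenius_complement_conj[OF S] by blast
  note Cf = frobenius_complementD[OF S, unfolded k(2)]
  note Ac = sub_carrier[OF normal_in_subgroup[OF A(1)]] and Bc = sub_carrier[OF B(1)]
  have Cc: "cset B k \<subseteq> carrier G" using Bc k(1) by auto
  have un: "proj x \<in> (\<Union>g\<in>carrier Q. conj_set Q S g) \<longleftrightarrow> (\<exists>g\<in>carrier G. x \<in> cset B g)"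
    if x: "x \<in> carrier G" for x
  proof
    assume "proj x \<in> (\<Union>g\<in>carrier Q. conj_set Q S g)"
    then obtain g where g: "g \<in> carrier G" "proj x \<in> conj_set Q S (proj g)" by (auto simp: Q_carrier)
    then have "proj x \<in> proj ` cset (cset B k) g" using proj_conj_set[OF Cc g(1)] Cf(5) by simp
    moreover have "subgroup (cset (cset B k) g) G" by (rule subgroup_cset[OF Cf(1) g(1)])
    moreover have "center G \<subseteq> cset (cset B k) g"
    proof
      fix z assume z: "z \<in> center G"
      then have "z = z \<frown> g" using Z_conj g(1) by simp
      then show "z \<in> cset (cset B k) g" using Cf(2) z by blast
    qed
    ultimately have "x \<in> cset (cset B k) g" using proj_in_image x by blast
    then have "x \<in> cset B (k \<otimes> g)" using cset_cset[OF subgroup.subset[OF B(1)] k(1) g(1)] by simp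
    then show "\<exists>g\<in>carrier G. x \<in> cset B g" using k(1) g(1) by blast
  next
    assume "\<exists>g\<in>carrier G. x \<in> cset B g"
    then obtain g where g: "g \<in> carrier G" "x \<in> cset B g" by blast
    let ?h = "inv k \<otimes> g"
    have h: "?h \<in> carrier G" using k(1) g(1) by simp
    have "cset (cset B k) ?h = cset B g"
      using cset_cset[OF subgroup.subset[OF B(1)] k(1) h] k(1) g(1) by (simp add: inv_mult_cancel)
    then have "conj_set Q S (proj ?h) = proj ` cset B g" using proj_conj_set[OF Cc h] Cf(5) by simp
    then have "proj x \<in> conj_set Q S (proj ?h)" using g(2) by simp
    then show "proj x \<in> (\<Union>g\<in>carrier Q. conj_set Q S g)" using h by (auto simp: Q_carrier)
  qed
  have "x \<in> N \<longleftrightarrow> x \<in> carrier G \<and> (x \<in> center G \<or> \<not> (\<exists>g\<in>carrier G. x \<in> cset B g))" for x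
    using un[of x] proj_one_iff[of x] by (auto simp: T center_preimage_eq Q_carrier)
  moreover have "x \<in> carrier G \<and> (x \<in> center G \<or> \<not> (\<exists>g\<in>carrier G. x \<in> cset B g)) \<longleftrightarrow> x \<in> A" for x
  proof
    assume "x \<in> carrier G \<and> (x \<in> center G \<or> \<not> (\<exists>g\<in>carrier G. x \<in> cset B g))"
    then show "x \<in> A" using AB cover by blast
  next
    assume x: "x \<in> A"
    have "x \<in> center G" if g: "g \<in> carrier G" "x \<in> cset B g" for g
    proof -
      obtain y where y: "y \<in> B" "x = y \<frown> g" using g by blast
      then have "y \<in> A" using normal_in_conj_iff[OF A(1) carrier_subgroup Bc[OF y(1)] g(1)] x by simp
      then have "y \<in> center G" using y(1) AB by blast
      then show ?thesis using y(2) Z_conj g(1) by simp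
    qed
    then show "x \<in> carrier G \<and> (x \<in> center G \<or> \<not> (\<exists>g\<in>carrier G. x \<in> cset B g))" using Ac[OF x] by blast
  qed
  ultimately show ?thesis by blast
qed

end

end

subsection \<open>Transfer to subgroups as groups\<close>

context finite_group
begin

lemma finite_group_sub: "subgroup H G \<Longrightarrow> finite_group (G\<lparr>carrier := H\<rparr>)"
  by (simp add: finite_group_def finite_group_axioms_def subgroup_imp_group)

lemma conj_sub: "\<lbrakk>subgroup H G; x \<in> H; g \<in> H\<rbrakk> \<Longrightarrow> finite_group.conjugate (G\<lparr>carrier := H\<rparr>) x g = x \<frown> g"
  by (simp add: finite_group.conjugate_def[OF finite_group_sub] conjugate_def m_inv_consistent)

lemma center_sub: "center (G\<lparr>carrier := H\<rparr>) = cz H H"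
  by (auto simp: center_def centralizer_def cz_def)

lemma normal_in_sub_iff:
  assumes H: "subgroup H G" and N: "normal_in N H"
  shows "finite_group.normal_in (G\<lparr>carrier := H\<rparr>) N H" "N \<lhd> G\<lparr>carrier := H\<rparr>"
proof -
  interpret S: finite_group "G\<lparr>carrier := H\<rparr>" by (rule finite_group_sub[OF H])
  have "subgroup N (G\<lparr>carrier := H\<rparr>)"
    by (rule subgroup_incl[OF normal_in_subgroup[OF N] H normal_in_subset[OF N]])
  then show "S.normal_in N H"
    using normal_in_subset[OF N] normal_in_conj[OF N] conj_sub[OF H] by (auto simp: S.normal_in_def subset_iff)
  then show "N \<lhd> G\<lparr>carrier := H\<rparr>" using S.normal_in_iff by simp
qed

lemma comm_group_sub:
  assumes H: "subgroup H G" "\<And>x y. x \<in> H \<Longrightarrow> y \<in> H \<Longrightarrow> x \<otimes> y = y \<otimes> x"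
  shows "comm_group (G\<lparr>carrier := H\<rparr>)"
  by (rule group.group_comm_groupI[OF subgroup_imp_group[OF H(1)]]) (use H(2) in auto)

end

section \<open>Structure of the p-complements\<close>

context isolated_pair
begin

lemma frobenius_structure:
  shows "quasi_frobenius (G\<lparr>carrier := K\<rparr>)"
    and "qf_kernel (G\<lparr>carrier := K\<rparr>) A \<Longrightarrow> A = K \<inter> W"
    and "qf_complement (G\<lparr>carrier := K\<rparr>) C \<Longrightarrow> \<exists>k\<in>K. C = cset (K \<inter> Y) k"
proof -
  interpret S: finite_group "G\<lparr>carrier := K\<rparr>" by (rule finite_group_sub[OF Ks])
  interpret S: finite_group_center "G\<lparr>carrier := K\<rparr>" by unfold_locales
  let ?A = "K \<inter> W" and ?B = "K \<inter> Y"
  have cen: "center (G\<lparr>carrier := K\<rparr>) = K \<inter> Y \<inter> W" by (simp add: center_sub center_K)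
  have cs: "S.conjugate x g = x \<frown> g" if "x \<in> K" "g \<in> K" for x g by (rule conj_sub[OF Ks that])
  have scs: "S.cset ?B g = cset ?B g" if "g \<in> K" for g
    using cs that by (intro image_cong) auto
  have "normal_in ?A K"
    using normal_in_mono[OF nW, of "K \<inter> W"] Kc subgroup_inter[OF Ks Ws] normal_in_conj[OF nW] conj_in_sub[OF Ks]
    by (auto simp: normal_in_def)
  then have 1: "S.normal_in ?A (carrier (G\<lparr>carrier := K\<rparr>))" using normal_in_sub_iff(1)[OF Ks] by simp
  have 2: "x \<otimes>\<^bsub>G\<lparr>carrier := K\<rparr>\<^esub> y = y \<otimes>\<^bsub>G\<lparr>carrier := K\<rparr>\<^esub> x" if "x \<in> ?A" "y \<in> ?A" for x y
    using abelian_KW[OF that] by simp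
  have 3: "subgroup ?B (G\<lparr>carrier := K\<rparr>)"
    by (rule subgroup_incl[OF subgroup_inter[OF Ks Ys] Ks]) auto
  have 4: "x \<otimes>\<^bsub>G\<lparr>carrier := K\<rparr>\<^esub> y = y \<otimes>\<^bsub>G\<lparr>carrier := K\<rparr>\<^esub> x" if "x \<in> ?B" "y \<in> ?B" for x y
    using abelian_KY[OF that] by simp
  have 5: "?A \<inter> ?B = center (G\<lparr>carrier := K\<rparr>)" unfolding cen by blast
  have 6: "?B \<noteq> center (G\<lparr>carrier := K\<rparr>)" unfolding cen using b_D DK b_Y b_notin_W by blast
  have aW: "a \<in> K" "a \<in> W" using a M_N NK MW by auto
  have a1: "a \<noteq> \<one>" using cl_a_neq1 orb_one_iff[of \<one>] by auto
  have 7: "?A \<noteq> center (G\<lparr>carrier := K\<rparr>)" unfolding cen using Y_inter_M[OF _ a] a1 aW by blast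
  have 8: "g \<in> ?B" if "y \<in> ?B" "y \<notin> center (G\<lparr>carrier := K\<rparr>)" "g \<in> carrier (G\<lparr>carrier := K\<rparr>)" "S.conjugate y g \<in> ?B" for y g
    using that Y_TI[of g y] KV cs[of y g] unfolding cen by auto
  have 9: "\<exists>g\<in>carrier (G\<lparr>carrier := K\<rparr>). z \<in> S.cset ?B g" if "z \<in> carrier (G\<lparr>carrier := K\<rparr>)" "z \<notin> ?A" for z
    using K_cover[of z] that scs by auto
  show "quasi_frobenius (G\<lparr>carrier := K\<rparr>)"
    by (rule S.quasi_frobenius_split[OF 1 2 3 4 5 6 7 8 9])
  show "A = K \<inter> W" if "qf_kernel (G\<lparr>carrier := K\<rparr>) A"
    by (rule S.quasi_frobenius_kernel_eq[OF 1 2 3 4 5 6 7 8 9 that])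
  assume "qf_complement (G\<lparr>carrier := K\<rparr>) C"
  then obtain T where T: "frobenius_complement S.Q T" "C = center_preimage (G\<lparr>carrier := K\<rparr>) T"
    by (auto simp: qf_complement_def S.Q_def)
  have "\<exists>g\<in>carrier (G\<lparr>carrier := K\<rparr>). center_preimage (G\<lparr>carrier := K\<rparr>) T = S.cset ?B g"
    by (rule S.quasi_frobenius_complement_conj[OF 1 2 3 4 5 6 7 8 9 T(1)])
  then obtain g where "g \<in> K" "C = S.cset ?B g" using T(2) by auto
  then show "\<exists>k\<in>K. C = cset (K \<inter> Y) k" using scs by blast
qed

text \<open>Elements of a normal sigma-subgroup have sigma-order, so \<open>pi_elements\<close>
  confines it to \<open>K\<close> or \<open>L\<close>, which themselves qualify.\<close>

lemma pi_cores:
  assumes \<pi>: "\<And>r. prime r \<Longrightarrow> r \<in> \<pi> \<longleftrightarrow> r dvd cl a * cl b"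
  shows "pi_core \<pi> (G\<lparr>carrier := V\<rparr>) = K" "pi_core (compl_primes \<pi>) (G\<lparr>carrier := V\<rparr>) = L"
proof -
  interpret S: finite_group "G\<lparr>carrier := V\<rparr>" by (rule finite_group_sub[OF Vs])
  have el: "x \<in> V \<and> (\<forall>r. prime r \<longrightarrow> r dvd ord x \<longrightarrow> r \<in> \<sigma>)"
    if A: "normal_pi_subgroup \<sigma> (G\<lparr>carrier := V\<rparr>) A" and x: "x \<in> A" for \<sigma> A x
  proof -
    have As: "subgroup A (G\<lparr>carrier := V\<rparr>)"
      using A normal_imp_subgroup by (auto simp: normal_pi_subgroup_def)
    have "A \<subseteq> V" using subgroup.subset[OF As] by simp
    moreover have "ord x dvd card A" by (rule ord_dvd_sub[OF incl_subgroup[OF Vs As] x])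
    ultimately show ?thesis
      using A x dvd_trans by (auto simp: normal_pi_subgroup_def pi_group_def order_def)
  qed
  have K: "normal_pi_subgroup \<pi> (G\<lparr>carrier := V\<rparr>) K"
    using normal_in_sub_iff(2)[OF Vs nKV] card_K \<pi> by (auto simp: normal_pi_subgroup_def pi_group_def order_def)
  have L: "normal_pi_subgroup (compl_primes \<pi>) (G\<lparr>carrier := V\<rparr>) L"
    using normal_in_sub_iff(2)[OF Vs nLV] card_L \<pi>
    by (auto simp: normal_pi_subgroup_def pi_group_def order_def compl_primes_def)
  note * = S.pi_core_largest[OF S.fin]
  show "pi_core \<pi> (G\<lparr>carrier := V\<rparr>) = K"
  proof
    show "K \<subseteq> pi_core \<pi> (G\<lparr>carrier := V\<rparr>)" by (rule *(2)[OF K])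
    show "pi_core \<pi> (G\<lparr>carrier := V\<rparr>) \<subseteq> K" using el[OF *(1)] pi_elements(1) \<pi> by blast
  qed
  show "pi_core (compl_primes \<pi>) (G\<lparr>carrier := V\<rparr>) = L"
  proof
    show "L \<subseteq> pi_core (compl_primes \<pi>) (G\<lparr>carrier := V\<rparr>)" by (rule *(2)[OF L])
    show "pi_core (compl_primes \<pi>) (G\<lparr>carrier := V\<rparr>) \<subseteq> L"
      using el[OF *(1), of _ "compl_primes \<pi>"] pi_elements(2) \<pi> by (auto simp: compl_primes_def)
  qed
qed

lemma sylow_p_centralizes_Y:
  obtains P where "sylow_in p (carrier G) P" "P \<subseteq> cz (carrier G) Y"
proof -
  obtain P where P: "sylow_in p (carrier G) P" "P \<subseteq> cz (carrier G) {b}"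
    by (rule sylow_centralizing_b[OF p pa])
  have "P \<subseteq> cz (carrier G) Y"
    using Y_central[OF p pa P] sub_carrier[OF sylow_subgroup[OF P(1)]] by (auto simp: cz_def)
  then show thesis by (rule that[OF P(1)])
qed

text \<open>A central element of \<open>V\<close> commutes with \<open>b\<close>, hence lies in
  \<open>Y\<close> and is centralised by a Sylow p-subgroup P, while G = P V.\<close>

lemma center_V: "center (G\<lparr>carrier := V\<rparr>) = V \<inter> center G"
proof
  show "V \<inter> center G \<subseteq> center (G\<lparr>carrier := V\<rparr>)"
    unfolding center_sub center_eq_cz using Vc by (auto simp: cz_def)
  show "center (G\<lparr>carrier := V\<rparr>) \<subseteq> V \<inter> center G"
  proof
    fix x assume "x \<in> center (G\<lparr>carrier := V\<rparr>)"
    then have x: "x \<in> V" "\<And>v. v \<in> V \<Longrightarrow> x \<otimes> v = v \<otimes> x" by (auto simp: center_sub cz_def)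
    note xc = Vc[OF x(1)]
    have xY: "x \<in> Y" using x b_V by (simp add: Y_def cz_def)
    obtain P where P: "sylow_in p (carrier G) P" "P \<subseteq> cz (carrier G) Y"
      by (rule sylow_p_centralizes_Y)
    have "x \<otimes> g = g \<otimes> x" if g: "g \<in> carrier G" for g
    proof -
      have "g \<in> P <#> V" using P_times_V[OF P(1)] g by simp
      then obtain u v where uv: "u \<in> P" "v \<in> V" "g = u \<otimes> v" unfolding set_mult_iff by blast
      have uc: "u \<in> carrier G" using sub_carrier[OF sylow_subgroup[OF P(1)] uv(1)] .
      have "x \<frown> u = x" "x \<frown> v = x"
        using conj_fix[OF xc uc] subsetD[OF P(2) uv(1)] xY conj_fix[OF xc Vc[OF uv(2)]] x(2)[OF uv(2)] by (auto simp: cz_def)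
      then have "x \<frown> g = x" unfolding uv(3) using xc uc Vc[OF uv(2)] by (simp add: conj_conj[symmetric])
      then show ?thesis using conj_fix[OF xc g] by simp
    qed
    then show "x \<in> V \<inter> center G" using x(1) xc by (simp add: center_eq_cz cz_def)
  qed
qed

text \<open>The elements of a p-complement are p-regular, hence in \<open>V\<close>; its index has
  no prime but \<open>p\<close>, so it cannot be proper in \<open>V\<close>.\<close>

lemma p_complement_iff: "p_complement p G H \<longleftrightarrow> H = V"
proof
  obtain i where i: "card (carrier G) = card V * p ^ i"
    by (rule regular_index_power[OF Gs Vs subgroup.subset[OF Vs] p]) (use regular_iff_V in blast)
  have idx: "card (rcosets H) * card H = card (carrier G)" if "subgroup H G" for H
    using lagrange[OF that] by (simp add: order_def)
  {
    assume H: "p_complement p G H"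
    then have Hs: "subgroup H G" and Hp: "\<not> p dvd card H"
      and Hi: "\<And>r. prime r \<Longrightarrow> r dvd card (rcosets H) \<Longrightarrow> r = p"
      using p by (auto simp: p_complement_def hall_subgroup_def pi_group_def order_def compl_primes_def)
    have HV: "H \<subseteq> V"
    proof
      fix x assume x: "x \<in> H"
      then have "\<not> p dvd ord x" using ord_dvd_sub[OF Hs x] Hp dvd_trans by blast
      then show "x \<in> V" using regular_iff_V sub_carrier[OF Hs x] by blast
    qed
    obtain n where n: "card V = card H * n" by (rule subgroup_index[OF Vs Hs HV])
    have "n = 1"
    proof (rule ccontr)
      assume "n \<noteq> 1"
      then obtain r where r: "prime r" "r dvd n" using prime_factor_nat by blast
      have "card H * card (rcosets H) = card H * (n * p ^ i)" using idx[OF Hs] i n by (simp add: mult_ac)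
      then have "card (rcosets H) = n * p ^ i" using card_sub_pos[OF Hs] by (metis mult_left_cancel not_gr_zero)
      then have "r = p" using Hi[OF r(1)] r(2) by simp
      then show False using n r(2) V(2) by simp
    qed
    then show "H = V" using n HV Vs by (intro card_seteq) auto
  }
  assume "H = V"
  have "card V * card (rcosets V) = card V * p ^ i" using idx[OF Vs] i by (simp add: mult_ac)
  then have "card (rcosets V) = p ^ i" using card_sub_pos[OF Vs] by (metis mult_left_cancel not_gr_zero)
  then have "r = p" if "prime r" "r dvd card (rcosets V)" for r
    using that p by (metis prime_dvd_power primes_dvd_imp_eq)
  then show "p_complement p G H"
    using \<open>H = V\<close> Vs V(2)
    by (auto simp: p_complement_def hall_subgroup_def pi_group_def order_def compl_primes_def)
qed

lemma conclusion:
  assumes \<pi>: "\<And>r. prime r \<Longrightarrow> r \<in> \<pi> \<longleftrightarrow> r dvd cl a * cl b"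
  shows "p_nilpotent p G \<and>
    (\<forall>H. p_complement p G H \<longrightarrow>
      (let K = pi_core \<pi> (G\<lparr>carrier := H\<rparr>);
           L = pi_core (compl_primes \<pi>) (G\<lparr>carrier := H\<rparr>)
       in internal_direct_product (G\<lparr>carrier := H\<rparr>) K L \<and>
          quasi_frobenius (G\<lparr>carrier := K\<rparr>) \<and>
          (\<forall>N. qf_kernel (G\<lparr>carrier := K\<rparr>) N \<longrightarrow> comm_group (G\<lparr>carrier := N\<rparr>)) \<and>
          (\<forall>C. qf_complement (G\<lparr>carrier := K\<rparr>) C \<longrightarrow> comm_group (G\<lparr>carrier := C\<rparr>)) \<and>
          (\<forall>C. qf_complement (G\<lparr>carrier := K\<rparr>) C \<longrightarrow>
             (\<exists>P. sylow_subgroup p G P \<and> P \<subseteq> centralizer G C)) \<and>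
          center (G\<lparr>carrier := H\<rparr>) = H \<inter> center G))"
proof -
  have nil: "p_nilpotent p G"
    unfolding p_nilpotent_def using p_complement_iff V(1) normal_in_iff by blast
  have dp: "internal_direct_product (G\<lparr>carrier := V\<rparr>) K L"
    using normal_in_sub_iff(2)[OF Vs nKV] normal_in_sub_iff(2)[OF Vs nLV] K_inter_L K_L_V
    by (simp add: internal_direct_product_def)
  have KYs: "subgroup (K \<inter> Y) G" by (rule subgroup_inter[OF Ks Ys])
  have comp: "comm_group (G\<lparr>carrier := C\<rparr>) \<and> (\<exists>P. sylow_subgroup p G P \<and> P \<subseteq> centralizer G C)"
    if C: "qf_complement (G\<lparr>carrier := K\<rparr>) C" for C
  proof -
    obtain k where k: "k \<in> K" "C = cset (K \<inter> Y) k" using frobenius_structure(3)[OF C] by blast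
    note kc = Kc[OF k(1)]
    have "x \<otimes> y = y \<otimes> x" if xy: "x \<in> C" "y \<in> C" for x y
    proof -
      have "x \<in> cset (K \<inter> Y) k" "y \<in> cset (K \<inter> Y) k" using xy k(2) by simp_all
      then obtain u v where uv: "u \<in> K \<inter> Y" "v \<in> K \<inter> Y" "x = u \<frown> k" "y = v \<frown> k" by blast
      then show ?thesis using conj_commute_iff[OF _ _ kc] abelian_KY[OF uv(1,2)] Kc by simp
    qed
    then have 1: "comm_group (G\<lparr>carrier := C\<rparr>)"
      using comm_group_sub subgroup_cset[OF KYs kc] k(2) by blast
    obtain P where P: "sylow_in p (carrier G) P" "P \<subseteq> cz (carrier G) Y"
      by (rule sylow_p_centralizes_Y)
    have P': "sylow_in p (carrier G) (cset P k)" by (rule sylow_cset[OF P(1) Gs kc])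
    have "sylow_subgroup p G (cset P k)"
      using sylow_subgroup[OF P'] sylow_card[OF P'] by (simp add: sylow_subgroup_def order_def)
    moreover have "cset P k \<subseteq> centralizer G C"
    proof
      fix x assume "x \<in> cset P k"
      then obtain u where u: "u \<in> P" "x = u \<frown> k" by blast
      have uc: "u \<in> carrier G" using sub_carrier[OF sylow_subgroup[OF P(1)] u(1)] .
      have "x \<otimes> c = c \<otimes> x" if c: "c \<in> C" for c
      proof -
        have "c \<in> cset (K \<inter> Y) k" using c k(2) by simp
        then obtain v where v: "v \<in> K \<inter> Y" "c = v \<frown> k" by blast
        then have "v \<in> carrier G" using Kc by blast
        then show ?thesis using conj_commute_iff[OF uc _ kc] subsetD[OF P(2) u(1)] u(2) v by (auto simp: cz_def)
      qed
      then show "x \<in> centralizer G C" using uc u(2) kc by (simp add: centralizer_def)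
    qed
    ultimately show ?thesis using 1 by blast
  qed
  have ker: "comm_group (G\<lparr>carrier := A\<rparr>)" if "qf_kernel (G\<lparr>carrier := K\<rparr>) A" for A
    unfolding frobenius_structure(2)[OF that]
    by (rule comm_group_sub[OF subgroup_inter[OF Ks Ws] abelian_KW])
  show ?thesis
    unfolding Let_def p_complement_iff
    using nil dp frobenius_structure(1) comp ker center_V pi_cores[OF \<pi>] by simp
qed

end

subsection \<open>The common divisor graph\<close>

context finite_group
begin

text \<open>Distance 3 excludes walks of length 0, 1 and 2. The first two would come from sizes with
  a common factor, the last from a p-regular class sharing factors with both.\<close>

lemma graph_dist_three:
  assumes p: "prime p"
    and x: "x \<in> carrier G" "conj_class G x \<in> p_regular_classes p G" "x \<notin> center G"
    and y: "y \<in> carrier G" "conj_class G y \<in> p_regular_classes p G" "y \<notin> center G"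
    and d: "graph_dist (common_divisor_graph p G) (conj_class G x) (conj_class G y) = 3"
  shows "coprime (cl x) (cl y)"
    "\<lbrakk>z \<in> carrier G; \<not> p dvd ord z\<rbrakk> \<Longrightarrow> coprime (cl z) (cl x) \<or> coprime (cl z) (cl y)"
proof -
  let ?\<Gamma> = "common_divisor_graph p G"
  interpret \<Gamma>: pair_graph ?\<Gamma> by (rule pair_graph_common_divisor_graph[OF fin])
  let ?B = "orb (carrier G) x" and ?C = "orb (carrier G) y"
  have vert: "D \<in> pverts ?\<Gamma> \<longleftrightarrow> (\<exists>z. D = orb (carrier G) z \<and> z \<in> carrier G \<and> z \<notin> center G \<and>
      orb (carrier G) z \<in> p_regular_classes p G)" for D
    by (auto simp: common_divisor_graph_def Let_def conj_class_eq_orb)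
  have arc: "(D, E) \<in> parcs ?\<Gamma> \<longleftrightarrow> D \<in> pverts ?\<Gamma> \<and> E \<in> pverts ?\<Gamma> \<and> D \<noteq> E \<and> \<not> coprime (card D) (card E)" for D E
  proof -
    \<comment> \<open>The conditions gcd > 1 and gcd not equal to 1 differ only at 0, which is ruled
      out since classes are nonempty.\<close>
    have "gcd (card D) (card E) > 1 \<longleftrightarrow> \<not> coprime (card D) (card E)" if "D \<in> pverts ?\<Gamma>"
    proof -
      have "card D > 0" using that orb_pos[OF carrier_subgroup] by (auto simp: vert)
      then have "gcd (card D) (card E) \<noteq> 0" by simp
      moreover have "1 < g \<longleftrightarrow> g \<noteq> 1" if "g \<noteq> 0" for g :: nat using that by auto
      ultimately show ?thesis by (simp only: coprime_iff_gcd_eq_1)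
    qed
    then show ?thesis by (auto simp: common_divisor_graph_def Let_def)
  qed
  have BV: "?B \<in> pverts ?\<Gamma>" and CV: "?C \<in> pverts ?\<Gamma>"
    using x y by (auto simp: vert conj_class_eq_orb)
  have walk: "3 \<le> length es" if "\<Gamma>.awalk ?B es ?C" for es
  proof -
    have "\<Gamma>.\<mu> (\<lambda>_. 1) ?B ?C \<le> \<Gamma>.awalk_cost (\<lambda>_. 1) es" by (rule \<Gamma>.min_cost_le_walk_cost[OF that])
    moreover have "\<Gamma>.\<mu> (\<lambda>_. 1) ?B ?C = 3" using d by (simp add: graph_dist_def conj_class_eq_orb)
    moreover have "\<Gamma>.awalk_cost (\<lambda>_. 1) es = real (length es)"
      by (simp add: \<Gamma>.awalk_cost_def sum_list_triv)
    ultimately have "ereal 3 \<le> ereal (real (length es))" by simp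
    then show ?thesis by simp
  qed
  show co: "coprime (cl x) (cl y)"
  proof (rule ccontr)
    assume nc: "\<not> coprime (cl x) (cl y)"
    show False
    proof (cases "?B = ?C")
      case True
      then have "\<Gamma>.awalk ?B [] ?C" using BV by (simp add: \<Gamma>.awalk_def)
      from walk[OF this] show False by simp
    next
      case False
      then have "(?B, ?C) \<in> parcs ?\<Gamma>" using BV CV nc by (simp add: arc)
      then have "\<Gamma>.awalk ?B [(?B, ?C)] ?C" using BV by (simp add: \<Gamma>.awalk_def)
      from walk[OF this] show False by simp
    qed
  qed
  assume z: "z \<in> carrier G" "\<not> p dvd ord z"
  let ?D = "orb (carrier G) z"
  show "coprime (cl z) (cl x) \<or> coprime (cl z) (cl y)"
  proof (rule ccontr)
    assume "\<not> ?thesis"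
    then have nx: "\<not> coprime (cl z) (cl x)" and ny: "\<not> coprime (cl z) (cl y)" by auto
    have "z \<notin> center G"
    proof
      assume "z \<in> center G"
      then have "cl z = 1" using orb_one_iff[OF z(1)] conj_fix[OF z(1)] by (auto simp: center_eq_cz cz_def)
      then show False using nx by simp
    qed
    moreover have "?D \<in> p_regular_classes p G"
      using z by (auto simp: p_regular_classes_def p_regular_def conj_class_eq_orb)
    ultimately have DV: "?D \<in> pverts ?\<Gamma>" using z by (auto simp: vert)
    have "?B \<noteq> ?D" "?D \<noteq> ?C" using co nx ny by (auto simp: coprime_commute)
    then have "(?B, ?D) \<in> parcs ?\<Gamma>" "(?D, ?C) \<in> parcs ?\<Gamma>"
      using BV CV DV nx ny by (auto simp: arc coprime_commute)
    then have "\<Gamma>.awalk ?B [(?B, ?D), (?D, ?C)] ?C" using BV by (simp add: \<Gamma>.awalk_def)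
    from walk[OF this] show False by simp
  qed
qed

lemma regular_of_class:
  assumes x: "x \<in> carrier G" "conj_class G x \<in> p_regular_classes p G" shows "\<not> p dvd ord x"
proof -
  obtain z where z: "z \<in> carrier G" "\<not> p dvd ord z" "orb (carrier G) x = orb (carrier G) z"
    using x(2) by (auto simp: p_regular_classes_def p_regular_def conj_class_eq_orb)
  then have "x \<in> orb (carrier G) z" using orb_self[OF carrier_subgroup x(1)] by simp
  then have "ord x = ord z" using z(1) by (auto simp: orb_def)
  then show ?thesis using z(2) by simp
qed

lemma class_primes_eq: "class_primes G x = prime_factors (cl x)"
  by (simp add: class_primes_def conj_class_eq_orb)

lemma p_separable_core:
  assumes p: "prime p" and sep: "p_separable p G"
  defines "V \<equiv> pi_core (compl_primes {p}) G"
  shows "normal_in V (carrier G)" "\<not> p dvd card V"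
    "\<lbrakk>z \<in> carrier G; \<not> p dvd ord z; \<not> p dvd cl z\<rbrakk> \<Longrightarrow> z \<in> V"
proof -
  have npi: "normal_pi_subgroup (compl_primes {p}) G N \<longleftrightarrow> normal_in N (carrier G) \<and> \<not> p dvd card N" for N
    using p by (auto simp: normal_pi_subgroup_def normal_in_iff pi_group_def order_def compl_primes_def)
  note * = pi_core_largest[OF fin, of "compl_primes {p}", folded V_def, unfolded npi]
  show V: "normal_in V (carrier G)" "\<not> p dvd card V" using *(1) by auto
  obtain r N where N: "N 0 = {\<one>}" "N (r::nat) = carrier G" "\<forall>i\<le>r. N i \<lhd> G"
    "\<forall>i<r. N i \<subseteq> N (Suc i) \<and> (p_group p (G\<lparr>carrier := N (Suc i)\<rparr> Mod N i) \<or>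
            p'_group p (G\<lparr>carrier := N (Suc i)\<rparr> Mod N i))"
    using sep unfolding p_separable_def by blast
  have nN: "normal_in (N i) (carrier G)" if "i \<le> r" for i using N(3) that normal_in_iff by blast
  \<comment> \<open>Lagrange turns the type of each factor group into a statement about an
    index.\<close>
  have fac: "\<exists>n. card (N (Suc i)) = card (N i) * n \<and> ((\<exists>k. n = p ^ k) \<or> \<not> p dvd n)" if i: "i < r" for i
  proof -
    note s = normal_in_subgroup[OF nN, of i] normal_in_subgroup[OF nN, of "Suc i"]
    have Ns: "subgroup (N i) G" "subgroup (N (Suc i)) G" using s i by auto
    interpret S: group "G\<lparr>carrier := N (Suc i)\<rparr>" by (rule subgroup_imp_group[OF Ns(2)])
    have "subgroup (N i) (G\<lparr>carrier := N (Suc i)\<rparr>)"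
      using subgroup_incl[OF Ns] N(4) i by blast
    from S.lagrange[OF this]
    have "card (N (Suc i)) = card (N i) * order (G\<lparr>carrier := N (Suc i)\<rparr> Mod N i)"
      by (simp add: order_def FactGroup_def mult.commute)
    then show ?thesis using N(4) i by (auto simp: p_group_def p'_group_def)
  qed
  show "\<lbrakk>z \<in> carrier G; \<not> p dvd ord z; \<not> p dvd cl z\<rbrakk> \<Longrightarrow> z \<in> V"
    by (rule p_regular_in_core[OF p V _ N(1,2) nN _ fac]) (use *(2) N(4) in blast)+
qed

end

theorem theoremB:
  fixes G :: "('a, 'b) monoid_scheme" and p :: nat and x y :: 'a
    and \<pi>\<^sub>x \<pi>\<^sub>y \<pi> :: "nat set"
  assumes "group G" and "finite (carrier G)"
    and "Factorial_Ring.prime p" and "p_separable p G"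
    and "x \<in> carrier G" and "conj_class G x \<in> p_regular_classes p G" and "x \<notin> center G"
    and "y \<in> carrier G" and "conj_class G y \<in> p_regular_classes p G" and "y \<notin> center G"
    and "graph_dist (common_divisor_graph p G) (conj_class G x) (conj_class G y) = 3"
    and "\<pi>\<^sub>x = class_primes G x" and "\<pi>\<^sub>y = class_primes G y" and "\<pi> = \<pi>\<^sub>x \<union> \<pi>\<^sub>y"
    and "p dvd min (card (conj_class G x)) (card (conj_class G y))"
  shows "p_nilpotent p G \<and>
    (\<forall>H. p_complement p G H \<longrightarrow>
      (let K = pi_core \<pi> (G\<lparr>carrier := H\<rparr>);
           L = pi_core (compl_primes \<pi>) (G\<lparr>carrier := H\<rparr>)
       in internal_direct_product (G\<lparr>carrier := H\<rparr>) K L \<and>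
          quasi_frobenius (G\<lparr>carrier := K\<rparr>) \<and>
          (\<forall>N. qf_kernel (G\<lparr>carrier := K\<rparr>) N \<longrightarrow> comm_group (G\<lparr>carrier := N\<rparr>)) \<and>
          (\<forall>C. qf_complement (G\<lparr>carrier := K\<rparr>) C \<longrightarrow> comm_group (G\<lparr>carrier := C\<rparr>)) \<and>
          (\<forall>C. qf_complement (G\<lparr>carrier := K\<rparr>) C \<longrightarrow>
             (\<exists>P. sylow_subgroup p G P \<and> P \<subseteq> centralizer G C)) \<and>
          center (G\<lparr>carrier := H\<rparr>) = H \<inter> center G))"
proof -
  interpret finite_group G using assms(1,2) by (simp add: finite_group_def finite_group_axioms_def)
  note p = assms(3) and Gs = carrier_subgroup
  note xc = assms(5) and yc = assms(8)
  have xr: "\<not> p dvd ord x" by (rule regular_of_class[OF assms(5,6)])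
  have yr: "\<not> p dvd ord y" by (rule regular_of_class[OF assms(8,9)])
  note gd = graph_dist_three[OF p assms(5-11)]
  note core = p_separable_core[OF p assms(4)]
  have pr: "prime r \<Longrightarrow> r \<in> \<pi> \<longleftrightarrow> r dvd cl x \<or> r dvd cl y" for r
    using assms(12-14) orb_pos[OF Gs, of x] orb_pos[OF Gs, of y]
    by (auto simp: class_primes_eq in_prime_factors_iff)
  \<comment> \<open>Equal coprime sizes would both be 1, against non-centrality.\<close>
  have "cl x \<noteq> cl y"
  proof
    assume e: "cl x = cl y"
    then have "cl x = 1" using gd(1) by simp
    then show False using assms(7) xc orb_one_iff[OF xc] conj_fix[OF xc] by (auto simp: center_eq_cz cz_def)
  qed
  then consider "cl x < cl y" "p dvd cl x" | "cl y < cl x" "p dvd cl y"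
    using assms(15) by (auto simp: conj_class_eq_orb min_def split: if_splits)
  then obtain u v where u: "u \<in> carrier G" "\<not> p dvd ord u" and v: "v \<in> carrier G" "\<not> p dvd ord v"
    and co: "coprime (cl u) (cl v)" and pu: "p dvd cl u" and less: "cl u < cl v"
    and sep: "\<And>z. \<lbrakk>z \<in> carrier G; \<not> p dvd ord z\<rbrakk> \<Longrightarrow> coprime (cl z) (cl u) \<or> coprime (cl z) (cl v)"
    and \<pi>: "\<And>r. prime r \<Longrightarrow> r \<in> \<pi> \<longleftrightarrow> r dvd cl u \<or> r dvd cl v"
  proof cases
    case 1
    then show thesis using that[OF xc xr yc yr gd(1) _ _ gd(2)] pr by blast
  next
    case 2
    then show thesis using that[OF yc yr xc xr] gd pr coprime_commute by blast
  qed
  obtain q k M a b where I: "isolated_pair G p q k (pi_core (compl_primes {p}) G) M a b"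
    and ab: "cl a = cl u" "b \<in> generate G {v}"
    using isolated_pair_exists[OF p core u v co pu less sep] by blast
  interpret I: isolated_pair G p q k "pi_core (compl_primes {p}) G" M a b by (rule I)
  \<comment> \<open>The set pi refers to the given class of \<open>v\<close>, while
    \<open>I.conclusion\<close> speaks of its primary component \<open>b\<close>;
    \<open>primes_of_root_class\<close> identifies their primes.\<close>
  have "r \<in> \<pi> \<longleftrightarrow> r dvd cl a * cl b" if r: "prime r" for r
    using \<pi>[OF r] I.primes_of_root_class[OF v ab(2) _ _ r] co sep ab(1) prime_dvd_mult_iff[OF r] by simp
  then show ?thesis by (rule I.conclusion)
qed

end
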